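(* Let $(M^2(\kappa),g)$ be a pseudo-Riemannian surface of constant Gaussian curvature $\kappa\neq 0$, and let $T_1M^2(\kappa)$ be endowed with the pseudo-Riemannian $g$-natural metric $\tilde G$ of Kaluza-Klein type with parameters $a,c,d$, where $\frac{a+c}{a}=\kappa$ and $|\varphi|=4|\alpha|$ with $\alpha=a(a+c)$, $\varphi=a+c+d$. Let $\lambda=(x,V)$ be a horizontal (non-null, arc length parameterized) Frenet curve on $T_1M^2(\kappa)$ with zero torsion, with first and second causal characters $\varepsilon_\lambda$ and $\varepsilon_1$ and curvature $\kappa_\lambda$. Then $\lambda$ is a helix curve with direction the geodesic vector field on $T_1M^2(\kappa)$ if and only if the following assertions are satisfied: 1. $d\neq 0$ and $a+c-d\neq 0$; 2. $x$ is a geodesic curve; 3. $g(\dot x,V)^2=\frac{\varepsilon_\lambda}{2d}$; 4. the curvature $\kappa_\lambda$ of $\lambda$ is constant, equal to $\kappa_\lambda=\pm\sqrt{\frac{d-(a+c)}{4\varepsilon_1\alpha}}$.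
   Context: $\nabla$ is the Levi-Civita connection of $g$, and $T_1M=\{(x,u)\in TM: g_x(u,u)=1\}$. For $X\in T_xM$, $X^h$ and $X^v$ are the horizontal and vertical lifts (with respect to $\nabla$) of $X$ to $(x,u)$, and $X^t=X^v-g(X,u)u^v$ is the tangential lift; $T_{(x,u)}T_1M=\{X^h+Y^t: X,Y\in T_xM\}$. For real constants $a,c,d$ with $\alpha:=a(a+c)\neq0$ and $\varphi:=a+c+d\neq 0$, the (pseudo-Riemannian) $g$-natural metric of Kaluza-Klein type $\tilde G$ on $T_1M$ is $\tilde G_{(x,u)}(X^h,Y^h)=(a+c)g(X,Y)+d\,g(X,u)g(Y,u)$, $\tilde G_{(x,u)}(X^h,Y^t)=0$, $\tilde G_{(x,u)}(X^t,Y^t)=a\,g(X,Y)-a\,g(X,u)g(Y,u)$; its Levi-Civita connection is $\tilde\nabla$. The geodesic vector field on $T_1M$ is $(x,u)\mapsto u^h$. A curve in $T_1M$ is written $\lambda=(x,V)$ with $x$ a curve in $M$ and $V$ a vector field along $x$ with $g(V,V)=1$; $\lambda'=\dot x^h+(\nabla_{\dot x}V)^t$. The curve $\lambda$ is horizontal if $\nabla_{\dot x}V=0$. A curve $\lambda$ parameterized by (pseudo-)arc length is a helix curve with direction the geodesic vector field if $\tilde G(\lambda',u^h)$ (with $u^h$ evaluated along $\lambda$, i.e. $V^h$) is constant along $\lambda$. A (non-null) Frenet curve is a spacelike or timelike curve $\lambda$ parameterized by arc length, with a $\tilde G$-orthonormal frame $\{T=\lambda',W_1,W_2\}$ along it satisfying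 $\tilde\nabla_TT=\varepsilon_1\kappa_\lambda W_1$, $\tilde\nabla_TW_1=-\varepsilon_\lambda\kappa_\lambda T-\varepsilon_2\tau W_2$, $\tilde\nabla_TW_2=\varepsilon_1\tau W_1$, where $\varepsilon_\lambda=\tilde G(T,T)$, $\varepsilon_1=\tilde G(W_1,W_1)$, $\varepsilon_2=\tilde G(W_2,W_2)$ (each $\pm1$) are the first, second and third causal characters of $\lambda$, $\kappa_\lambda$ (nowhere zero) is its curvature and $\tau$ its torsion. *)

theory Defs
  imports "HOL-Analysis.Analysis"
begin

section \<open>Smooth manifolds given by an atlas\<close>

primrec Ck_on :: "nat \<Rightarrow> ('a::euclidean_space \<Rightarrow> 'b::euclidean_space) \<Rightarrow> 'a set \<Rightarrow> bool" where
  "Ck_on 0 f S \<longleftrightarrow> continuous_on S f"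
| "Ck_on (Suc k) f S \<longleftrightarrow>
     (\<forall>y\<in>S. f differentiable (at y)) \<and> (\<forall>v. Ck_on k (\<lambda>y. frechet_derivative f (at y) v) S)"

definition smooth_on :: "('a::euclidean_space \<Rightarrow> 'b::euclidean_space) \<Rightarrow> 'a set \<Rightarrow> bool" where
  "smooth_on f S \<longleftrightarrow> open S \<and> (\<forall>k. Ck_on k f S)"

text \<open>A chart is a pair of its domain and its coordinate map; only the values of the map on the
  domain matter. The points of the manifold with atlas \<open>A\<close> are those in the chart domains.\<close>

type_synonym ('m, 'e) chart = "'m set \<times> ('m \<Rightarrow> 'e)"

definition param :: "('m, 'e) chart \<Rightarrow> 'e \<Rightarrow> 'm" where
  "param C = inv_into (fst C) (snd C)"

definition points :: "('m, 'e) chart set \<Rightarrow> 'm set" where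
  "points A = (\<Union>C\<in>A. fst C)"

definition charts_at :: "('m, 'e) chart set \<Rightarrow> 'm \<Rightarrow> ('m, 'e) chart set" where
  "charts_at A p = {C \<in> A. p \<in> fst C}"

definition transition :: "('m, 'e) chart \<Rightarrow> ('m, 'e) chart \<Rightarrow> 'e \<Rightarrow> 'e" where
  "transition C D = snd D \<circ> param C"

definition smooth_atlas :: "('m, 'e::euclidean_space) chart set \<Rightarrow> bool" where
  "smooth_atlas A \<longleftrightarrow>
     (\<forall>C\<in>A. inj_on (snd C) (fst C) \<and> open (snd C ` fst C)) \<and>
     (\<forall>C\<in>A. \<forall>D\<in>A. smooth_on (transition C D) (snd C ` (fst C \<inter> fst D)))"

definition atlas_topology :: "('m, 'e::euclidean_space) chart set \<Rightarrow> 'm topology" where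
  "atlas_topology A =
     topology (\<lambda>U. U \<subseteq> points A \<and> (\<forall>C\<in>A. open (snd C ` (U \<inter> fst C))))"

lemma openin_atlas_topology:
  assumes "smooth_atlas A"
  shows "openin (atlas_topology A) U \<longleftrightarrow>
           U \<subseteq> points A \<and> (\<forall>C\<in>A. open (snd C ` (U \<inter> fst C)))"
proof -
  have inj: "inj_on (snd C) (fst C)" if "C \<in> A" for C
    using assms that by (auto simp: smooth_atlas_def)
  have 1: "open (snd C ` (S \<inter> T \<inter> fst C))"
    if "C \<in> A" "open (snd C ` (S \<inter> fst C))" "open (snd C ` (T \<inter> fst C))" for C S T
  proof -
    have "snd C ` (S \<inter> T \<inter> fst C) = snd C ` (S \<inter> fst C) \<inter> snd C ` (T \<inter> fst C)"
      using inj[OF that(1)] by (auto simp: inj_on_def)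
    then show ?thesis using that by auto
  qed
  have 2: "open (snd C ` (\<Union>\<K> \<inter> fst C))" if "\<And>K. K \<in> \<K> \<Longrightarrow> open (snd C ` (K \<inter> fst C))" for C \<K>
  proof -
    have "snd C ` (\<Union>\<K> \<inter> fst C) = (\<Union>K\<in>\<K>. snd C ` (K \<inter> fst C))" by auto
    then show ?thesis using that by auto
  qed
  have "istopology (\<lambda>U. U \<subseteq> points A \<and> (\<forall>C\<in>A. open (snd C ` (U \<inter> fst C))))"
    unfolding istopology_def using 1 2 by (fastforce intro!: 1 2)
  then show ?thesis by (simp add: atlas_topology_def topology_inverse')
qed

definition smooth_manifold :: "('m, 'e::euclidean_space) chart set \<Rightarrow> bool" where
  "smooth_manifold A \<longleftrightarrow>
     smooth_atlas A \<and> Hausdorff_space (atlas_topology A) \<and> second_countable (atlas_topology A)"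


section \<open>Tangent vectors and pseudo-Riemannian metrics\<close>

text \<open>A tangent vector at \<open>p\<close> is the family of its components in the charts around \<open>p\<close>, related by
  the Jacobians of the transition maps; entries for other charts are \<open>0\<close>.\<close>

type_synonym ('m, 'e) tvec = "('m, 'e) chart \<Rightarrow> 'e"

definition tangent_space ::
  "('m, 'e::euclidean_space) chart set \<Rightarrow> 'm \<Rightarrow> ('m, 'e) tvec set" where
  "tangent_space A p =
     {X. (\<forall>C\<in>charts_at A p. \<forall>D\<in>charts_at A p.
            X D = frechet_derivative (transition C D) (at (snd C p)) (X C)) \<and>
         (\<forall>C. C \<notin> charts_at A p \<longrightarrow> X C = 0)}"

definition tvec_of ::
  "('m, 'e::euclidean_space) chart set \<Rightarrow> 'm \<Rightarrow> ('m, 'e) chart \<Rightarrow> 'e \<Rightarrow> ('m, 'e) tvec" where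
  "tvec_of A p C v =
     (\<lambda>D. if D \<in> charts_at A p then frechet_derivative (transition C D) (at (snd C p)) v else 0)"

type_synonym ('m, 'e) metric = "'m \<Rightarrow> ('m, 'e) tvec \<Rightarrow> ('m, 'e) tvec \<Rightarrow> real"

definition in_chart ::
  "('m, 'e::euclidean_space) chart set \<Rightarrow> ('m, 'e) metric \<Rightarrow> ('m, 'e) chart \<Rightarrow> 'e \<Rightarrow> 'e \<Rightarrow> 'e \<Rightarrow> real"
  where
  "in_chart A g C y v w =
     g (param C y) (tvec_of A (param C y) C v) (tvec_of A (param C y) C w)"

definition form_index :: "('e::euclidean_space \<Rightarrow> 'e \<Rightarrow> real) \<Rightarrow> nat" where
  "form_index B = Max {dim S | S. subspace S \<and> (\<forall>v\<in>S. v \<noteq> 0 \<longrightarrow> B v v < 0)}"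

definition pseudo_riemannian_metric ::
  "('m, 'e::euclidean_space) chart set \<Rightarrow> ('m, 'e) metric \<Rightarrow> bool" where
  "pseudo_riemannian_metric A g \<longleftrightarrow>
     (\<forall>C\<in>A. \<forall>y\<in>snd C ` fst C.
        bilinear (in_chart A g C y) \<and>
        (\<forall>v w. in_chart A g C y v w = in_chart A g C y w v) \<and>
        (\<forall>v. (\<forall>w. in_chart A g C y v w = 0) \<longrightarrow> v = 0)) \<and>
     (\<forall>C\<in>A. \<forall>v w. smooth_on (\<lambda>y. in_chart A g C y v w) (snd C ` fst C)) \<and>
     (\<exists>\<nu>. \<forall>C\<in>A. \<forall>y\<in>snd C ` fst C. form_index (in_chart A g C y) = \<nu>)"


section \<open>Levi-Civita connection and curvature\<close>

text \<open>In a chart a connection is \<open>\<nabla>\<^bsub>X\<^esub> Y = D Y(X) + \<Gamma>(X, Y)\<close> with \<open>\<Gamma>\<close> bilinear at each point. It is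
  torsion-free iff \<open>\<Gamma>\<close> is symmetric, and \<open>metric\<close> iff the displayed product rule holds for
  constant fields \<open>v, w\<close>.\<close>

definition levi_civita_at ::
  "('m, 'e::euclidean_space) chart set \<Rightarrow> ('m, 'e) metric \<Rightarrow> ('m, 'e) chart \<Rightarrow> 'e \<Rightarrow>
     ('e \<Rightarrow> 'e \<Rightarrow> 'e) \<Rightarrow> bool" where
  "levi_civita_at A g C y \<Gamma> \<longleftrightarrow>
     bilinear \<Gamma> \<and> (\<forall>v w. \<Gamma> v w = \<Gamma> w v) \<and>
     (\<forall>u v w. frechet_derivative (\<lambda>z. in_chart A g C z v w) (at y) u =
        in_chart A g C y (\<Gamma> u v) w + in_chart A g C y v (\<Gamma> u w))"

definition christoffel ::
  "('m, 'e::euclidean_space) chart set \<Rightarrow> ('m, 'e) metric \<Rightarrow> ('m, 'e) chart \<Rightarrow> 'e \<Rightarrow> 'e \<Rightarrow> 'e \<Rightarrow> 'e"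
  where
  "christoffel A g C y = (THE \<Gamma>. levi_civita_at A g C y \<Gamma>)"

lemma nondegenerate_riesz:
  fixes B :: "'e::euclidean_space \<Rightarrow> 'e \<Rightarrow> real"
  assumes B: "bilinear B" and nd: "\<And>v. (\<forall>w. B v w = 0) \<Longrightarrow> v = 0" and f: "linear f"
  shows "\<exists>!z. \<forall>w. B z w = f w"
proof -
  define L where "L v = (\<Sum>b\<in>Basis. B v b *\<^sub>R b)" for v
  have lin: "linear L"
    unfolding L_def using B
    by (intro linearI) (simp_all add: bilinear_ladd bilinear_lmul sum.distrib scaleR_add_left
        scaleR_sum_right)
  have Lb: "L v \<bullet> b = B v b" if "b \<in> Basis" for v b
    using that by (simp add: L_def inner_sum_left inner_Basis if_distrib cong: if_cong)
  have ext: "h = k" if "linear h" "linear k" "\<And>b. b \<in> Basis \<Longrightarrow> h b = k b" for h k :: "'e \<Rightarrow> real"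
    using linear_eq_stdbasis[OF that] by auto
  have linB: "linear (B v)" for v using B by (simp add: bilinear_def)
  have l0: "linear (\<lambda>_::'e. 0::real)" by (simp add: linear_iff)
  have inj: "inj L"
  proof (subst linear_injective_0[OF lin], intro allI impI)
    fix v assume "L v = 0"
    then have "B v b = 0" if "b \<in> Basis" for b using Lb[OF that, of v] by simp
    then have "B v = (\<lambda>_. 0)" by (intro ext[OF linB l0])
    then show "v = 0" using nd[of v] by simp
  qed
  then have "surj L" using linear_injective_imp_surjective[OF lin] by simp
  then obtain z where z: "L z = (\<Sum>b\<in>Basis. f b *\<^sub>R b)" by (metis surj_def)
  have "B z = f"
  proof (rule ext[OF linB f])
    fix b :: 'e assume b: "b \<in> Basis"
    have "B z b = L z \<bullet> b" using Lb[OF b] by simp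
    also have "\<dots> = f b"
      using b by (simp add: z inner_sum_left inner_Basis if_distrib cong: if_cong)
    finally show "B z b = f b" .
  qed
  moreover have "z' = z" if "\<forall>w. B z' w = f w" for z'
  proof -
    have "B (z' - z) w = 0" for w using B \<open>B z = f\<close> that by (simp add: bilinear_lsub)
    then show ?thesis using nd[of "z' - z"] by simp
  qed
  ultimately show ?thesis by (metis)
qed

lemma christoffel_unique:
  assumes g: "pseudo_riemannian_metric A g" and C: "C \<in> A" and y: "y \<in> snd C ` fst C"
  shows "\<exists>!\<Gamma>. levi_civita_at A g C y \<Gamma>"
proof -
  define S where "S = snd C ` fst C"
  define h where "h = in_chart A g C"
  define D where "D u v w = frechet_derivative (\<lambda>z. h z v w) (at y) u" for u v w
  have bil: "bilinear (h z)" if "z \<in> S" for z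
    using g C that by (auto simp: pseudo_riemannian_metric_def S_def h_def)
  have sym: "h z v w = h z w v" if "z \<in> S" for z v w
    using g C that by (auto simp: pseudo_riemannian_metric_def S_def h_def)
  have nd: "v = 0" if "\<forall>w. h y v w = 0" for v
    using g C y that by (auto simp: pseudo_riemannian_metric_def h_def)
  have sm: "smooth_on (\<lambda>z. h z v w) S" for v w
    using g C by (auto simp: pseudo_riemannian_metric_def h_def S_def)
  have S: "open S" using sm by (auto simp: smooth_on_def)
  have yS: "y \<in> S" using y by (simp add: S_def)
  have "Ck_on (Suc 0) (\<lambda>z. h z v w) S" for v w using sm by (auto simp: smooth_on_def)
  then have df: "(\<lambda>z. h z v w) differentiable (at y)" for v w using yS by auto
  have der: "((\<lambda>z. h z v w) has_derivative (\<lambda>u. D u v w)) (at y)" for v w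
    using df[of v w, unfolded frechet_derivative_works] by (simp add: D_def[abs_def])
  have D1: "linear (\<lambda>u. D u v w)" for v w by (rule has_derivative_linear[OF der])
  have uniq: "F = (\<lambda>u. D u v w)" if "(k has_derivative F) (at y)" "\<And>z. z \<in> S \<Longrightarrow> k z = h z v w"
    for F k v w
    using has_derivative_unique[OF has_derivative_transform_within_open[OF that(1) S yS that(2)] der]
    by simp
  have D3: "linear (\<lambda>w. D u v w)" for u v
  proof (rule linearI)
    fix w w'
    have "((\<lambda>z. h z v w + h z v w') has_derivative (\<lambda>u. D u v w + D u v w')) (at y)"
      by (intro has_derivative_add der)
    then have "(\<lambda>u. D u v w + D u v w') = (\<lambda>u. D u v (w + w'))"
      by (rule uniq) (simp add: bilinear_radd[OF bil])
    then show "D u v (w + w') = D u v w + D u v w'" by (rule fun_cong[symmetric])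
  next
    fix r w
    have "((\<lambda>z. r *\<^sub>R h z v w) has_derivative (\<lambda>u. r *\<^sub>R D u v w)) (at y)"
      by (intro has_derivative_scaleR_right der)
    then have "(\<lambda>u. r *\<^sub>R D u v w) = (\<lambda>u. D u v (r *\<^sub>R w))"
      by (rule uniq) (simp add: bilinear_rmul[OF bil])
    then show "D u v (r *\<^sub>R w) = r *\<^sub>R D u v w" by (rule fun_cong[symmetric])
  qed
  have Dsym: "D u v w = D u w v" for u v w
  proof -
    have "(\<lambda>u. D u v w) = (\<lambda>u. D u w v)" by (rule uniq[OF der]) (rule sym)
    then show ?thesis by (rule fun_cong)
  qed
  have D2: "linear (\<lambda>v. D u v w)" for u w by (subst Dsym) (rule D3)
  define P where "P v w k = (D v w k + D w v k - D k v w) / 2" for v w k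
  have linP: "linear (P v w)" for v w
  proof (rule linearI)
    note add = linear_add[OF D1] linear_add[OF D3]
    note scale = linear_scale[OF D1] linear_scale[OF D3]
    fix k k' and r :: real
    show "P v w (k + k') = P v w k + P v w k'"
      unfolding P_def add by (simp add: field_simps)
    show "P v w (r *\<^sub>R k) = r *\<^sub>R P v w k"
      unfolding P_def scale by (simp add: field_simps)
  qed
  note riesz = nondegenerate_riesz[OF bil[OF yS] nd linP]
  define \<Gamma> where "\<Gamma> v w = (THE z. \<forall>k. h y z k = P v w k)" for v w
  have \<Gamma>: "h y (\<Gamma> v w) k = P v w k" for v w k
    using theI'[OF riesz[of v w]] by (simp add: \<Gamma>_def)
  have cancel: "z = z'" if "\<And>k. h y z k = h y z' k" for z z'
    using nd[of "z - z'"] that bil[OF yS] by (simp add: bilinear_lsub)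
  note B = bilinear_ladd[OF bil[OF yS]] bilinear_lmul[OF bil[OF yS]]
  have "levi_civita_at A g C y \<Gamma>"
    unfolding levi_civita_at_def h_def[symmetric] D_def[symmetric]
  proof (intro conjI allI)
    show "\<Gamma> v w = \<Gamma> w v" for v w
      by (rule cancel) (simp only: \<Gamma> P_def Dsym[of _ v w] add.commute)
    show "bilinear \<Gamma>"
      unfolding bilinear_def
    proof (intro conjI allI linearI cancel)
      note add = linear_add[OF D1] linear_add[OF D2] linear_add[OF D3]
      note scale = linear_scale[OF D1] linear_scale[OF D2] linear_scale[OF D3]
      fix v w w' k and r :: real
      show "h y (\<Gamma> v (w + w')) k = h y (\<Gamma> v w + \<Gamma> v w') k"
        "h y (\<Gamma> (w + w') v) k = h y (\<Gamma> w v + \<Gamma> w' v) k"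
        unfolding B \<Gamma> P_def add by (simp_all add: field_simps)
      show "h y (\<Gamma> v (r *\<^sub>R w)) k = h y (r *\<^sub>R \<Gamma> v w) k"
        "h y (\<Gamma> (r *\<^sub>R w) v) k = h y (r *\<^sub>R \<Gamma> w v) k"
        unfolding B \<Gamma> P_def scale by (simp_all add: field_simps)
    qed
    show "D u v w = h y (\<Gamma> u v) w + h y v (\<Gamma> u w)" for u v w
      unfolding sym[OF yS, of v "\<Gamma> u w"] \<Gamma> P_def Dsym[of w v u] Dsym[of v w u] Dsym[of u w v]
      by (simp add: field_simps)
  qed
  moreover have "\<Gamma>' = \<Gamma>" if "levi_civita_at A g C y \<Gamma>'" for \<Gamma>'
  proof (intro ext cancel)
    fix v w k
    have s: "\<Gamma>' v w = \<Gamma>' w v" for v w using that by (simp add: levi_civita_at_def)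
    have m: "D u v w = h y (\<Gamma>' u v) w + h y v (\<Gamma>' u w)" for u v w
      using that by (simp add: levi_civita_at_def h_def D_def)
    show "h y (\<Gamma>' v w) k = h y (\<Gamma> v w) k"
      unfolding \<Gamma> P_def m s[of w v] s[of k v] s[of k w] sym[OF yS, of w] sym[OF yS, of v]
      by simp
  qed
  ultimately show ?thesis by blast
qed

text \<open>The components in a chart of \<open>R(X,Y)Z = \<nabla>\<^bsub>X\<^esub>\<nabla>\<^bsub>Y\<^esub>Z - \<nabla>\<^bsub>Y\<^esub>\<nabla>\<^bsub>X\<^esub>Z - \<nabla>\<^bsub>[X,Y]\<^esub>Z\<close>.\<close>

definition riemann ::
  "('m, 'e::euclidean_space) chart set \<Rightarrow> ('m, 'e) metric \<Rightarrow> ('m, 'e) chart \<Rightarrow> 'e \<Rightarrow>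
     'e \<Rightarrow> 'e \<Rightarrow> 'e \<Rightarrow> 'e" where
  "riemann A g C y X Y Z =
     (let \<Gamma> = christoffel A g C in
        frechet_derivative (\<lambda>z. \<Gamma> z Y Z) (at y) X - frechet_derivative (\<lambda>z. \<Gamma> z X Z) (at y) Y
        + \<Gamma> y X (\<Gamma> y Y Z) - \<Gamma> y Y (\<Gamma> y X Z))"

text \<open>In dimension two, \<open>X, Y\<close> form a basis of the tangent plane iff the denominator is nonzero.\<close>

definition constant_gaussian_curvature ::
  "('m, real^2) chart set \<Rightarrow> ('m, real^2) metric \<Rightarrow> real \<Rightarrow> bool" where
  "constant_gaussian_curvature A g \<kappa> \<longleftrightarrow>
     (\<forall>C\<in>A. \<forall>y\<in>snd C ` fst C. \<forall>X Y.
        (let h = in_chart A g C y; Q = h X X * h Y Y - (h X Y)\<^sup>2 in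
           Q \<noteq> 0 \<longrightarrow> h (riemann A g C y X Y Y) X / Q = \<kappa>))"


section \<open>Curves\<close>

definition smooth_curve ::
  "('m, 'e::euclidean_space) chart set \<Rightarrow> real set \<Rightarrow> (real \<Rightarrow> 'm) \<Rightarrow> bool" where
  "smooth_curve A I x \<longleftrightarrow>
     (\<forall>t\<in>I. x t \<in> points A) \<and> (\<forall>C\<in>A. smooth_on (snd C \<circ> x) {t\<in>I. x t \<in> fst C})"

definition velocity ::
  "('m, 'e::euclidean_space) chart set \<Rightarrow> (real \<Rightarrow> 'm) \<Rightarrow> real \<Rightarrow> ('m, 'e) tvec" where
  "velocity A x t =
     (\<lambda>C. if C \<in> charts_at A (x t) then vector_derivative (snd C \<circ> x) (at t) else 0)"

definition smooth_field_along ::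
  "('m, 'e::euclidean_space) chart set \<Rightarrow> real set \<Rightarrow> (real \<Rightarrow> 'm) \<Rightarrow> (real \<Rightarrow> ('m, 'e) tvec) \<Rightarrow> bool"
  where
  "smooth_field_along A I x V \<longleftrightarrow>
     (\<forall>t\<in>I. V t \<in> tangent_space A (x t)) \<and>
     (\<forall>C\<in>A. smooth_on (\<lambda>t. V t C) {t\<in>I. x t \<in> fst C})"

definition cov_deriv ::
  "('m, 'e::euclidean_space) chart set \<Rightarrow> ('m, 'e) metric \<Rightarrow> (real \<Rightarrow> 'm) \<Rightarrow>
     (real \<Rightarrow> ('m, 'e) tvec) \<Rightarrow> real \<Rightarrow> ('m, 'e) tvec" where
  "cov_deriv A g x V t =
     (\<lambda>C. if C \<in> charts_at A (x t)
          then vector_derivative (\<lambda>s. V s C) (at t)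
               + christoffel A g C (snd C (x t)) (velocity A x t C) (V t C)
          else 0)"

definition geodesic_curve ::
  "('m, 'e::euclidean_space) chart set \<Rightarrow> ('m, 'e) metric \<Rightarrow> real set \<Rightarrow> (real \<Rightarrow> 'm) \<Rightarrow> bool" where
  "geodesic_curve A g I x \<longleftrightarrow>
     smooth_curve A I x \<and> (\<forall>t\<in>I. cov_deriv A g x (velocity A x) t = (\<lambda>_. 0))"

definition frenet_curve ::
  "('m, 'e::euclidean_space) chart set \<Rightarrow> ('m, 'e) metric \<Rightarrow> real set \<Rightarrow> (real \<Rightarrow> 'm) \<Rightarrow>
     (real \<Rightarrow> ('m, 'e) tvec) \<Rightarrow> (real \<Rightarrow> ('m, 'e) tvec) \<Rightarrow> real \<Rightarrow> real \<Rightarrow> real \<Rightarrow>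
     (real \<Rightarrow> real) \<Rightarrow> (real \<Rightarrow> real) \<Rightarrow> bool" where
  "frenet_curve A G I x W1 W2 \<epsilon> \<epsilon>1 \<epsilon>2 \<kappa> \<tau> \<longleftrightarrow>
     (let T = velocity A x in
        smooth_curve A I x \<and> smooth_field_along A I x W1 \<and> smooth_field_along A I x W2 \<and>
        \<epsilon> \<in> {1, -1} \<and> \<epsilon>1 \<in> {1, -1} \<and> \<epsilon>2 \<in> {1, -1} \<and>
        (\<forall>t\<in>I.
           G (x t) (T t) (T t) = \<epsilon> \<and> G (x t) (W1 t) (W1 t) = \<epsilon>1 \<and> G (x t) (W2 t) (W2 t) = \<epsilon>2 \<and>
           G (x t) (T t) (W1 t) = 0 \<and> G (x t) (T t) (W2 t) = 0 \<and> G (x t) (W1 t) (W2 t) = 0 \<and>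
           \<kappa> t \<noteq> 0 \<and>
           cov_deriv A G x T t = (\<lambda>C. (\<epsilon>1 * \<kappa> t) *\<^sub>R W1 t C) \<and>
           cov_deriv A G x W1 t = (\<lambda>C. - (\<epsilon> * \<kappa> t) *\<^sub>R T t C - (\<epsilon>2 * \<tau> t) *\<^sub>R W2 t C) \<and>
           cov_deriv A G x W2 t = (\<lambda>C. (\<epsilon>1 * \<tau> t) *\<^sub>R W1 t C)))"


section \<open>The unit tangent bundle\<close>

type_synonym ('m, 'e) tpoint = "'m \<times> ('m, 'e) tvec"

definition unit_tangent_bundle ::
  "('m, real^2) chart set \<Rightarrow> ('m, real^2) metric \<Rightarrow> ('m, real^2) tpoint set" where
  "unit_tangent_bundle A g =
     {(p, u). p \<in> points A \<and> u \<in> tangent_space A p \<and> g p u u = 1}"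

text \<open>The coordinates \<open>(x\<^sup>i, u\<^sup>i)\<close> on the tangent bundle induced by a chart of the surface.\<close>

definition bundle_coords :: "('m, 'e) chart \<Rightarrow> ('m, 'e) tpoint \<Rightarrow> 'e \<times> 'e" where
  "bundle_coords C q = (snd C (fst q), snd q C)"

text \<open>The charts of the three-dimensional submanifold \<open>T\<^sub>1M\<close> of \<open>TM\<close>: the inverses of its injective
  immersed parametrizations by open sets of \<open>\<real>\<^sup>3\<close>. By equality of dimensions such an immersion is
  automatically a diffeomorphism onto an open subset of \<open>T\<^sub>1M\<close>.\<close>

definition unit_bundle_atlas ::
  "('m, real^2) chart set \<Rightarrow> ('m, real^2) metric \<Rightarrow> (('m, real^2) tpoint, real^3) chart set" where
  "unit_bundle_atlas A g =
     {\<Psi>. fst \<Psi> \<subseteq> unit_tangent_bundle A g \<and>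
         inj_on (snd \<Psi>) (fst \<Psi>) \<and> open (snd \<Psi> ` fst \<Psi>) \<and>
         (\<exists>C\<in>A. fst ` fst \<Psi> \<subseteq> fst C \<and>
            smooth_on (bundle_coords C \<circ> param \<Psi>) (snd \<Psi> ` fst \<Psi>) \<and>
            (\<forall>y\<in>snd \<Psi> ` fst \<Psi>. inj (frechet_derivative (bundle_coords C \<circ> param \<Psi>) (at y))))}"

text \<open>A vector \<open>\<xi>\<close> tangent to \<open>TM\<close> at \<open>q = (p, u)\<close> is given by the family of its components
  \<open>(dx\<^sup>i(\<xi>), du\<^sup>i(\<xi>))\<close> in the coordinates induced by the charts of the surface around \<open>p\<close>.\<close>

type_synonym ('m, 'e) ttvec = "('m, 'e) chart \<Rightarrow> 'e \<times> 'e"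

definition horizontal_lift ::
  "('m, real^2) chart set \<Rightarrow> ('m, real^2) metric \<Rightarrow> ('m, real^2) tpoint \<Rightarrow>
     ('m, real^2) tvec \<Rightarrow> ('m, real^2) ttvec" where
  "horizontal_lift A g q X =
     (\<lambda>C. if C \<in> charts_at A (fst q)
          then (X C, - christoffel A g C (snd C (fst q)) (X C) (snd q C)) else 0)"

definition vertical_lift ::
  "('m, real^2) chart set \<Rightarrow> ('m, real^2) tpoint \<Rightarrow> ('m, real^2) tvec \<Rightarrow> ('m, real^2) ttvec" where
  "vertical_lift A q X = (\<lambda>C. if C \<in> charts_at A (fst q) then (0, X C) else 0)"

definition tangential_lift ::
  "('m, real^2) chart set \<Rightarrow> ('m, real^2) metric \<Rightarrow> ('m, real^2) tpoint \<Rightarrow>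
     ('m, real^2) tvec \<Rightarrow> ('m, real^2) ttvec" where
  "tangential_lift A g q X =
     (\<lambda>C. vertical_lift A q X C - g (fst q) X (snd q) *\<^sub>R vertical_lift A q (snd q) C)"

text \<open>The vectors \<open>X, Y\<close> with \<open>\<xi> = X\<^sup>h + Y\<^sup>v\<close>: the projection of \<open>\<xi>\<close> to \<open>M\<close> and its image under the
  connection map.\<close>

definition horizontal_part ::
  "('m, real^2) chart set \<Rightarrow> ('m, real^2) tpoint \<Rightarrow> ('m, real^2) ttvec \<Rightarrow> ('m, real^2) tvec" where
  "horizontal_part A q \<xi> = (\<lambda>C. if C \<in> charts_at A (fst q) then fst (\<xi> C) else 0)"

definition vertical_part ::
  "('m, real^2) chart set \<Rightarrow> ('m, real^2) metric \<Rightarrow> ('m, real^2) tpoint \<Rightarrow>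
     ('m, real^2) ttvec \<Rightarrow> ('m, real^2) tvec" where
  "vertical_part A g q \<xi> =
     (\<lambda>C. if C \<in> charts_at A (fst q)
          then snd (\<xi> C) + christoffel A g C (snd C (fst q)) (fst (\<xi> C)) (snd q C) else 0)"

text \<open>The metric of Kaluza-Klein type. On the vectors \<open>X\<^sup>h + Y\<^sup>t\<close>, which span the tangent space of
  \<open>T\<^sub>1M\<close>, it takes the values by which it is usually defined: see \<open>kaluza_klein_lifts\<close> below.\<close>

definition kaluza_klein ::
  "('m, real^2) chart set \<Rightarrow> ('m, real^2) metric \<Rightarrow> real \<Rightarrow> real \<Rightarrow> real \<Rightarrow>
     ('m, real^2) tpoint \<Rightarrow> ('m, real^2) ttvec \<Rightarrow> ('m, real^2) ttvec \<Rightarrow> real" where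
  "kaluza_klein A g a c d q \<xi> \<eta> =
     (let p = fst q; u = snd q;
          X = horizontal_part A q \<xi>; X' = horizontal_part A q \<eta>;
          Y = vertical_part A g q \<xi>; Y' = vertical_part A g q \<eta>
      in (a + c) * g p X X' + d * g p X u * g p X' u
         + a * g p Y Y' - a * g p Y u * g p Y' u)"

lemma metric_in_chart:
  assumes "smooth_manifold A" "X \<in> tangent_space A p" "Y \<in> tangent_space A p" "C \<in> charts_at A p"
  shows "g p X Y = in_chart A g C (snd C p) (X C) (Y C)"
proof -
  have "param C (snd C p) = p"
  proof -
    have "inj_on (snd C) (fst C)" "p \<in> fst C"
      using assms(1,4) unfolding smooth_manifold_def smooth_atlas_def charts_at_def by blast+
    then show ?thesis by (simp add: param_def)
  qed
  moreover have "tvec_of A p C (Z C) = Z" if "Z \<in> tangent_space A p" for Z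
  proof
    fix D
    have "Z D = frechet_derivative (transition C D) (at (snd C p)) (Z C)" if "D \<in> charts_at A p"
      using \<open>Z \<in> _\<close> assms(4) that unfolding tangent_space_def by blast
    moreover have "Z D = 0" if "D \<notin> charts_at A p"
      using \<open>Z \<in> _\<close> that unfolding tangent_space_def by blast
    ultimately have "Z D = (if D \<in> charts_at A p
        then frechet_derivative (transition C D) (at (snd C p)) (Z C) else 0)"
      by (cases "D \<in> charts_at A p") (simp_all only: if_True if_False not_True_eq_False not_False_eq_True)
    then show "tvec_of A p C (Z C) D = Z D" by (simp only: tvec_of_def)
  qed
  ultimately show ?thesis using assms(2,3) by (simp only: in_chart_def)
qed

lemma tangent_space_combination:
  assumes A: "smooth_manifold A" and X: "X \<in> tangent_space A p" and Y: "Y \<in> tangent_space A p"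
  shows "(\<lambda>C. X C - s *\<^sub>R Y C) \<in> tangent_space A p"
proof -
  have "linear (frechet_derivative (transition C D) (at (snd C p)))"
    if "C \<in> charts_at A p" "D \<in> charts_at A p" for C D
  proof -
    have "smooth_on (transition C D) (snd C ` (fst C \<inter> fst D))"
      using A that by (auto simp: smooth_manifold_def smooth_atlas_def charts_at_def)
    then have "Ck_on (Suc 0) (transition C D) (snd C ` (fst C \<inter> fst D))"
      by (simp only: smooth_on_def)
    then have "transition C D differentiable (at (snd C p))"
      using that by (auto simp: charts_at_def)
    then show ?thesis by (rule linear_frechet_derivative)
  qed
  note lin = this
  show ?thesis
    unfolding tangent_space_def
  proof (intro CollectI conjI ballI allI impI)
    fix C D assume CD: "C \<in> charts_at A p" "D \<in> charts_at A p"
    let ?F = "frechet_derivative (transition C D) (at (snd C p))"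
    have "X D = ?F (X C)" "Y D = ?F (Y C)" using X Y CD unfolding tangent_space_def by blast+
    then show "X D - s *\<^sub>R Y D = ?F (X C - s *\<^sub>R Y C)"
      by (simp only: linear_diff[OF lin[OF CD]] linear_scale[OF lin[OF CD]])
  next
    fix C assume "C \<notin> charts_at A p"
    then have "X C = 0" "Y C = 0" using X Y unfolding tangent_space_def by blast+
    then show "X C - s *\<^sub>R Y C = 0" by simp
  qed
qed

theorem kaluza_klein_lifts:
  assumes A: "smooth_manifold A" and g: "pseudo_riemannian_metric A g"
    and q: "q \<in> unit_tangent_bundle A g" and pu: "q = (p, u)"
    and X: "X \<in> tangent_space A p" "X' \<in> tangent_space A p"
    and Y: "Y \<in> tangent_space A p" "Y' \<in> tangent_space A p"
  shows "kaluza_klein A g a c d q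
           (\<lambda>C. horizontal_lift A g q X C + tangential_lift A g q Y C)
           (\<lambda>C. horizontal_lift A g q X' C + tangential_lift A g q Y' C)
         = ((a + c) * g p X X' + d * g p X u * g p X' u) + (a * g p Y Y' - a * g p Y u * g p Y' u)"
proof -
  have u: "u \<in> tangent_space A p" "g p u u = 1" and "p \<in> points A"
    using q pu by (auto simp: unit_tangent_bundle_def)
  then obtain C where C: "C \<in> charts_at A p" by (auto simp: points_def charts_at_def)
  have bil: "bilinear (in_chart A g C (snd C p))"
    and sym: "in_chart A g C (snd C p) v w = in_chart A g C (snd C p) w v" for v w
    using g C by (auto simp: pseudo_riemannian_metric_def charts_at_def)
  have zero: "Z C = 0" if "Z \<in> tangent_space A p" "C \<notin> charts_at A p" for Z C
    using that unfolding tangent_space_def by blast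
  have hp: "horizontal_part A q (\<lambda>C. horizontal_lift A g q X C + tangential_lift A g q Y C) = X"
    if "X \<in> tangent_space A p" for X Y
    using zero[OF that] by (auto simp: horizontal_part_def horizontal_lift_def
        tangential_lift_def vertical_lift_def pu)
  have vp: "vertical_part A g q (\<lambda>C. horizontal_lift A g q X C + tangential_lift A g q Y C)
      = (\<lambda>C. Y C - g p Y u *\<^sub>R u C)" if "Y \<in> tangent_space A p" for X Y
    using zero[OF that] zero[OF u(1)] by (auto simp: vertical_part_def horizontal_lift_def
        tangential_lift_def vertical_lift_def pu)
  note mc = metric_in_chart[OF A _ _ C, of _ _ g]
  note ts = tangent_space_combination[OF A _ u(1)]
  have uu: "in_chart A g C (snd C p) (u C) (u C) = 1" using mc[OF u(1) u(1)] u(2) by simp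
  show ?thesis
    unfolding kaluza_klein_def Let_def hp[OF X(1)] hp[OF X(2)] vp[OF Y(1)] vp[OF Y(2)]
    unfolding pu fst_conv snd_conv
      mc[OF X] mc[OF X(1) u(1)] mc[OF X(2) u(1)] mc[OF Y] mc[OF Y(1) u(1)] mc[OF Y(2) u(1)]
      mc[OF ts[OF Y(1)] ts[OF Y(2)]] mc[OF ts[OF Y(1)] u(1)] mc[OF ts[OF Y(2)] u(1)]
      bilinear_lsub[OF bil] bilinear_rsub[OF bil] bilinear_lmul[OF bil] bilinear_rmul[OF bil]
      uu sym[of "u C" "Y' C"]
    by (simp add: algebra_simps)
qed

text \<open>The differential of the inclusion of \<open>T\<^sub>1M\<close> in \<open>TM\<close>; it does not depend on the chosen chart.\<close>

definition inclusion_diff ::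
  "('m, real^2) chart set \<Rightarrow> ('m, real^2) metric \<Rightarrow> ('m, real^2) tpoint \<Rightarrow>
     (('m, real^2) tpoint, real^3) tvec \<Rightarrow> ('m, real^2) ttvec" where
  "inclusion_diff A g q \<xi> =
     (let \<Psi> = (SOME \<Psi>. \<Psi> \<in> charts_at (unit_bundle_atlas A g) q) in
        (\<lambda>C. if C \<in> charts_at A (fst q)
             then frechet_derivative (bundle_coords C \<circ> param \<Psi>) (at (snd \<Psi> q)) (\<xi> \<Psi>) else 0))"

definition kk_metric ::
  "('m, real^2) chart set \<Rightarrow> ('m, real^2) metric \<Rightarrow> real \<Rightarrow> real \<Rightarrow> real \<Rightarrow>
     (('m, real^2) tpoint, real^3) metric" where
  "kk_metric A g a c d q \<xi> \<eta> =
     kaluza_klein A g a c d q (inclusion_diff A g q \<xi>) (inclusion_diff A g q \<eta>)"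

definition horizontal_curve ::
  "('m, real^2) chart set \<Rightarrow> ('m, real^2) metric \<Rightarrow> real set \<Rightarrow> (real \<Rightarrow> ('m, real^2) tpoint) \<Rightarrow> bool"
  where
  "horizontal_curve A g I \<gamma> \<longleftrightarrow> (\<forall>t\<in>I. cov_deriv A g (fst \<circ> \<gamma>) (snd \<circ> \<gamma>) t = (\<lambda>_. 0))"

definition helix_geodesic_field ::
  "('m, real^2) chart set \<Rightarrow> ('m, real^2) metric \<Rightarrow> real \<Rightarrow> real \<Rightarrow> real \<Rightarrow> real set \<Rightarrow>
     (real \<Rightarrow> ('m, real^2) tpoint) \<Rightarrow> bool" where
  "helix_geodesic_field A g a c d I \<gamma> \<longleftrightarrow>
     (\<exists>K. \<forall>t\<in>I.
        kaluza_klein A g a c d (\<gamma> t)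
          (inclusion_diff A g (\<gamma> t) (velocity (unit_bundle_atlas A g) \<gamma> t))
          (horizontal_lift A g (\<gamma> t) (snd (\<gamma> t))) = K)"

end

theory Submission
  imports Defs
begin

text \<open>In a chart of the surface and a chart of the unit tangent bundle, a tangent vector \<open>v\<close> of
  \<open>T\<^sub>1M\<close> at \<open>(p, u)\<close> has a horizontal part \<open>X v\<close> and a vertical part \<open>Y v\<close>, and the metric is
  \<open>m h(X v, X w) + d h(X v, u) h(X w, u) + a h(Y v, Y w)\<close> with \<open>m = a + c\<close>. Differentiating \<open>X\<close> and
  \<open>Y\<close> covariantly, Koszul's formula expresses the Levi-Civita connection through \<open>h\<close> and the
  curvature, where \<open>\<kappa> a = m\<close>.

  Let \<open>f = g(x', V)\<close>. The product of \<open>\<lambda>'\<close> with the geodesic field is \<open>(a + c + d) f\<close>, so \<open>\<lambda>\<close> is a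
  helix iff \<open>f\<close> is constant. If it is, then \<open>g(x', x')\<close> is constant as well, and since the surface has
  dimension two and \<open>V\<close> is parallel, \<open>x\<close> is a geodesic. The first Frenet equation then shows that the
  normal \<open>W\<^sub>1\<close> is vertical, with vertical part \<open>Y\<close> say, and \<open>k = - d f g(x', Y)\<close>; the horizontal
  components of the second one along \<open>V\<close> and \<open>Y\<close> are \<open>g(x', Y) = - 2 \<epsilon> k f\<close> and
  \<open>(d - m) \<epsilon>\<^sub>1 = 4 a m k\<^sup>2\<close>, from which the assertions follow. Conversely the third assertion makes \<open>f\<close>
  constant by continuity.\<close>

section \<open>Functions of class C\<open>\<^sup>k\<close>\<close>

text \<open>The connection of the Kaluza-Klein metric is never solved for as a vector. Koszul's
  formula gives its products with test vectors, and each Frenet equation is paired with suitable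
  ones; this suffices because every pair of a horizontal part and a vertical part orthogonal to
  \<open>u\<close> occurs, by a count of dimensions. All second derivatives that enter are grouped
  into covariant derivatives along the curve of the horizontal and vertical parts of the velocity
  and of the horizontal part of the normal, and these vanish. The relation \<kappa> a = m gives the
  curvature terms the coefficient m of the horizontal metric. Hence m + d cancels in the component
  along V, and d - m is what remains in the component along Y. The other obstacle is the encoding:
  charts of the unit tangent bundle are arbitrary immersed parametrizations, and the metric is
  evaluated through a chosen one. That the choice is immaterial rests on the inverse function
  theorem, for the transitions, and on the transformation law of the Christoffel symbols, for the
  vertical parts.\<close>

lemma Ck_on_SucD: "Ck_on (Suc k) f S \<Longrightarrow> Ck_on k f S"
proof (induction k arbitrary: f)
  case 0
  then show ?case
    by (auto intro!: continuous_at_imp_continuous_on differentiable_imp_continuous_within)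
qed auto

lemma Ck_on_continuous_on: "Ck_on k f S \<Longrightarrow> continuous_on S f"
  by (induction k) (auto dest: Ck_on_SucD simp del: Ck_on.simps(2))

lemma Ck_on_subset: "Ck_on k f S \<Longrightarrow> T \<subseteq> S \<Longrightarrow> Ck_on k f T"
  by (induction k arbitrary: f) (auto intro: continuous_on_subset)

text \<open>Serves for the base curve: its smoothness in a fixed chart of the surface is checked
  near each time in a chart of the unit tangent bundle that varies with the time.\<close>

lemma Ck_on_local:
  assumes "\<And>y. y \<in> S \<Longrightarrow> \<exists>U. open U \<and> y \<in> U \<and> Ck_on k f U"
  shows "Ck_on k f S"
  using assms
proof (induction k arbitrary: f)
  case 0
  then show ?case
    by (auto intro!: continuous_at_imp_continuous_on) (metis continuous_on_eq_continuous_at)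
next
  case (Suc k)
  have "Ck_on k (\<lambda>y. frechet_derivative f (at y) v) S" for v
  proof (rule Suc.IH)
    fix y assume "y \<in> S"
    then obtain U where "open U" "y \<in> U" "Ck_on (Suc k) f U" using Suc.prems by blast
    then show "\<exists>U. open U \<and> y \<in> U \<and> Ck_on k (\<lambda>y. frechet_derivative f (at y) v) U" by auto
  qed
  moreover have "\<forall>y\<in>S. f differentiable (at y)"
  proof
    fix y assume "y \<in> S"
    then obtain U where "open U" "y \<in> U" "Ck_on (Suc k) f U" using Suc.prems by blast
    then show "f differentiable (at y)" by simp
  qed
  ultimately show ?case by simp
qed

text \<open>Maps that agree near \<open>y\<close> have the same derivatives there, so the choice
  behind \<open>frechet_derivative\<close> falls on the same map, even where no derivative
  exists.\<close>

lemma frechet_derivative_cong_open: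
  assumes "open S" "y \<in> S" "\<And>z. z \<in> S \<Longrightarrow> f z = g z"
  shows "frechet_derivative f (at y) = frechet_derivative g (at y)"
proof -
  have "(f has_derivative D) (at y) \<longleftrightarrow> (g has_derivative D) (at y)" for D
    using has_derivative_transform_within_open[OF _ assms(1,2)] assms(3) by metis
  then show ?thesis by (simp add: frechet_derivative_def)
qed

lemma Ck_on_cong:
  assumes "open S" "\<And>z. z \<in> S \<Longrightarrow> f z = g z" "Ck_on k f S"
  shows "Ck_on k g S"
  using assms(2,3)
proof (induction k arbitrary: f g)
  case 0
  then show ?case using continuous_on_cong by (metis Ck_on.simps(1))
next
  case (Suc k)
  have "frechet_derivative f (at y) = frechet_derivative g (at y)" if "y \<in> S" for y
    by (rule frechet_derivative_cong_open[OF assms(1) that Suc.prems(1)])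
  moreover have "g differentiable (at y)" if "y \<in> S" for y
    using Suc.prems that has_derivative_transform_within_open[OF _ assms(1) that]
    by (metis Ck_on.simps(2) differentiable_def)
  ultimately show ?case
    using Suc.prems Suc.IH[of "\<lambda>y. frechet_derivative f (at y) v" "\<lambda>y. frechet_derivative g (at y) v" for v]
    by auto
qed

lemma has_derivative_Ck_on:
  assumes "Ck_on (Suc k) f S" "y \<in> S"
  shows "(f has_derivative frechet_derivative f (at y)) (at y)"
  using assms by (simp add: frechet_derivative_works)

lemma Ck_on_SucI:
  assumes "open S" "\<And>y. y \<in> S \<Longrightarrow> (f has_derivative D y) (at y)"
    "\<And>v. Ck_on k (\<lambda>y. D y v) S"
  shows "Ck_on (Suc k) f S"
proof -
  have "frechet_derivative f (at y) = D y" if "y \<in> S" for y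
    using assms(2)[OF that] frechet_derivative_at by metis
  then have "Ck_on k (\<lambda>y. frechet_derivative f (at y) v) S" for v
    by (intro Ck_on_cong[OF assms(1) _ assms(3)[of v]]) simp
  then show ?thesis using assms(2) by (auto simp: differentiable_def)
qed

section \<open>Closure of the classes under sums, products, linear maps and composition\<close>

lemma Ck_on_const: "open S \<Longrightarrow> Ck_on k (\<lambda>_. c) S"
proof (induction k arbitrary: c)
  case (Suc k)
  then show ?case by (intro Ck_on_SucI[where D="\<lambda>_ _. 0"]) auto
qed simp

lemma Ck_on_add:
  assumes "open S" "Ck_on k f S" "Ck_on k g S"
  shows "Ck_on k (\<lambda>z. f z + g z) S"
  using assms(2,3)
proof (induction k arbitrary: f g)
  case (Suc k)
  show ?case
  proof (rule Ck_on_SucI[OF assms(1) has_derivative_add])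
    fix y assume y: "y \<in> S"
    show "(f has_derivative frechet_derivative f (at y)) (at y)"
      "(g has_derivative frechet_derivative g (at y)) (at y)"
      using Suc.prems y has_derivative_Ck_on by blast+
  qed (use Suc in auto)
qed (auto intro: continuous_on_add)

lemma Ck_on_sum:
  assumes "open S" "\<And>i. i \<in> J \<Longrightarrow> Ck_on k (f i) S"
  shows "Ck_on k (\<lambda>z. \<Sum>i\<in>J. f i z) S"
  using assms(2)
  by (induction J rule: infinite_finite_induct) (auto intro: Ck_on_const Ck_on_add assms(1))

lemma Ck_on_linear:
  assumes "open S" "bounded_linear L" "Ck_on k f S"
  shows "Ck_on k (\<lambda>z. L (f z)) S"
  using assms(3)
proof (induction k arbitrary: f)
  case 0
  then show ?case by (auto intro: bounded_linear.continuous_on[OF assms(2)])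
next
  case (Suc k)
  show ?case
    by (rule Ck_on_SucI[OF assms(1) bounded_linear.has_derivative[OF assms(2) has_derivative_Ck_on]])
       (use Suc in auto)
qed

lemma Ck_on_scaleR:
  assumes "open S" "Ck_on k f S" "Ck_on k g S"
  shows "Ck_on k (\<lambda>z. f z *\<^sub>R g z) S"
  using assms(2,3)
proof (induction k arbitrary: f g)
  case (Suc k)
  show ?case
  proof (rule Ck_on_SucI[OF assms(1) has_derivative_scaleR])
    fix y assume y: "y \<in> S"
    show "(f has_derivative frechet_derivative f (at y)) (at y)"
      "(g has_derivative frechet_derivative g (at y)) (at y)"
      using Suc.prems y has_derivative_Ck_on by blast+
  next
    fix v
    show "Ck_on k (\<lambda>y. f y *\<^sub>R frechet_derivative g (at y) v + frechet_derivative f (at y) v *\<^sub>R g y) S"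
      using Suc.prems Suc.prems[THEN Ck_on_SucD] by (intro Ck_on_add Suc.IH assms(1)) auto
  qed
qed (auto intro: continuous_on_scaleR)

text \<open>\<open>Ck_on\<close> speaks of derivatives in fixed directions, whereas the chain rule
  evaluates the derivative of \<open>g\<close> in a direction that moves with \<open>y\<close>.
  Expanding that direction over the basis leaves fixed directions, to which the induction hypothesis
  applies.\<close>

lemma Ck_on_compose:
  fixes f :: "'a::euclidean_space \<Rightarrow> 'b::euclidean_space" and g :: "'b \<Rightarrow> 'c::euclidean_space"
  assumes "open S" "open T" "f ` S \<subseteq> T" "Ck_on k f S" "Ck_on k g T"
  shows "Ck_on k (g \<circ> f) S"
  using assms(4,5)
proof (induction k arbitrary: g)
  case 0
  then show ?case
    using assms(3) continuous_on_compose[of S f g] continuous_on_subset[of T g "f ` S"] by simp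
next
  case (Suc k)
  show ?case
  proof (rule Ck_on_SucI[OF assms(1)])
    fix y assume y: "y \<in> S"
    let ?D = "\<lambda>v. \<Sum>b\<in>Basis. (frechet_derivative f (at y) v \<bullet> b) *\<^sub>R frechet_derivative g (at (f y)) b"
    have f: "(f has_derivative frechet_derivative f (at y)) (at y)"
      using Suc.prems y has_derivative_Ck_on by blast
    have g: "(g has_derivative frechet_derivative g (at (f y))) (at (f y))"
      using Suc.prems y has_derivative_Ck_on assms(3) by blast
    have lin: "linear (frechet_derivative g (at (f y)))"
      by (rule has_derivative_linear[OF g])
    have "frechet_derivative g (at (f y)) w =
        (\<Sum>b\<in>Basis. (w \<bullet> b) *\<^sub>R frechet_derivative g (at (f y)) b)" for w
      using linear_sum[OF lin, of "\<lambda>b. (w \<bullet> b) *\<^sub>R b" Basis]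
      by (simp add: linear_scale[OF lin] euclidean_representation)
    then have "frechet_derivative g (at (f y)) \<circ> frechet_derivative f (at y) = ?D"
      by (metis comp_def)
    with diff_chain_at[OF f g] show "(g \<circ> f has_derivative ?D) (at y)" by simp
  next
    fix v
    show "Ck_on k (\<lambda>y. \<Sum>b\<in>Basis. (frechet_derivative f (at y) v \<bullet> b) *\<^sub>R
        frechet_derivative g (at (f y)) b) S"
    proof (intro Ck_on_sum Ck_on_scaleR assms(1))
      fix b :: 'b
      show "Ck_on k (\<lambda>y. frechet_derivative f (at y) v \<bullet> b) S"
        using Suc.prems by (intro Ck_on_linear[where L="\<lambda>x. x \<bullet> b"] assms(1) bounded_linear_inner_left) auto
      show "Ck_on k (\<lambda>y. frechet_derivative g (at (f y)) b) S"
        using Suc.IH[of "\<lambda>z. frechet_derivative g (at z) b"] Suc.prems Ck_on_SucD[OF Suc.prems(1)]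
        by (simp add: comp_def)
    qed
  qed
qed

text \<open>The mixed second difference is evaluated by the mean value theorem in two ways.\<close>

lemma second_difference_mvt:
  fixes f :: "'a::euclidean_space \<Rightarrow> real"
  assumes C2: "Ck_on (Suc (Suc k)) f S" and s: "s > 0"
    and box: "\<And>r q. 0 \<le> r \<Longrightarrow> r \<le> s \<Longrightarrow> 0 \<le> q \<Longrightarrow> q \<le> s \<Longrightarrow> y + r *\<^sub>R v + q *\<^sub>R w \<in> S"
  shows "\<exists>r q. 0 < r \<and> r < s \<and> 0 < q \<and> q < s \<and>
    f (y + s *\<^sub>R v + s *\<^sub>R w) - f (y + s *\<^sub>R v) - f (y + s *\<^sub>R w) + f y =
    s * s * frechet_derivative (\<lambda>z. frechet_derivative f (at z) v) (at (y + r *\<^sub>R v + q *\<^sub>R w)) w"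
proof -
  define D where "D z = frechet_derivative f (at z)" for z
  have D: "(f has_derivative D z) (at z)" if "z \<in> S" for z
    using has_derivative_Ck_on[OF C2 that] by (simp add: D_def)
  have "Ck_on (Suc k) (\<lambda>z. D z v) S" using C2 by (simp add: D_def)
  then have DD: "((\<lambda>z. D z v) has_derivative frechet_derivative (\<lambda>z. D z v) (at z)) (at z)"
    if "z \<in> S" for z using has_derivative_Ck_on that by blast
  have lin: "linear (D z)" if "z \<in> S" for z by (rule has_derivative_linear[OF D[OF that]])
  have "\<exists>r. 0 < r \<and> r < s \<and>
      (f (y + s *\<^sub>R v + s *\<^sub>R w) - f (y + s *\<^sub>R v + 0 *\<^sub>R w)) - (f (y + 0 *\<^sub>R v + s *\<^sub>R w) - f (y + 0 *\<^sub>R v + 0 *\<^sub>R w))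
      = (s - 0) * (D (y + r *\<^sub>R v + s *\<^sub>R w) v - D (y + r *\<^sub>R v + 0 *\<^sub>R w) v)"
  proof (rule MVT2[OF s, of "\<lambda>r. f (y + r *\<^sub>R v + s *\<^sub>R w) - f (y + r *\<^sub>R v + 0 *\<^sub>R w)"
        "\<lambda>r. D (y + r *\<^sub>R v + s *\<^sub>R w) v - D (y + r *\<^sub>R v + 0 *\<^sub>R w) v"])
    fix r assume r: "0 \<le> r" "r \<le> s"
    have der: "((\<lambda>r. f (y + r *\<^sub>R v + q *\<^sub>R w)) has_real_derivative D (y + r *\<^sub>R v + q *\<^sub>R w) v) (at r)"
      if "q = 0 \<or> q = s" for q
    proof -
      have S: "y + r *\<^sub>R v + q *\<^sub>R w \<in> S" using box r that s by (metis less_eq_real_def order_refl)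
      have "((\<lambda>r. y + r *\<^sub>R v + q *\<^sub>R w) has_derivative (\<lambda>h. h *\<^sub>R v)) (at r)"
        by (auto intro!: derivative_eq_intros)
      from has_derivative_compose[OF this D[OF S]]
      show ?thesis by (simp add: has_field_derivative_def linear_scale[OF lin[OF S]] mult_commute_abs)
    qed
    show "((\<lambda>r. f (y + r *\<^sub>R v + s *\<^sub>R w) - f (y + r *\<^sub>R v + 0 *\<^sub>R w)) has_real_derivative
        D (y + r *\<^sub>R v + s *\<^sub>R w) v - D (y + r *\<^sub>R v + 0 *\<^sub>R w) v) (at r)"
      by (intro DERIV_diff der) simp_all
  qed
  then obtain r where r: "0 < r" "r < s" and eq1:
      "f (y + s *\<^sub>R v + s *\<^sub>R w) - f (y + s *\<^sub>R v) - f (y + s *\<^sub>R w) + f y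
      = s * (D (y + r *\<^sub>R v + s *\<^sub>R w) v - D (y + r *\<^sub>R v) v)"
    by auto
  have "\<exists>q. 0 < q \<and> q < s \<and>
      D (y + r *\<^sub>R v + s *\<^sub>R w) v - D (y + r *\<^sub>R v + 0 *\<^sub>R w) v
      = (s - 0) * frechet_derivative (\<lambda>z. D z v) (at (y + r *\<^sub>R v + q *\<^sub>R w)) w"
  proof (rule MVT2[OF s, of "\<lambda>q. D (y + r *\<^sub>R v + q *\<^sub>R w) v"
        "\<lambda>q. frechet_derivative (\<lambda>z. D z v) (at (y + r *\<^sub>R v + q *\<^sub>R w)) w"])
    fix q assume q: "0 \<le> q" "q \<le> s"
    have S: "y + r *\<^sub>R v + q *\<^sub>R w \<in> S" using box r q by auto
    have "((\<lambda>q. y + r *\<^sub>R v + q *\<^sub>R w) has_derivative (\<lambda>h. h *\<^sub>R w)) (at q)"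
      by (auto intro!: derivative_eq_intros)
    from has_derivative_compose[OF this DD[OF S]]
    show "((\<lambda>q. D (y + r *\<^sub>R v + q *\<^sub>R w) v) has_real_derivative
        frechet_derivative (\<lambda>z. D z v) (at (y + r *\<^sub>R v + q *\<^sub>R w)) w) (at q)"
      by (simp add: has_field_derivative_def linear_scale[OF has_derivative_linear[OF DD[OF S]]] mult_commute_abs)
  qed
  then show ?thesis using r eq1 by (auto simp: D_def)
qed

text \<open>The second difference does not depend on the order of \<open>v\<close> and
  \<open>w\<close>, so the two mixed derivatives agree at two points close to \<open>y\<close>;
  their continuity closes the gap.\<close>

lemma second_derivative_symmetric_real:
  fixes f :: "'a::euclidean_space \<Rightarrow> real"
  assumes S: "open S" "y \<in> S" and C2: "Ck_on (Suc (Suc k)) f S"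
  shows "frechet_derivative (\<lambda>z. frechet_derivative f (at z) v) (at y) w =
         frechet_derivative (\<lambda>z. frechet_derivative f (at z) w) (at y) v"
proof -
  define D where "D v w z = frechet_derivative (\<lambda>z. frechet_derivative f (at z) v) (at z) w" for v w z
  have "Ck_on k (D v w) S" for v w using C2 by (simp add: D_def[abs_def])
  then have cont: "continuous (at y) (D v w)" for v w
    using S continuous_on_eq_continuous_at Ck_on_continuous_on by blast
  obtain e where e: "e > 0" "ball y e \<subseteq> S" using openE[OF S] by blast
  have close: "\<bar>D v w y - D w v y\<bar> \<le> \<epsilon>" if \<epsilon>: "\<epsilon> > 0" for \<epsilon>
  proof -
    obtain d1 where d1: "d1 > 0" "\<And>z. dist z y < d1 \<Longrightarrow> dist (D v w z) (D v w y) < \<epsilon> / 2"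
      using cont[of v w] half_gt_zero[OF \<epsilon>] unfolding continuous_at_eps_delta by blast
    obtain d2 where d2: "d2 > 0" "\<And>z. dist z y < d2 \<Longrightarrow> dist (D w v z) (D w v y) < \<epsilon> / 2"
      using cont[of w v] half_gt_zero[OF \<epsilon>] unfolding continuous_at_eps_delta by blast
    define \<rho> where "\<rho> = Min {e, d1, d2}"
    \<comment> \<open>The summand 1 keeps \<open>N\<close> positive when \<open>v\<close> and
      \<open>w\<close> both vanish; as \<open>s * N\<close> is half of \<open>\<rho>\<close>, the
      parallelogram of side parameters at most \<open>s\<close> stays in the ball of radius
      \<open>\<rho>\<close>.\<close>
    define N where "N = norm v + norm w + 1"
    define s where "s = \<rho> / (2 * N)"
    have \<rho>: "\<rho> > 0" "\<rho> \<le> e" "\<rho> \<le> d1" "\<rho> \<le> d2" using e d1 d2 by (auto simp: \<rho>_def)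
    have pos: "N > 0" by (simp add: N_def add_nonneg_pos)
    have s: "s > 0" using \<rho> pos by (simp add: s_def)
    have small: "dist (y + r *\<^sub>R a + q *\<^sub>R b) y < \<rho>"
      if "0 \<le> r" "r \<le> s" "0 \<le> q" "q \<le> s" "{a, b} = {v, w}" for r q a b
    proof -
      have "dist (y + r *\<^sub>R a + q *\<^sub>R b) y \<le> r * norm a + q * norm b"
        using norm_triangle_ineq[of "r *\<^sub>R a" "q *\<^sub>R b"] that by (simp add: dist_norm add.assoc)
      also have "\<dots> \<le> s * norm a + s * norm b"
        using that by (intro add_mono mult_right_mono) auto
      also have "s * norm a + s * norm b = s * (norm v + norm w)"
        using that(5) by (auto simp: doubleton_eq_iff distrib_left)
      also have "\<dots> \<le> s * N" using s by (simp add: N_def)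
      also have "\<dots> = \<rho> / 2" using pos by (simp add: s_def)
      also have "\<dots> < \<rho>" using \<rho> by simp
      finally show ?thesis .
    qed
    have box: "y + r *\<^sub>R a + q *\<^sub>R b \<in> S"
      if "0 \<le> r" "r \<le> s" "0 \<le> q" "q \<le> s" "{a, b} = {v, w}" for r q a b
    proof -
      have "dist y (y + r *\<^sub>R a + q *\<^sub>R b) < e" using small[OF that] \<rho> by (simp add: dist_commute)
      then show ?thesis using e by (simp add: subset_eq)
    qed
    obtain r q where rq: "0 < r" "r < s" "0 < q" "q < s"
      "f (y + s *\<^sub>R v + s *\<^sub>R w) - f (y + s *\<^sub>R v) - f (y + s *\<^sub>R w) + f y = s * s * D v w (y + r *\<^sub>R v + q *\<^sub>R w)"
      using second_difference_mvt[OF C2 s, of y v w] box[of _ _ v w] unfolding D_def by blast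
    obtain r' q' where rq': "0 < r'" "r' < s" "0 < q'" "q' < s"
      "f (y + s *\<^sub>R w + s *\<^sub>R v) - f (y + s *\<^sub>R w) - f (y + s *\<^sub>R v) + f y = s * s * D w v (y + r' *\<^sub>R w + q' *\<^sub>R v)"
      using second_difference_mvt[OF C2 s, of y w v] box[of _ _ w v] unfolding D_def by blast
    have "s * s * D v w (y + r *\<^sub>R v + q *\<^sub>R w) = s * s * D w v (y + r' *\<^sub>R w + q' *\<^sub>R v)"
      using rq(5) rq'(5) by (simp add: algebra_simps)
    then have "D v w (y + r *\<^sub>R v + q *\<^sub>R w) = D w v (y + r' *\<^sub>R w + q' *\<^sub>R v)" using s by simp
    moreover have "dist (D v w (y + r *\<^sub>R v + q *\<^sub>R w)) (D v w y) < \<epsilon> / 2"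
      using d1(2) small[of r q v w] rq \<rho> by auto
    moreover have "dist (D w v (y + r' *\<^sub>R w + q' *\<^sub>R v)) (D w v y) < \<epsilon> / 2"
      using d2(2) small[of r' q' w v] rq' \<rho> by (auto simp: insert_commute)
    ultimately show ?thesis by (auto simp: dist_real_def abs_if split: if_splits)
  qed
  have "\<bar>D v w y - D w v y\<bar> \<le> 0" by (rule field_le_epsilon) (use close in auto)
  then show ?thesis by (simp add: D_def)
qed

lemma second_derivative_symmetric:
  fixes f :: "'a::euclidean_space \<Rightarrow> 'b::euclidean_space"
  assumes S: "open S" "y \<in> S" and C2: "Ck_on (Suc (Suc k)) f S"
  shows "frechet_derivative (\<lambda>z. frechet_derivative f (at z) v) (at y) w =
         frechet_derivative (\<lambda>z. frechet_derivative f (at z) w) (at y) v"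
proof (rule euclidean_eqI)
  fix b :: 'b assume "b \<in> Basis"
  have C: "Ck_on (Suc (Suc k)) (\<lambda>z. f z \<bullet> b) S"
    by (rule Ck_on_linear[where L="\<lambda>x. x \<bullet> b", OF S(1) bounded_linear_inner_left C2])
  have 1: "frechet_derivative (\<lambda>z. f z \<bullet> b) (at z) v = frechet_derivative f (at z) v \<bullet> b" if "z \<in> S" for z v
    using frechet_derivative_at[OF has_derivative_inner_left[OF has_derivative_Ck_on[OF C2 that]], of b]
    by metis
  have 2: "frechet_derivative (\<lambda>z. frechet_derivative (\<lambda>z. f z \<bullet> b) (at z) v) (at y) w =
    frechet_derivative (\<lambda>z. frechet_derivative f (at z) v) (at y) w \<bullet> b" for v w
  proof -
    have "Ck_on (Suc k) (\<lambda>z. frechet_derivative f (at z) v) S" using C2 by simp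
    from has_derivative_inner_left[OF has_derivative_Ck_on[OF this S(2)], of b]
    have "frechet_derivative (\<lambda>z. frechet_derivative f (at z) v \<bullet> b) (at y) w =
        frechet_derivative (\<lambda>z. frechet_derivative f (at z) v) (at y) w \<bullet> b"
      using frechet_derivative_at by metis
    then show ?thesis
      using frechet_derivative_cong_open[OF S, of "\<lambda>z. frechet_derivative (\<lambda>z. f z \<bullet> b) (at z) v"
          "\<lambda>z. frechet_derivative f (at z) v \<bullet> b"] 1 by simp
  qed
  show "frechet_derivative (\<lambda>z. frechet_derivative f (at z) v) (at y) w \<bullet> b =
      frechet_derivative (\<lambda>z. frechet_derivative f (at z) w) (at y) v \<bullet> b"
    using second_derivative_symmetric_real[OF S C, of v w] by (simp only: 2)
qed

section \<open>Families of bilinear forms and Levi-Civita connections\<close>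

lemma bilinear_expand:
  fixes B :: "'a::euclidean_space \<Rightarrow> 'b::euclidean_space \<Rightarrow> 'c::real_vector"
  assumes "bilinear B"
  shows "B v w = (\<Sum>i\<in>Basis. \<Sum>j\<in>Basis. ((v \<bullet> i) * (w \<bullet> j)) *\<^sub>R B i j)"
proof -
  have "B v w = B (\<Sum>i\<in>Basis. (v \<bullet> i) *\<^sub>R i) (\<Sum>j\<in>Basis. (w \<bullet> j) *\<^sub>R j)"
    by (simp add: euclidean_representation)
  also have "\<dots> = (\<Sum>(i, j)\<in>Basis \<times> Basis. B ((v \<bullet> i) *\<^sub>R i) ((w \<bullet> j) *\<^sub>R j))"
    by (rule bilinear_sum[OF assms])
  finally show ?thesis
    by (simp add: sum.cartesian_product bilinear_lmul[OF assms] bilinear_rmul[OF assms] mult.commute)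
qed

text \<open>The linearity relations hold on the whole neighbourhood \<open>S\<close>, so they may be
  differentiated; uniqueness of the derivative transfers them to \<open>f'\<close>.\<close>

lemma bilinear_derivative:
  fixes f :: "'e::real_normed_vector \<Rightarrow> 'b::real_vector \<Rightarrow> 'd::real_vector \<Rightarrow> 'c::real_normed_vector"
  assumes S: "open S" "y \<in> S" and bil: "\<And>z. z \<in> S \<Longrightarrow> bilinear (f z)"
    and der: "\<And>v w. ((\<lambda>z. f z v w) has_derivative (\<lambda>u. f' u v w)) (at y)"
  shows "bilinear (f' u)"
proof -
  have uniq: "F = (\<lambda>u. f' u v w)" if "(k has_derivative F) (at y)" "\<And>z. z \<in> S \<Longrightarrow> k z = f z v w"
    for F k v w
    using has_derivative_unique[OF has_derivative_transform_within_open[OF that(1) S that(2)] der]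
    by simp
  have "(\<lambda>u. f' u (v + v') w) = (\<lambda>u. f' u v w + f' u v' w)" for v v' w
    by (rule uniq[symmetric, OF has_derivative_add[OF der der]]) (simp add: bilinear_ladd[OF bil])
  moreover have "(\<lambda>u. f' u v (w + w')) = (\<lambda>u. f' u v w + f' u v w')" for v w w'
    by (rule uniq[symmetric, OF has_derivative_add[OF der der]]) (simp add: bilinear_radd[OF bil])
  moreover have "(\<lambda>u. f' u (r *\<^sub>R v) w) = (\<lambda>u. r *\<^sub>R f' u v w)" for r v w
    by (rule uniq[symmetric, OF has_derivative_scaleR_right[OF der]]) (simp add: bilinear_lmul[OF bil])
  moreover have "(\<lambda>u. f' u v (r *\<^sub>R w)) = (\<lambda>u. r *\<^sub>R f' u v w)" for r v w
    by (rule uniq[symmetric, OF has_derivative_scaleR_right[OF der]]) (simp add: bilinear_rmul[OF bil])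
  ultimately show ?thesis
    unfolding bilinear_def by (intro conjI allI linearI) (metis (no_types))+
qed

text \<open>Only the derivatives of \<open>f z v w\<close> for fixed \<open>v\<close> and
  \<open>w\<close> are given. Expansion over both bases gives a finite sum of products, valid on a
  neighbourhood of \<open>y\<close> that \<open>p\<close> maps into \<open>S\<close>. This product
  rule underlies the covariant derivatives of fields along maps.\<close>

lemma has_derivative_bilinear_family:
  fixes f :: "'e::real_normed_vector \<Rightarrow> 'b::euclidean_space \<Rightarrow> 'd::euclidean_space \<Rightarrow> 'c::real_normed_vector"
    and p :: "'a::real_normed_vector \<Rightarrow> 'e"
  assumes S: "open S" "p y \<in> S" and bil: "\<And>z. z \<in> S \<Longrightarrow> bilinear (f z)"
    and der: "\<And>v w. ((\<lambda>z. f z v w) has_derivative (\<lambda>u. f' u v w)) (at (p y))"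
    and p: "(p has_derivative p') (at y)"
    and A: "(A has_derivative A') (at y)" and B: "(B has_derivative B') (at y)"
  shows "((\<lambda>x. f (p x) (A x) (B x)) has_derivative
      (\<lambda>v. f' (p' v) (A y) (B y) + f (p y) (A' v) (B y) + f (p y) (A y) (B' v))) (at y)"
proof -
  let ?F = "\<lambda>x. \<Sum>i\<in>Basis. \<Sum>j\<in>Basis. ((A x \<bullet> i) * (B x \<bullet> j)) *\<^sub>R f (p x) i j"
  have bil': "bilinear (f' u)" for u by (rule bilinear_derivative[OF S bil der])
  have fp: "((\<lambda>x. f (p x) i j) has_derivative (\<lambda>v. f' (p' v) i j)) (at y)" for i j
    by (rule has_derivative_compose[OF p der])
  have "(?F has_derivative (\<lambda>v. \<Sum>i\<in>Basis. \<Sum>j\<in>Basis.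
      ((A y \<bullet> i) * (B y \<bullet> j)) *\<^sub>R f' (p' v) i j +
      ((A y \<bullet> i) * (B' v \<bullet> j) + (A' v \<bullet> i) * (B y \<bullet> j)) *\<^sub>R f (p y) i j)) (at y)"
    by (intro has_derivative_sum has_derivative_scaleR has_derivative_mult has_derivative_inner_left
        A B fp)
  also have "(\<lambda>v. \<Sum>i\<in>Basis. \<Sum>j\<in>Basis.
      ((A y \<bullet> i) * (B y \<bullet> j)) *\<^sub>R f' (p' v) i j +
      ((A y \<bullet> i) * (B' v \<bullet> j) + (A' v \<bullet> i) * (B y \<bullet> j)) *\<^sub>R f (p y) i j) =
      (\<lambda>v. f' (p' v) (A y) (B y) + f (p y) (A' v) (B y) + f (p y) (A y) (B' v))"
    (is "?l = ?r")
  proof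
    fix v
    note e = bilinear_expand[OF bil', of "p' v" "A y" "B y"]
      bilinear_expand[OF bil[OF S(2)], of "A' v" "B y"] bilinear_expand[OF bil[OF S(2)], of "A y" "B' v"]
    show "?l v = ?r v"
      unfolding e by (simp only: sum.distrib scaleR_add_left ac_simps)
  qed
  finally have F: "(?F has_derivative (\<lambda>v. f' (p' v) (A y) (B y) + f (p y) (A' v) (B y) +
      f (p y) (A y) (B' v))) (at y)" .
  have "isCont p y" by (rule has_derivative_continuous[OF p])
  then obtain U where U: "open U" "y \<in> U" "\<And>x. x \<in> U \<Longrightarrow> p x \<in> S"
    using S unfolding continuous_at_open by metis
  show ?thesis
    by (rule has_derivative_transform_within_open[OF F U(1,2)])
       (rule bilinear_expand[symmetric, OF bil[OF U(3)]])
qed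

text \<open>The content of \<open>levi_civita_at\<close> at one point, with the derivative of the
  metric as a separate argument \<open>D\<close>. Any explicit formula for that derivative can be
  inserted, as is done with \<open>H'\<close> for the Kaluza-Klein metric.\<close>

definition levi_civita_form ::
  "('e::euclidean_space \<Rightarrow> 'e \<Rightarrow> real) \<Rightarrow> ('e \<Rightarrow> 'e \<Rightarrow> 'e \<Rightarrow> real) \<Rightarrow> ('e \<Rightarrow> 'e \<Rightarrow> 'e) \<Rightarrow> bool"
  where
  "levi_civita_form B D \<Gamma> \<longleftrightarrow> bilinear \<Gamma> \<and> (\<forall>v w. \<Gamma> v w = \<Gamma> w v) \<and>
     (\<forall>u v w. D u v w = B (\<Gamma> u v) w + B v (\<Gamma> u w))"

lemma koszul:
  assumes \<Gamma>: "levi_civita_form B D \<Gamma>" and sym: "\<And>v w. B v w = B w v"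
  shows "2 * B (\<Gamma> v w) z = D v w z + D w v z - D z v w"
proof -
  have 1: "D u v w = B (\<Gamma> u v) w + B v (\<Gamma> u w)" and 2: "\<Gamma> v w = \<Gamma> w v" for u v w
    using \<Gamma> by (auto simp: levi_civita_form_def)
  show ?thesis unfolding 1 using 2[of w v] 2[of z v] 2[of z w] sym by auto
qed

lemma levi_civita_form_unique:
  assumes B: "bilinear B" and sym: "\<And>v w. B v w = B w v" and nd: "\<And>v. (\<forall>w. B v w = 0) \<Longrightarrow> v = 0"
    and \<Gamma>: "levi_civita_form B D \<Gamma>" "levi_civita_form B D \<Gamma>'"
  shows "\<Gamma> = \<Gamma>'"
proof (intro ext)
  fix v w
  have "B (\<Gamma> v w - \<Gamma>' v w) z = 0" for z
    using koszul[OF \<Gamma>(1) sym, of v w z] koszul[OF \<Gamma>(2) sym, of v w z] by (simp add: bilinear_lsub[OF B])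
  then show "\<Gamma> v w = \<Gamma>' v w" using nd[of "\<Gamma> v w - \<Gamma>' v w"] by simp
qed

lemma levi_civita_form_exists:
  assumes B: "bilinear B" and sym: "\<And>v w. B v w = B w v" and nd: "\<And>v. (\<forall>w. B v w = 0) \<Longrightarrow> v = 0"
    and D: "\<And>v w. linear (\<lambda>u. D u v w)" "\<And>u. bilinear (D u)" "\<And>u v w. D u v w = D u w v"
  shows "\<exists>\<Gamma>. levi_civita_form B D \<Gamma>"
proof -
  define P where "P v w z = (D v w z + D w v z - D z v w) / 2" for v w z
  note lin = linear_add[OF D(1)] linear_scale[OF D(1)] bilinear_ladd[OF D(2)] bilinear_radd[OF D(2)]
    bilinear_lmul[OF D(2)] bilinear_rmul[OF D(2)]
  have "linear (P v w)" for v w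
    by (rule linearI) (simp_all add: P_def lin field_simps)
  then have "\<exists>\<Gamma>. \<forall>z. B \<Gamma> z = P v w z" for v w
    using nondegenerate_riesz[OF B nd, of "P v w"] by blast
  then obtain \<Gamma> where \<Gamma>: "\<And>v w z. B (\<Gamma> v w) z = P v w z" by metis
  have cancel: "a = b" if "\<And>z. B a z = B b z" for a b
    using nd[of "a - b"] that by (simp add: bilinear_lsub[OF B])
  have "levi_civita_form B D \<Gamma>"
    unfolding levi_civita_form_def
  proof (intro conjI allI)
    show "\<Gamma> v w = \<Gamma> w v" for v w
      by (rule cancel) (simp add: \<Gamma> P_def D(3)[of _ v w])
    show "D u v w = B (\<Gamma> u v) w + B v (\<Gamma> u w)" for u v w
      unfolding sym[of v "\<Gamma> u w"] \<Gamma> P_def D(3)[of w v u] D(3)[of v w u] D(3)[of u w v]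
      by (simp add: field_simps)
    show "bilinear \<Gamma>"
      unfolding bilinear_def
      by (intro conjI allI linearI cancel;
          simp add: \<Gamma> bilinear_ladd[OF B] bilinear_lmul[OF B] P_def lin field_simps)
  qed
  then show ?thesis by blast
qed

lemma levi_civita_at_iff:
  assumes "\<And>v w. ((\<lambda>z. in_chart A g C z v w) has_derivative (\<lambda>u. D u v w)) (at y)"
  shows "levi_civita_at A g C y \<Gamma> \<longleftrightarrow> levi_civita_form (in_chart A g C y) D \<Gamma>"
  using frechet_derivative_at[OF assms]
  by (simp add: levi_civita_at_def levi_civita_form_def fun_eq_iff)

text \<open>Everything is asked of one chart, and differentiability only at the point
  \<open>y\<close>. So the description in \<open>christoffel\<close> is justified for the metric of
  the unit tangent bundle from its expression in a single chart.\<close>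

lemma christoffel_levi_civita_form:
  assumes S: "open S" "y \<in> S" and bil: "\<And>z. z \<in> S \<Longrightarrow> bilinear (in_chart A g C z)"
    and sym: "\<And>z v w. z \<in> S \<Longrightarrow> in_chart A g C z v w = in_chart A g C z w v"
    and nd: "\<And>v. (\<forall>w. in_chart A g C y v w = 0) \<Longrightarrow> v = 0"
    and der: "\<And>v w. ((\<lambda>z. in_chart A g C z v w) has_derivative (\<lambda>u. D u v w)) (at y)"
  shows "levi_civita_form (in_chart A g C y) D (christoffel A g C y)"
proof -
  have "D u v w = D u w v" for u v w
    using has_derivative_unique[OF der[of v w]
        has_derivative_transform_within_open[OF der[of w v] S sym]] by metis
  then obtain \<Gamma> where "levi_civita_form (in_chart A g C y) D \<Gamma>"
    using levi_civita_form_exists[OF bil[OF S(2)] sym[OF S(2)] nd has_derivative_linear[OF der]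
        bilinear_derivative[OF S bil der]] by blast
  then have "\<exists>!\<Gamma>. levi_civita_at A g C y \<Gamma>"
    using levi_civita_form_unique[OF bil[OF S(2)] sym[OF S(2)] nd] levi_civita_at_iff[OF der] by metis
  from theI'[OF this] show ?thesis
    by (simp add: christoffel_def levi_civita_at_iff[OF der])
qed

section \<open>Surfaces of constant curvature in a chart\<close>

abbreviation e1 :: "real^2" where "e1 \<equiv> axis 1 1"
abbreviation e2 :: "real^2" where "e2 \<equiv> axis 2 1"

definition area_form :: "real^2 \<Rightarrow> real^2 \<Rightarrow> real" where
  "area_form v w = v$1 * w$2 - v$2 * w$1"

lemma plane_expand: "v = v$1 *\<^sub>R e1 + v$2 *\<^sub>R e2" for v :: "real^2"
  by (simp add: vec_eq_iff forall_2 axis_def)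

lemma bilinear_plane:
  fixes B :: "real^2 \<Rightarrow> real^2 \<Rightarrow> 'c::real_vector"
  assumes "bilinear B"
  shows "B v w = (v$1 * w$1) *\<^sub>R B e1 e1 + (v$1 * w$2) *\<^sub>R B e1 e2 + (v$2 * w$1) *\<^sub>R B e2 e1
    + (v$2 * w$2) *\<^sub>R B e2 e2"
  by (subst plane_expand[of v], subst plane_expand[of w])
     (simp add: bilinear_ladd[OF assms] bilinear_radd[OF assms] bilinear_lmul[OF assms]
       bilinear_rmul[OF assms] scaleR_add_right mult.commute)

lemma alternating_plane:
  fixes B :: "real^2 \<Rightarrow> real^2 \<Rightarrow> 'c::real_vector"
  assumes B: "bilinear B" and alt: "\<And>v w. B v w = - B w v"
  shows "B v w = area_form v w *\<^sub>R B e1 e2"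
proof -
  have "2 *\<^sub>R B v v = 0" for v using alt[of v v] by (metis add.right_inverse scaleR_2)
  then have "B v v = 0" for v by simp
  then show ?thesis
    using bilinear_plane[OF B, of v w] alt[of e2 e1] by (simp add: area_form_def scaleR_diff_left)
qed

definition gram :: "(real^2 \<Rightarrow> real^2 \<Rightarrow> real) \<Rightarrow> real" where
  "gram B = B e1 e1 * B e2 e2 - (B e1 e2)\<^sup>2"

text \<open>The Cauchy-Binet formula in dimension two. It turns orthogonality relations into
  statements about the area form, and conversely, whatever the signature of
  \<open>B\<close>.\<close>

lemma gram_identity:
  assumes B: "bilinear B" and sym: "\<And>v w. B v w = B w v"
  shows "B v v' * B w w' - B v w' * B w v' = area_form v w * area_form v' w' * gram B"
  unfolding bilinear_plane[OF B, of v v'] bilinear_plane[OF B, of w w']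
    bilinear_plane[OF B, of v w'] bilinear_plane[OF B, of w v'] sym[of e2 e1]
  by (simp add: area_form_def gram_def power2_eq_square algebra_simps)

text \<open>If the determinant vanished, the Gram identity and nondegeneracy would give
  \<open>B w w *\<^sub>R v = B v w *\<^sub>R w\<close> for all \<open>v\<close> and
  \<open>w\<close>. The basis vectors then force both diagonal entries to be zero, hence also
  \<open>B e1 e2\<close>, and \<open>B\<close> would vanish.\<close>

lemma gram_nonzero:
  assumes B: "bilinear B" and sym: "\<And>v w. B v w = B w v" and nd: "\<And>v. (\<forall>w. B v w = 0) \<Longrightarrow> v = 0"
  shows "gram B \<noteq> 0"
proof
  assume 0: "gram B = 0"
  have B0: "B v w = 0" for v w
  proof -
    have "(\<forall>z. B (B w w *\<^sub>R v - B v w *\<^sub>R w) z = 0)" for v w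
    proof
      fix z
      show "B (B w w *\<^sub>R v - B v w *\<^sub>R w) z = 0"
        using gram_identity[OF B sym, of v z w w] 0
        by (simp add: bilinear_lsub[OF B] bilinear_lmul[OF B] mult.commute)
    qed
    then have *: "B w w *\<^sub>R v = B v w *\<^sub>R w" for v w using nd[of "B w w *\<^sub>R v - B v w *\<^sub>R w"] by simp
    have "B e1 e1 = 0" using *[of e1 e2] by (simp add: vec_eq_iff forall_2 axis_def)
    moreover have "B e2 e2 = 0" using *[of e2 e1] by (simp add: vec_eq_iff forall_2 axis_def)
    ultimately show ?thesis
      using 0 bilinear_plane[OF B, of v w] sym[of e2 e1] by (simp add: gram_def)
  qed
  then have "e1 = 0" using nd[of e1] by blast
  then show False by (simp add: axis_eq_0_iff)
qed

text \<open>Cramer's rule recovers \<open>v\<close> from its products with the basis vectors. Its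
  use is to turn Koszul's formula into a rational expression for the Christoffel symbols.\<close>

lemma cramer_plane:
  assumes B: "bilinear B" and sym: "\<And>v w. B v w = B w v" and "gram B \<noteq> 0"
  shows "v = ((B e2 e2 * B v e1 - B e1 e2 * B v e2) / gram B) *\<^sub>R e1
    + ((B e1 e1 * B v e2 - B e1 e2 * B v e1) / gram B) *\<^sub>R e2"
proof -
  have "B e2 e2 * B v e1 - B e1 e2 * B v e2 = v$1 * gram B"
    "B e1 e1 * B v e2 - B e1 e2 * B v e1 = v$2 * gram B"
    unfolding bilinear_plane[OF B, of v e1] bilinear_plane[OF B, of v e2] sym[of e2 e1]
    by (simp_all add: gram_def power2_eq_square algebra_simps axis_def)
  then show ?thesis using assms(3) plane_expand[of v] by simp
qed

text \<open>The surface seen in one chart. The derivative of \<open>h\<close> is prescribed by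
  metric compatibility, and the curvature enters as the full tensor R(u,v)w = \<kappa> (h(v,w) u -
  h(u,w) v), paired with \<open>x\<close>, since a quotient over planes could not be substituted
  into Koszul's formula.\<close>

locale constant_curvature_chart =
  fixes S :: "(real^2) set" and h :: "real^2 \<Rightarrow> real^2 \<Rightarrow> real^2 \<Rightarrow> real"
    and \<Gamma> :: "real^2 \<Rightarrow> real^2 \<Rightarrow> real^2 \<Rightarrow> real^2"
    and \<Gamma>' :: "real^2 \<Rightarrow> real^2 \<Rightarrow> real^2 \<Rightarrow> real^2 \<Rightarrow> real^2" and \<kappa> :: real
  assumes open_S: "open S"
    and bil: "z \<in> S \<Longrightarrow> bilinear (h z)" and sym: "z \<in> S \<Longrightarrow> h z v w = h z w v"
    and nondeg: "z \<in> S \<Longrightarrow> (\<And>w. h z v w = 0) \<Longrightarrow> v = 0"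
    and bil_\<Gamma>: "z \<in> S \<Longrightarrow> bilinear (\<Gamma> z)" and sym_\<Gamma>: "z \<in> S \<Longrightarrow> \<Gamma> z v w = \<Gamma> z w v"
    and has_derivative_h: "z \<in> S \<Longrightarrow>
      ((\<lambda>z. h z v w) has_derivative (\<lambda>u. h z (\<Gamma> z u v) w + h z v (\<Gamma> z u w))) (at z)"
    and has_derivative_\<Gamma>: "z \<in> S \<Longrightarrow> ((\<lambda>z. \<Gamma> z v w) has_derivative (\<lambda>u. \<Gamma>' z u v w)) (at z)"
    and curvature: "z \<in> S \<Longrightarrow>
      h z (\<Gamma>' z u v w - \<Gamma>' z v u w + \<Gamma> z u (\<Gamma> z v w) - \<Gamma> z v (\<Gamma> z u w)) x =
        \<kappa> * (h z v w * h z u x - h z u w * h z v x)"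

section \<open>Christoffel symbols and curvature tensor of the surface in a chart\<close>

context
  fixes A :: "('m, real^2) chart set" and g :: "('m, real^2) metric" and C :: "('m, real^2) chart"
  assumes g: "pseudo_riemannian_metric A g" and C: "C \<in> A"
begin

lemma in_chart_open: "open (snd C ` fst C)"
  using g C by (auto simp: pseudo_riemannian_metric_def smooth_on_def)

lemma in_chart_bilinear: "z \<in> snd C ` fst C \<Longrightarrow> bilinear (in_chart A g C z)"
  and in_chart_sym: "z \<in> snd C ` fst C \<Longrightarrow> in_chart A g C z v w = in_chart A g C z w v"
  and in_chart_nondegenerate: "z \<in> snd C ` fst C \<Longrightarrow> (\<And>w. in_chart A g C z v w = 0) \<Longrightarrow> v = 0"
  using g C by (auto simp: pseudo_riemannian_metric_def)

lemma in_chart_Ck_on: "Ck_on k (\<lambda>z. in_chart A g C z v w) (snd C ` fst C)"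
  using g C by (auto simp: pseudo_riemannian_metric_def smooth_on_def)

lemma in_chart_has_frechet_derivative:
  "z \<in> snd C ` fst C \<Longrightarrow>
    ((\<lambda>z. in_chart A g C z v w) has_derivative frechet_derivative (\<lambda>z. in_chart A g C z v w) (at z)) (at z)"
  by (rule has_derivative_Ck_on[OF in_chart_Ck_on])

lemma christoffel_in_chart:
  assumes z: "z \<in> snd C ` fst C"
  shows "levi_civita_form (in_chart A g C z)
    (\<lambda>u v w. frechet_derivative (\<lambda>z. in_chart A g C z v w) (at z) u) (christoffel A g C z)"
  using theI'[OF christoffel_unique[OF g C z]]
  unfolding christoffel_def[symmetric] levi_civita_form_def by (simp only: levi_civita_at_def simp_thms)

text \<open>\<open>christoffel\<close> is a description and carries no regularity by itself.
  Koszul's formula determines its products with \<open>e1\<close> and \<open>e2\<close> through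
  first derivatives of the metric, and Cramer's rule, with a nonzero Gram determinant, expresses the
  vector through them.\<close>

lemma christoffel_differentiable:
  assumes z: "z \<in> snd C ` fst C"
  shows "(\<lambda>z. christoffel A g C z v w) differentiable (at z)"
proof -
  let ?h = "in_chart A g C" and ?S = "snd C ` fst C"
  define P where "P z v w k = (frechet_derivative (\<lambda>z. ?h z w k) (at z) v
    + frechet_derivative (\<lambda>z. ?h z v k) (at z) w - frechet_derivative (\<lambda>z. ?h z v w) (at z) k) / 2"
    for z v w k
  define X where "X z = ((?h z e2 e2 * P z v w e1 - ?h z e1 e2 * P z v w e2) / gram (?h z)) *\<^sub>R e1
    + ((?h z e1 e1 * P z v w e2 - ?h z e1 e2 * P z v w e1) / gram (?h z)) *\<^sub>R e2" for z
  have gr: "gram (?h z) \<noteq> 0" if "z \<in> ?S" for z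
    using gram_nonzero[OF in_chart_bilinear in_chart_sym] in_chart_nondegenerate that by blast
  have eq: "X z = christoffel A g C z v w" if z: "z \<in> ?S" for z
  proof -
    have "?h z (christoffel A g C z v w) k = P z v w k" for k
      using koszul[OF christoffel_in_chart[OF z] in_chart_sym[OF z], of v w k] by (simp add: P_def)
    with cramer_plane[OF in_chart_bilinear[OF z] in_chart_sym[OF z] gr[OF z], of "christoffel A g C z v w"]
    show ?thesis by (simp add: X_def)
  qed
  have dh: "(\<lambda>z. ?h z v w) differentiable (at z)" for v w
    using in_chart_has_frechet_derivative[OF z] by (auto simp: differentiable_def)
  have "Ck_on (Suc 0) (\<lambda>z. frechet_derivative (\<lambda>z. ?h z v w) (at z) u) ?S" for u v w
    using in_chart_Ck_on[of "Suc (Suc 0)" v w] by simp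
  then have "(\<lambda>z. frechet_derivative (\<lambda>z. ?h z v w) (at z) u) differentiable (at z)" for u v w
    using z by auto
  then have dP: "(\<lambda>z. P z v w k) differentiable (at z)" for v w k
    unfolding P_def by (intro derivative_intros) auto
  have "X differentiable (at z)"
    unfolding X_def[abs_def] using gr[OF z] unfolding gram_def
    by (intro differentiable_add differentiable_scaleR differentiable_divide differentiable_diff
        differentiable_mult differentiable_power dh dP differentiable_const)
  then obtain D where "(X has_derivative D) (at z)" unfolding differentiable_def by blast
  from has_derivative_transform_within_open[OF this in_chart_open z eq] show ?thesis
    unfolding differentiable_def by blast
qed

text \<open>In dimension two the curvature tensor is skew in \<open>u\<close>, \<open>v\<close> and
  in \<open>w\<close>, \<open>x\<close>, so it is a scalar \<open>\<rho>\<close> times a product of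
  two area forms. The hypothesis on the plane of \<open>e1\<close> and \<open>e2\<close> evaluates
  \<open>\<rho>\<close>, and the Gram identity converts the area forms back into products of
  \<open>h\<close>.\<close>

lemma constant_curvature_chart_in_chart:
  assumes K: "constant_gaussian_curvature A g \<kappa>"
  shows "constant_curvature_chart (snd C ` fst C) (in_chart A g C) (christoffel A g C)
    (\<lambda>z u v w. frechet_derivative (\<lambda>z. christoffel A g C z v w) (at z) u) \<kappa>"
proof
  let ?h = "in_chart A g C" and ?S = "snd C ` fst C" and ?G = "christoffel A g C"
  let ?G' = "\<lambda>z u v w. frechet_derivative (\<lambda>z. ?G z v w) (at z) u"
  show "open ?S" by (rule in_chart_open)
  fix z assume z: "z \<in> ?S"
  note LC = christoffel_in_chart[unfolded levi_civita_form_def]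
  show bil: "bilinear (?h z)" and sym: "?h z v w = ?h z w v" for v w
    by (rule in_chart_bilinear[OF z] in_chart_sym[OF z])+
  show nd: "v = 0" if "\<And>w. ?h z v w = 0" for v by (rule in_chart_nondegenerate[OF z that])
  show bilG: "bilinear (?G z)" and symG: "?G z v w = ?G z w v" for v w using LC[OF z] by auto
  have fd: "frechet_derivative (\<lambda>z. ?h z v w) (at y) u = ?h y (?G y u v) w + ?h y v (?G y u w)"
    if "y \<in> ?S" for y u v w using LC[OF that] by auto
  have dh: "((\<lambda>z. ?h z v w) has_derivative (\<lambda>u. ?h y (?G y u v) w + ?h y v (?G y u w))) (at y)"
    if "y \<in> ?S" for y v w
  proof -
    have "frechet_derivative (\<lambda>z. ?h z v w) (at y) = (\<lambda>u. ?h y (?G y u v) w + ?h y v (?G y u w))"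
      using fd[OF that] by auto
    then show ?thesis using in_chart_has_frechet_derivative[OF that, of v w] by simp
  qed
  show "((\<lambda>z. ?h z v w) has_derivative (\<lambda>u. ?h z (?G z u v) w + ?h z v (?G z u w))) (at z)" for v w
    by (rule dh[OF z])
  show dG: "((\<lambda>z. ?G z v w) has_derivative (\<lambda>u. ?G' z u v w)) (at z)" for v w
    using christoffel_differentiable[OF z, of v w] unfolding frechet_derivative_works by simp
  define R where "R u v w = ?G' z u v w - ?G' z v u w + ?G z u (?G z v w) - ?G z v (?G z u w)" for u v w
  have bilG': "bilinear (?G' z u)" for u
    by (rule bilinear_derivative[OF in_chart_open z _ dG]) (use LC in auto)
  note lins = bilinear_ladd[OF bilG] bilinear_radd[OF bilG] bilinear_lmul[OF bilG] bilinear_rmul[OF bilG]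
    bilinear_ladd[OF bilG'] bilinear_radd[OF bilG'] bilinear_lmul[OF bilG'] bilinear_rmul[OF bilG']
    linear_add[OF has_derivative_linear[OF dG]] linear_scale[OF has_derivative_linear[OF dG]]
  have R1: "bilinear (\<lambda>u v. R u v w)" for w
    unfolding bilinear_def R_def
    by (intro conjI allI linearI) (simp_all add: lins algebra_simps)
  have R2: "linear (R u v)" for u v
    unfolding R_def by (rule linearI) (simp_all add: lins algebra_simps)
  have R3: "R u v w = - R v u w" for u v w by (simp add: R_def)
  note linh = bilinear_ladd[OF bil] bilinear_radd[OF bil] bilinear_lmul[OF bil] bilinear_rmul[OF bil]
    bilinear_lneg[OF bil] bilinear_lsub[OF bil] bilinear_rsub[OF bil]
  \<comment> \<open>The second derivatives of \<open>h z v w\<close> in the directions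
    \<open>u\<close> and \<open>x\<close> commute. Written out by metric compatibility, their
    difference is the sum of the two curvature products.\<close>
  have skew: "?h z (R u x v) w = - ?h z (R u x w) v" for u x v w
  proof -
    define E where "E u y = ?h y (?G y u v) w + ?h y v (?G y u w)" for u y
    define E' where "E' u x = (?h z (?G z x (?G z u v)) w + ?h z (?G z u v) (?G z x w))
        + ?h z (?G' z x u v) w
        + ((?h z (?G z x v) (?G z u w) + ?h z v (?G z x (?G z u w))) + ?h z v (?G' z x u w))" for u x
    have d: "(E u has_derivative (\<lambda>x. E' u x)) (at z)" for u
      unfolding E_def[abs_def] E'_def
      using has_derivative_add[OF
        has_derivative_bilinear_family[OF in_chart_open z in_chart_bilinear dh[OF z] has_derivative_ident dG[of u v] has_derivative_const[of w]]
        has_derivative_bilinear_family[OF in_chart_open z in_chart_bilinear dh[OF z] has_derivative_ident has_derivative_const[of v] dG[of u w]]]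
      by (simp add: bilinear_lzero[OF bil] bilinear_rzero[OF bil])
    have "frechet_derivative (\<lambda>y. frechet_derivative (\<lambda>z. ?h z v w) (at y) u) (at z) x = E' u x" for u x
    proof -
      have "frechet_derivative (\<lambda>y. frechet_derivative (\<lambda>z. ?h z v w) (at y) u) (at z)
          = frechet_derivative (E u) (at z)"
        by (rule frechet_derivative_cong_open[OF in_chart_open z]) (simp add: fd E_def)
      then show ?thesis using frechet_derivative_at[OF d] by metis
    qed
    then have "E' u x = E' x u"
      using second_derivative_symmetric[OF in_chart_open z in_chart_Ck_on, of v w u x] by simp
    then show ?thesis by (simp add: E'_def R_def linh sym algebra_simps)
  qed
  define \<rho> where "\<rho> = ?h z (R e1 e2 e1) e2"
  have Rh: "?h z (R u v w) x = area_form u v * area_form w x * \<rho>" for u v w x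
  proof -
    have "R u v w = area_form u v *\<^sub>R R e1 e2 w" by (rule alternating_plane[OF R1 R3])
    moreover have "?h z (R e1 e2 w) x = area_form w x *\<^sub>R ?h z (R e1 e2 e1) e2"
    proof (rule alternating_plane)
      show "bilinear (\<lambda>w. ?h z (R e1 e2 w))"
        unfolding bilinear_def
        by (intro conjI allI linearI) (simp_all add: linh linear_add[OF R2] linear_scale[OF R2])
    qed (rule skew)
    ultimately show ?thesis by (simp add: linh \<rho>_def)
  qed
  have gr: "gram (?h z) \<noteq> 0" by (rule gram_nonzero[OF bil sym]) (use nd in blast)
  have "?h z (R e1 e2 e2) e1 / gram (?h z) = \<kappa>"
    using K[unfolded constant_gaussian_curvature_def Let_def riemann_def, rule_format, OF C z, of e1 e2] gr
    by (simp add: R_def gram_def)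
  then have \<rho>: "\<rho> = - \<kappa> * gram (?h z)"
    using gr by (simp add: Rh area_form_def axis_def field_simps)
  show "?h z (?G' z u v w - ?G' z v u w + ?G z u (?G z v w) - ?G z v (?G z u w)) x =
      \<kappa> * (?h z v w * ?h z u x - ?h z u w * ?h z v x)" for u v w x
    unfolding R_def[symmetric] Rh \<rho>
    using gram_identity[OF bil sym, of u w v x] by (simp add: algebra_simps sym)
qed

end

text \<open>The bilinear rule with a dummy real argument that is kept equal to 1.\<close>

lemma has_derivative_linear_family:
  fixes f :: "'e::real_normed_vector \<Rightarrow> 'b::euclidean_space \<Rightarrow> 'c::real_normed_vector"
    and p :: "'a::real_normed_vector \<Rightarrow> 'e"
  assumes S: "open S" "p y \<in> S" and lin: "\<And>z. z \<in> S \<Longrightarrow> linear (f z)"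
    and der: "\<And>v. ((\<lambda>z. f z v) has_derivative (\<lambda>u. f' u v)) (at (p y))"
    and p: "(p has_derivative p') (at y)" and A: "(A has_derivative A') (at y)"
  shows "((\<lambda>x. f (p x) (A x)) has_derivative (\<lambda>v. f' (p' v) (A y) + f (p y) (A' v))) (at y)"
proof -
  have "bilinear (\<lambda>v (r::real). r *\<^sub>R f z v)" if "z \<in> S" for z
    using lin[OF that] unfolding bilinear_def
    by (auto intro!: linearI simp: linear_add linear_scale scaleR_add_right scaleR_add_left mult.commute)
  from has_derivative_bilinear_family[OF S this has_derivative_scaleR_right[OF der] p A has_derivative_const[of 1]]
  show ?thesis by simp
qed

lemma linear_inj_surj:
  fixes L :: "'a::euclidean_space \<Rightarrow> 'b::euclidean_space"
  assumes "linear L" "inj L" "DIM('a) = DIM('b)"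
  shows "surj L"
proof -
  have "dim (range L) = dim (UNIV :: 'a set)"
    using assms by (intro dim_image_eq) auto
  then have "span (range L) = UNIV" using assms(3) dim_eq_full[of "range L"] by simp
  moreover have "subspace (range L)" using assms(1) linear_subspace_image subspace_UNIV by blast
  ultimately show ?thesis by (metis span_eq_iff)
qed

section \<open>Metric compatibility along maps and curves in the surface\<close>

context constant_curvature_chart
begin

text \<open>The term \<open>A' v + \<Gamma> (p y) (p' v) (A y)\<close> is the covariant derivative
  along \<open>p\<close> of the field \<open>A\<close>. Metric compatibility thus survives the
  pullback by \<open>p\<close>, for fields that live only along \<open>p\<close>.\<close>

lemma has_derivative_metric:
  fixes p :: "'a::real_normed_vector \<Rightarrow> real^2"
  assumes "p y \<in> S" "(p has_derivative p') (at y)"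
    "(A has_derivative A') (at y)" "(B has_derivative B') (at y)"
  shows "((\<lambda>x. h (p x) (A x) (B x)) has_derivative
    (\<lambda>v. h (p y) (A' v + \<Gamma> (p y) (p' v) (A y)) (B y) + h (p y) (A y) (B' v + \<Gamma> (p y) (p' v) (B y)))) (at y)"
  using has_derivative_bilinear_family[OF open_S assms(1) bil has_derivative_h[OF assms(1)] assms(2-4)]
  by (simp add: bilinear_ladd[OF bil[OF assms(1)]] bilinear_radd[OF bil[OF assms(1)]] algebra_simps)

lemma has_real_derivative_metric:
  assumes "x t \<in> S" "(x has_vector_derivative x') (at t)"
    "(A has_vector_derivative A') (at t)" "(B has_vector_derivative B') (at t)"
  shows "((\<lambda>s. h (x s) (A s) (B s)) has_real_derivative
    h (x t) (A' + \<Gamma> (x t) x' (A t)) (B t) + h (x t) (A t) (B' + \<Gamma> (x t) x' (B t))) (at t)"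
proof -
  note l = bilinear_lmul[OF bil_\<Gamma>[OF assms(1)]] scaleR_add_right[symmetric]
    bilinear_lmul[OF bil[OF assms(1)]] bilinear_rmul[OF bil[OF assms(1)]]
  show ?thesis
    using has_derivative_metric[OF assms(1) assms(2-4)[unfolded has_vector_derivative_def]]
    by (simp add: l has_field_derivative_def distrib_left[symmetric] mult_commute_abs)
qed

lemma gram_nz: "z \<in> S \<Longrightarrow> gram (h z) \<noteq> 0"
  using gram_nonzero[OF bil sym] nondeg by blast

text \<open>The Gram determinant of the velocity and the parallel field is constant. If it does not vanish,
  the acceleration is orthogonal to a basis; otherwise the velocity is a constant multiple of the
  parallel field.\<close>

lemma geodesic_if_constant_angle:
  assumes J: "open J" "t \<in> J" and x: "\<And>s. s \<in> J \<Longrightarrow> x s \<in> S"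
    and x': "\<And>s. s \<in> J \<Longrightarrow> (x has_vector_derivative x' s) (at s)"
    and x'': "(x' has_vector_derivative x'') (at t)"
    and V: "(V has_vector_derivative V') (at t)" and par: "V' + \<Gamma> (x t) (x' t) (V t) = 0"
    and unit: "\<And>s. s \<in> J \<Longrightarrow> h (x s) (V s) (V s) = 1"
    and e: "\<And>s. s \<in> J \<Longrightarrow> h (x s) (x' s) (x' s) = e"
    and f: "\<And>s. s \<in> J \<Longrightarrow> h (x s) (x' s) (V s) = f"
  shows "x'' + \<Gamma> (x t) (x' t) (x' t) = 0"
proof -
  let ?N = "x'' + \<Gamma> (x t) (x' t) (x' t)"
  note xt = x[OF J(2)]
  have "((\<lambda>s. h (x s) (x' s) (V s)) has_real_derivative 0) (at t)"
    by (rule has_field_derivative_transform_within_open[OF DERIV_const J]) (use f in simp)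
  then have NV: "h (x t) ?N (V t) = 0"
    using DERIV_unique[OF has_real_derivative_metric[OF xt x'[OF J(2)] x'' V]] par
    by (simp add: bilinear_rzero[OF bil[OF xt]])
  have d0: "((\<lambda>s. h (x s) (x' s) (x' s)) has_real_derivative 0) (at t)"
    by (rule has_field_derivative_transform_within_open[OF DERIV_const J]) (use e in simp)
  have Nx: "h (x t) ?N (x' t) = 0"
    using DERIV_unique[OF has_real_derivative_metric[OF xt x'[OF J(2)] x'' x''] d0] sym[OF xt, of "x' t" ?N]
    by simp
  have area: "area_form (x' s) (V s) * area_form (x' s) (V s) * gram (h (x s)) = e - f * f" if "s \<in> J" for s
    using gram_identity[OF bil[OF x[OF that]] sym[OF x[OF that]], of "x' s" "x' s" "V s" "V s"] x[OF that] e f unit that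
      sym[of "x s" "V s" "x' s"] by simp
  show ?thesis
  proof (cases "e = f * f")
    case False
    \<comment> \<open>Both products on the left of the Gram identity contain a product of the
      acceleration with \<open>x' t\<close> or \<open>V t\<close>, and these are zero.\<close>
    have "area_form ?N w * area_form (x' t) (V t) * gram (h (x t)) = 0" for w
      using gram_identity[OF bil[OF xt] sym[OF xt], of ?N "x' t" w "V t"] Nx NV by simp
    moreover have "area_form (x' t) (V t) \<noteq> 0" using area[OF J(2)] False by auto
    ultimately have "area_form ?N w = 0" for w using gram_nz[OF xt] by simp
    from this[of e2] this[of e1] show ?thesis
      by (simp add: area_form_def axis_def vec_eq_iff forall_2)
  next
    case True
    have "x' s = f *\<^sub>R V s" if s: "s \<in> J" for s
    proof -
      have "area_form (x' s) (V s) = 0" using area[OF s] True gram_nz[OF x[OF s]] by simp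
      \<comment> \<open>With \<open>V s\<close> in two places, the Gram identity and the vanishing
        area give equal products of \<open>x' s\<close> and of \<open>f *\<^sub>R V s\<close> with
        every \<open>z\<close>.\<close>
      then have "h (x s) (x' s - f *\<^sub>R V s) z = 0" for z
        using gram_identity[OF bil[OF x[OF s]] sym[OF x[OF s]], of "x' s" z "V s" "V s"] unit[OF s] f[OF s]
        by (simp add: bilinear_lsub[OF bil[OF x[OF s]]] bilinear_lmul[OF bil[OF x[OF s]]])
      then show ?thesis using nondeg[OF x[OF s], of "x' s - f *\<^sub>R V s"] by simp
    qed
    then have eq: "f *\<^sub>R V s = x' s" if "s \<in> J" for s using that by simp
    have "((\<lambda>s. f *\<^sub>R V s) has_vector_derivative f *\<^sub>R V') (at t)"
      using V by (auto intro!: derivative_eq_intros)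
    then have "(x' has_vector_derivative f *\<^sub>R V') (at t)"
      by (rule has_vector_derivative_transform_within_open[OF _ J]) (rule eq)
    then have "x'' = f *\<^sub>R V'" using vector_derivative_unique_at[OF x''] by blast
    moreover have "\<Gamma> (x t) (x' t) (x' t) = f *\<^sub>R \<Gamma> (x t) (x' t) (V t)"
      using eq[OF J(2)] bilinear_rmul[OF bil_\<Gamma>[OF xt], of "x' t" f "V t"] by simp
    ultimately show ?thesis using par by (simp flip: scaleR_add_right)
  qed
qed

end

section \<open>The Kaluza-Klein metric on an immersed piece of the unit tangent bundle\<close>

text \<open>The pair of \<open>p\<close> and \<open>u\<close> is a parametrization of unit vectors
  in the coordinates of the tangent bundle, and \<open>m\<close> stands for a + c. The three
  nonvanishing conditions are nondegeneracy of the metric on horizontal vectors orthogonal to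
  \<open>u\<close>, along \<open>u\<close>, and on vertical vectors.\<close>

locale unit_immersion = constant_curvature_chart +
  fixes U :: "(real^3) set" and p u :: "real^3 \<Rightarrow> real^2" and m d a :: real
  assumes open_U: "open U" and p_S: "y \<in> U \<Longrightarrow> p y \<in> S"
    and p_Ck: "Ck_on k p U" and u_Ck: "Ck_on k u U"
    and unit: "y \<in> U \<Longrightarrow> h (p y) (u y) (u y) = 1"
    and immersion: "y \<in> U \<Longrightarrow> frechet_derivative p (at y) v = 0 \<Longrightarrow>
      frechet_derivative u (at y) v = 0 \<Longrightarrow> v = 0"
    and m_nz: "m \<noteq> 0" and md_nz: "m + d \<noteq> 0" and a_nz: "a \<noteq> 0" and \<kappa>_a: "\<kappa> * a = m"
begin

text \<open>A tangent vector \<open>v\<close> has the horizontal part \<open>X v\<close> and the vertical part \<open>Y v\<close>; the covariant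
  derivatives along \<open>v\<close> of the fields \<open>X w\<close> and \<open>Y w\<close> are \<open>X' v w\<close> and \<open>Y' v w\<close>.\<close>

definition X :: "real^3 \<Rightarrow> real^3 \<Rightarrow> real^2" where
  "X y v = frechet_derivative p (at y) v"

definition Y :: "real^3 \<Rightarrow> real^3 \<Rightarrow> real^2" where
  "Y y v = frechet_derivative u (at y) v + \<Gamma> (p y) (X y v) (u y)"

definition X' :: "real^3 \<Rightarrow> real^3 \<Rightarrow> real^3 \<Rightarrow> real^2" where
  "X' y v w = frechet_derivative (\<lambda>z. X z w) (at y) v + \<Gamma> (p y) (X y v) (X y w)"

definition Y' :: "real^3 \<Rightarrow> real^3 \<Rightarrow> real^3 \<Rightarrow> real^2" where
  "Y' y v w = frechet_derivative (\<lambda>z. Y z w) (at y) v + \<Gamma> (p y) (X y v) (Y y w)"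

text \<open>The Kaluza-Klein metric without its term - a h(Y v, u) h(Y w, u), which vanishes on
  tangent vectors of the unit bundle by \<open>Y_unit\<close>.\<close>

definition H :: "real^3 \<Rightarrow> real^3 \<Rightarrow> real^3 \<Rightarrow> real" where
  "H y v w = m * h (p y) (X y v) (X y w) + d * (h (p y) (X y v) (u y) * h (p y) (X y w) (u y))
    + a * h (p y) (Y y v) (Y y w)"

text \<open>The derivative of \<open>H\<close> in the direction \<open>s\<close>. The covariant
  derivative of \<open>u\<close> along \<open>s\<close> is \<open>Y y s\<close>, which accounts for
  the mixed products of horizontal and vertical parts.\<close>

definition H' :: "real^3 \<Rightarrow> real^3 \<Rightarrow> real^3 \<Rightarrow> real^3 \<Rightarrow> real" where
  "H' y s v w = m * (h (p y) (X' y s v) (X y w) + h (p y) (X y v) (X' y s w))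
    + d * ((h (p y) (X' y s v) (u y) + h (p y) (X y v) (Y y s)) * h (p y) (X y w) (u y)
         + h (p y) (X y v) (u y) * (h (p y) (X' y s w) (u y) + h (p y) (X y w) (Y y s)))
    + a * (h (p y) (Y' y s v) (Y y w) + h (p y) (Y y v) (Y' y s w))"

lemma p_has_derivative: "y \<in> U \<Longrightarrow> (p has_derivative X y) (at y)"
  using has_derivative_Ck_on[OF p_Ck] by (simp add: X_def[abs_def])

lemma u_has_derivative: "y \<in> U \<Longrightarrow> (u has_derivative frechet_derivative u (at y)) (at y)"
  using has_derivative_Ck_on[OF u_Ck] by simp

lemma linear_X: "y \<in> U \<Longrightarrow> linear (X y)"
  by (rule has_derivative_linear[OF p_has_derivative])

lemma linear_Y:
  assumes y: "y \<in> U"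
  shows "linear (Y y)"
  unfolding Y_def
  by (intro linearI)
     (simp_all add: linear_add[OF linear_X[OF y]] linear_scale[OF linear_X[OF y]]
       linear_add[OF has_derivative_linear[OF u_has_derivative[OF y]]]
       linear_scale[OF has_derivative_linear[OF u_has_derivative[OF y]]]
       bilinear_ladd[OF bil_\<Gamma>[OF p_S[OF y]]] bilinear_lmul[OF bil_\<Gamma>[OF p_S[OF y]]] scaleR_add_right)

lemma X_has_derivative:
  assumes "y \<in> U"
  shows "((\<lambda>z. X z v) has_derivative frechet_derivative (\<lambda>z. X z v) (at y)) (at y)"
proof -
  have "Ck_on (Suc 0) (\<lambda>z. X z v) U"
    using p_Ck[of "Suc (Suc 0)"] unfolding X_def by (simp only: Ck_on.simps(2)[of "Suc 0"] simp_thms)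
  from has_derivative_Ck_on[OF this assms] show ?thesis .
qed

lemma du_has_derivative:
  assumes "y \<in> U"
  shows "((\<lambda>z. frechet_derivative u (at z) v) has_derivative
    frechet_derivative (\<lambda>z. frechet_derivative u (at z) v) (at y)) (at y)"
proof -
  have "Ck_on (Suc 0) (\<lambda>z. frechet_derivative u (at z) v) U"
    using u_Ck[of "Suc (Suc 0)"] by (simp only: Ck_on.simps(2)[of "Suc 0"] simp_thms)
  from has_derivative_Ck_on[OF this assms] show ?thesis .
qed

lemma Y_has_derivative_aux:
  assumes y: "y \<in> U"
  shows "((\<lambda>z. Y z w) has_derivative (\<lambda>v. frechet_derivative (\<lambda>z. frechet_derivative u (at z) w) (at y) v
    + (\<Gamma>' (p y) (X y v) (X y w) (u y) + \<Gamma> (p y) (frechet_derivative (\<lambda>z. X z w) (at y) v) (u y)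
      + \<Gamma> (p y) (X y w) (frechet_derivative u (at y) v)))) (at y)"
  unfolding Y_def
  by (intro has_derivative_add du_has_derivative[OF y]
      has_derivative_bilinear_family[OF open_S p_S[OF y] bil_\<Gamma> has_derivative_\<Gamma>[OF p_S[OF y]]
        p_has_derivative[OF y] X_has_derivative[OF y] u_has_derivative[OF y]])

lemma Y_has_derivative:
  assumes "y \<in> U"
  shows "((\<lambda>z. Y z v) has_derivative frechet_derivative (\<lambda>z. Y z v) (at y)) (at y)"
  using Y_has_derivative_aux[OF assms] frechet_derivative_works differentiable_def by blast

lemma X'_sym:
  assumes y: "y \<in> U"
  shows "X' y v w = X' y w v"
  using second_derivative_symmetric[OF open_U y p_Ck, of w v]
    sym_\<Gamma>[OF p_S[OF y], of "X y v" "X y w"]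
  by (simp add: X'_def X_def)

text \<open>\<open>Y y w\<close> is the covariant derivative of \<open>u\<close> along
  \<open>w\<close>, so the left side is the commutator of two covariant derivatives of
  \<open>u\<close>. Second derivatives of \<open>u\<close> and of \<open>p\<close> cancel, and the
  curvature R(X v, X w) u is left.\<close>

lemma Y'_antisym:
  assumes y: "y \<in> U"
  shows "h (p y) (Y' y v w) x - h (p y) (Y' y w v) x =
    \<kappa> * (h (p y) (X y w) (u y) * h (p y) (X y v) x - h (p y) (X y v) (u y) * h (p y) (X y w) x)"
proof -
  let ?G = "\<Gamma> (p y)"
  have fd: "frechet_derivative (\<lambda>z. Y z w) (at y) v =
    frechet_derivative (\<lambda>z. frechet_derivative u (at z) w) (at y) v
    + (\<Gamma>' (p y) (X y v) (X y w) (u y) + ?G (frechet_derivative (\<lambda>z. X z w) (at y) v) (u y)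
      + ?G (X y w) (frechet_derivative u (at y) v))" for v w
    by (rule fun_cong[OF frechet_derivative_at[OF Y_has_derivative_aux[OF y, of w]], symmetric])
  have su: "frechet_derivative (\<lambda>z. frechet_derivative u (at z) w) (at y) v =
    frechet_derivative (\<lambda>z. frechet_derivative u (at z) v) (at y) w" for v w
    by (rule second_derivative_symmetric[OF open_U y u_Ck])
  have sp: "frechet_derivative (\<lambda>z. X z w) (at y) v = frechet_derivative (\<lambda>z. X z v) (at y) w" for v w
    unfolding X_def by (rule second_derivative_symmetric[OF open_U y p_Ck])
  have "Y' y v w - Y' y w v = \<Gamma>' (p y) (X y v) (X y w) (u y) - \<Gamma>' (p y) (X y w) (X y v) (u y)
      + ?G (X y v) (?G (X y w) (u y)) - ?G (X y w) (?G (X y v) (u y))"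
    unfolding Y'_def fd su[of w v] sp[of w v]
    by (simp add: Y_def bilinear_radd[OF bil_\<Gamma>[OF p_S[OF y]]] algebra_simps)
  then have "h (p y) (Y' y v w - Y' y w v) x = \<kappa> * (h (p y) (X y w) (u y) * h (p y) (X y v) x
      - h (p y) (X y v) (u y) * h (p y) (X y w) x)"
    using curvature[OF p_S[OF y]] by simp
  then show ?thesis by (simp add: bilinear_lsub[OF bil[OF p_S[OF y]]])
qed

lemma Y_unit:
  assumes y: "y \<in> U"
  shows "h (p y) (Y y v) (u y) = 0"
proof -
  have "((\<lambda>z. h (p z) (u z) (u z)) has_derivative (\<lambda>_. 0)) (at y)"
    by (rule has_derivative_transform_within_open[OF has_derivative_const[of 1] open_U y]) (simp add: unit)
  from has_derivative_unique[OF this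
      has_derivative_metric[OF p_S[OF y] p_has_derivative[OF y] u_has_derivative[OF y] u_has_derivative[OF y]]]
  have "0 = h (p y) (Y y v) (u y) + h (p y) (u y) (Y y v)"
    unfolding Y_def by meson
  then show ?thesis by (simp add: sym[OF p_S[OF y]])
qed

text \<open>Adding a multiple of \<open>u\<close> to the vertical part gives a linear map between
  spaces of dimension four. Pairing with \<open>u\<close> recovers the multiple, so the map is
  injective by the immersion property, hence onto; for \<open>B\<close> orthogonal to
  \<open>u\<close> the multiple is zero.\<close>

lemma exists_horizontal_vertical:
  assumes y: "y \<in> U" and B: "h (p y) B (u y) = 0"
  shows "\<exists>v. X y v = A \<and> Y y v = B"
proof -
  let ?L = "\<lambda>(v, s::real). (X y v, Y y v + s *\<^sub>R u y)"
  have lin: "linear ?L"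
    by (rule linearI)
       (auto simp: linear_add[OF linear_X[OF y]] linear_add[OF linear_Y[OF y]]
         linear_scale[OF linear_X[OF y]] linear_scale[OF linear_Y[OF y]] scaleR_add_left scaleR_add_right)
  have L: "s = h (p y) (Y y v + s *\<^sub>R u y) (u y)" for v s
    using Y_unit[OF y] unit[OF y]
    by (simp add: bilinear_ladd[OF bil[OF p_S[OF y]]] bilinear_lmul[OF bil[OF p_S[OF y]]])
  have "inj ?L"
    unfolding linear_injective_0[OF lin]
  proof (clarsimp simp: zero_prod_def)
    fix v s assume 0: "X y v = 0" "Y y v + s *\<^sub>R u y = 0"
    have s: "s = 0" using L[of s v] 0(2) by (simp add: bilinear_lzero[OF bil[OF p_S[OF y]]])
    then have "frechet_derivative u (at y) v = 0"
      using 0 by (simp add: Y_def bilinear_lzero[OF bil_\<Gamma>[OF p_S[OF y]]])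
    then show "v = 0 \<and> s = 0" using immersion[OF y, of v] 0(1) s by (simp add: X_def)
  qed
  then have "surj ?L" by (intro linear_inj_surj[OF lin]) simp_all
  then obtain q where "(A, B) = ?L q" unfolding surj_def by blast
  then obtain v s where vs: "X y v = A" "Y y v + s *\<^sub>R u y = B" by (cases q) (use that in auto)
  with L[of s v] B have "s = 0" by simp
  with vs show ?thesis by auto
qed

lemma bilinear_H:
  assumes y: "y \<in> U"
  shows "bilinear (H y)"
  unfolding bilinear_def H_def
  by (intro conjI allI linearI)
     (simp_all add: linear_add[OF linear_X[OF y]] linear_add[OF linear_Y[OF y]]
         linear_scale[OF linear_X[OF y]] linear_scale[OF linear_Y[OF y]]
         bilinear_ladd[OF bil[OF p_S[OF y]]] bilinear_lmul[OF bil[OF p_S[OF y]]]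
         bilinear_radd[OF bil[OF p_S[OF y]]] bilinear_rmul[OF bil[OF p_S[OF y]]] algebra_simps)

lemma sym_H: "y \<in> U \<Longrightarrow> H y v w = H y w v"
  by (simp add: H_def sym[OF p_S, of y "X y v"] sym[OF p_S, of y "Y y v"] mult.commute)

text \<open>Testing with \<open>u\<close> isolates the factor m + d and gives orthogonality to
  \<open>u\<close>. The second term then disappears and m alone remains.\<close>

lemma horizontal_zero:
  assumes y: "y \<in> U" and 0: "\<And>z. m * h (p y) A z + d * (h (p y) A (u y) * h (p y) z (u y)) = 0"
  shows "A = 0"
proof (rule nondeg[OF p_S[OF y]])
  have "(m + d) * h (p y) A (u y) = 0" using 0[of "u y"] unit[OF y] by (simp add: algebra_simps)
  then have "h (p y) A (u y) = 0" using md_nz by simp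
  then show "h (p y) A z = 0" for z using 0[of z] m_nz by simp
qed

lemma H_horizontal:
  assumes y: "y \<in> U" and 0: "\<And>w. Y y w = 0 \<Longrightarrow> H y v w = 0"
  shows "X y v = 0"
proof (rule horizontal_zero[OF y])
  fix z
  obtain w where w: "X y w = z" "Y y w = 0"
    using exists_horizontal_vertical[OF y, of 0 z] by (auto simp: bilinear_lzero[OF bil[OF p_S[OF y]]])
  show "m * h (p y) (X y v) z + d * (h (p y) (X y v) (u y) * h (p y) z (u y)) = 0"
    using 0[OF w(2)] w by (simp add: H_def bilinear_rzero[OF bil[OF p_S[OF y]]])
qed

lemma nondegenerate_H:
  assumes y: "y \<in> U" and 0: "\<And>w. H y v w = 0"
  shows "v = 0"
proof -
  note B = bil[OF p_S[OF y]]
  have X: "X y v = 0" using H_horizontal[OF y] 0 by blast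
  have "Y y v = 0"
  proof (rule nondeg[OF p_S[OF y]])
    fix z
    \<comment> \<open>Vertical parts fill only the orthogonal complement of \<open>u\<close>, so
      \<open>z\<close> is projected there first; its component along \<open>u\<close> pairs to zero
      with \<open>Y y v\<close>.\<close>
    define z' where "z' = z - h (p y) z (u y) *\<^sub>R u y"
    have "h (p y) z' (u y) = 0"
      using unit[OF y] by (simp add: z'_def bilinear_lsub[OF B] bilinear_lmul[OF B])
    then obtain w where w: "X y w = 0" "Y y w = z'" using exists_horizontal_vertical[OF y] by blast
    have "h (p y) (Y y v) z' = 0"
      using 0[of w] w X a_nz by (simp add: H_def bilinear_lzero[OF B] bilinear_rzero[OF B])
    then show "h (p y) (Y y v) z = 0"
      using Y_unit[OF y] by (simp add: z'_def bilinear_rsub[OF B] bilinear_rmul[OF B])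
  qed
  then show ?thesis
    using X immersion[OF y, of v] by (simp add: X_def Y_def bilinear_lzero[OF bil_\<Gamma>[OF p_S[OF y]]])
qed

lemma has_derivative_H:
  assumes y: "y \<in> U"
  shows "((\<lambda>z. H z v w) has_derivative (\<lambda>s. H' y s v w)) (at y)"
proof -
  note metric = has_derivative_metric[OF p_S[OF y] p_has_derivative[OF y]]
  note D = X_has_derivative[OF y] Y_has_derivative[OF y] u_has_derivative[OF y]
  show ?thesis
    unfolding H_def
    using has_derivative_add[OF has_derivative_add[OF
        has_derivative_mult_right[where x=m, OF metric[OF D(1)[of v] D(1)[of w]]]
        has_derivative_mult_right[where x=d, OF has_derivative_mult[OF metric[OF D(1)[of v] D(3)] metric[OF D(1)[of w] D(3)]]]]
        has_derivative_mult_right[where x=a, OF metric[OF D(2)[of v] D(2)[of w]]]]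
    by (rule has_derivative_eq_rhs) (simp add: fun_eq_iff H'_def X'_def Y'_def Y_def[of y] algebra_simps)
qed

text \<open>The last three lines of the formula are the curvature terms, evaluated with \<open>\<kappa> a = m\<close>.\<close>

lemma koszul_H:
  assumes y: "y \<in> U" and G: "levi_civita_form (H y) (H' y) G"
  shows "2 * H y (G v w) z =
    2 * m * h (p y) (X' y v w) (X y z) + 2 * d * h (p y) (X' y v w) (u y) * h (p y) (X y z) (u y)
    + d * (h (p y) (X y w) (Y y v) * h (p y) (X y z) (u y) + h (p y) (X y v) (Y y w) * h (p y) (X y z) (u y)
      + h (p y) (X y w) (u y) * h (p y) (X y z) (Y y v) + h (p y) (X y v) (u y) * h (p y) (X y z) (Y y w)
      - h (p y) (X y v) (Y y z) * h (p y) (X y w) (u y) - h (p y) (X y w) (Y y z) * h (p y) (X y v) (u y))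
    + 2 * a * h (p y) (Y' y v w) (Y y z)
    - m * (h (p y) (X y w) (u y) * h (p y) (X y v) (Y y z) - h (p y) (X y v) (u y) * h (p y) (X y w) (Y y z))
    + m * (h (p y) (X y z) (u y) * h (p y) (X y v) (Y y w) - h (p y) (X y v) (u y) * h (p y) (X y z) (Y y w))
    + m * (h (p y) (X y z) (u y) * h (p y) (X y w) (Y y v) - h (p y) (X y w) (u y) * h (p y) (X y z) (Y y v))"
proof -
  have Y': "a * h (p y) (Y' y v w) x = a * h (p y) (Y' y w v) x
    + m * (h (p y) (X y w) (u y) * h (p y) (X y v) x - h (p y) (X y v) (u y) * h (p y) (X y w) x)" for v w x
    using arg_cong[OF Y'_antisym[OF y, of v w x], of "\<lambda>r. a * r"] by (simp add: algebra_simps flip: \<kappa>_a)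
  show ?thesis
    unfolding koszul[OF G sym_H[OF y]] H'_def
    using X'_sym[OF y, of w v] X'_sym[OF y, of z v] X'_sym[OF y, of z w]
      Y'[of w v "Y y z"] Y'[of z v "Y y w"] Y'[of z w "Y y v"]
      sym[OF p_S[OF y], of "X y v" "X' y w z"] sym[OF p_S[OF y], of "X y w" "X' y v z"]
      sym[OF p_S[OF y], of "Y y v" "Y' y w z"] sym[OF p_S[OF y], of "Y y w" "Y' y v z"]
      sym[OF p_S[OF y], of "Y y v" "Y' y z w"] sym[OF p_S[OF y], of "Y y w" "Y' y z v"]
      sym[OF p_S[OF y], of "X y z" "X' y v w"] sym[OF p_S[OF y], of "Y y z" "Y' y v w"]
      sym[OF p_S[OF y], of "Y y z" "Y' y w v"]
    by (simp add: algebra_simps)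
qed

end

section \<open>Horizontal Frenet curves in a chart of the unit tangent bundle\<close>

context unit_immersion
begin

text \<open>The derivative is an ordinary one, hence the subtracted Christoffel term. The covariant
  derivative of the field along the curve is \<open>X' (b t) T (W t) + X (b t) W'\<close>.\<close>

lemma X_along_curve:
  assumes y: "b t \<in> U" and b: "(b has_vector_derivative T) (at t)"
    and W: "(W has_vector_derivative W') (at t)"
  shows "((\<lambda>s. X (b s) (W s)) has_vector_derivative
    X' (b t) T (W t) + X (b t) W' - \<Gamma> (p (b t)) (X (b t) T) (X (b t) (W t))) (at t)"
  using has_derivative_linear_family[OF open_U y linear_X X_has_derivative[OF y]
      b[unfolded has_vector_derivative_def] W[unfolded has_vector_derivative_def]]
  by (simp add: has_vector_derivative_def X'_def linear_scale[OF linear_X[OF y]]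
      linear_scale[OF has_derivative_linear[OF X_has_derivative[OF y]]] scaleR_add_right)

lemma Y_along_curve:
  assumes y: "b t \<in> U" and b: "(b has_vector_derivative T) (at t)"
    and W: "(W has_vector_derivative W') (at t)"
  shows "((\<lambda>s. Y (b s) (W s)) has_vector_derivative
    Y' (b t) T (W t) + Y (b t) W' - \<Gamma> (p (b t)) (X (b t) T) (Y (b t) (W t))) (at t)"
  using has_derivative_linear_family[OF open_U y linear_Y Y_has_derivative[OF y]
      b[unfolded has_vector_derivative_def] W[unfolded has_vector_derivative_def]]
  by (simp add: has_vector_derivative_def Y'_def linear_scale[OF linear_Y[OF y]]
      linear_scale[OF has_derivative_linear[OF Y_has_derivative[OF y]]] scaleR_add_right)

lemma p_along_curve:
  assumes y: "b t \<in> U" and b: "(b has_vector_derivative T) (at t)"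
  shows "((\<lambda>s. p (b s)) has_vector_derivative X (b t) T) (at t)"
  using has_derivative_compose[OF b[unfolded has_vector_derivative_def] p_has_derivative[OF y]]
  by (simp add: has_vector_derivative_def linear_scale[OF linear_X[OF y]])

lemma u_along_curve:
  assumes y: "b t \<in> U" and b: "(b has_vector_derivative T) (at t)"
  shows "((\<lambda>s. u (b s)) has_vector_derivative frechet_derivative u (at (b t)) T) (at t)"
  using has_derivative_compose[OF b[unfolded has_vector_derivative_def] u_has_derivative[OF y]]
  by (simp add: has_vector_derivative_def linear_scale[OF has_derivative_linear[OF u_has_derivative[OF y]]])

end

text \<open>A helix during the times \<open>J\<close> spent in one chart. The connection
  \<open>G\<close> is known only through \<open>levi_civita_form\<close>, zero torsion is built into
  \<open>frenet_W\<close>, which has no second normal, and \<open>angle\<close> holds the constant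
  product with the direction field.\<close>

locale horizontal_frenet_curve = unit_immersion +
  fixes J :: "real set" and b T T' W W' :: "real \<Rightarrow> real^3"
    and G :: "real \<Rightarrow> real^3 \<Rightarrow> real^3 \<Rightarrow> real^3" and k :: "real \<Rightarrow> real" and \<epsilon> \<epsilon>1 f :: real
  assumes open_J: "open J" and b_U: "s \<in> J \<Longrightarrow> b s \<in> U"
    and b': "s \<in> J \<Longrightarrow> (b has_vector_derivative T s) (at s)"
    and T': "s \<in> J \<Longrightarrow> (T has_vector_derivative T' s) (at s)"
    and W': "s \<in> J \<Longrightarrow> (W has_vector_derivative W' s) (at s)"
    and G: "s \<in> J \<Longrightarrow> levi_civita_form (H (b s)) (H' (b s)) (G s)"
    and frenet_T: "s \<in> J \<Longrightarrow> T' s + G s (T s) (T s) = (\<epsilon>1 * k s) *\<^sub>R W s"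
    and frenet_W: "s \<in> J \<Longrightarrow> W' s + G s (T s) (W s) = - (\<epsilon> * k s) *\<^sub>R T s"
    and H_T: "s \<in> J \<Longrightarrow> H (b s) (T s) (T s) = \<epsilon>" and H_W: "s \<in> J \<Longrightarrow> H (b s) (W s) (W s) = \<epsilon>1"
    and \<epsilon>: "\<epsilon>\<^sup>2 = 1" and \<epsilon>1: "\<epsilon>1\<^sup>2 = 1" and k_nz: "s \<in> J \<Longrightarrow> k s \<noteq> 0"
    and horizontal: "s \<in> J \<Longrightarrow> Y (b s) (T s) = 0"
    and angle: "s \<in> J \<Longrightarrow> h (p (b s)) (X (b s) (T s)) (u (b s)) = f"
begin

lemma Y'_T:
  assumes s: "s \<in> J"
  shows "Y' (b s) (T s) (T s) + Y (b s) (T' s) = 0"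
proof -
  have "((\<lambda>s. Y (b s) (T s)) has_vector_derivative 0) (at s)"
    by (rule has_vector_derivative_transform_within_open[OF has_vector_derivative_const open_J s])
       (simp add: horizontal)
  from vector_derivative_unique_at[OF Y_along_curve[OF b_U[OF s] b'[OF s] T'[OF s]] this]
  show ?thesis by (simp add: horizontal[OF s] bilinear_rzero[OF bil_\<Gamma>[OF p_S[OF b_U[OF s]]]])
qed

lemma acceleration_zero:
  assumes s: "s \<in> J"
  shows "X' (b s) (T s) (T s) + X (b s) (T' s) = 0"
proof -
  have par: "frechet_derivative u (at (b s)) (T s) + \<Gamma> (p (b s)) (X (b s) (T s)) (u (b s)) = 0"
    using horizontal[OF s] by (simp add: Y_def)
  \<comment> \<open>With zero vertical part, \<open>H_T\<close> reads m g(x', x') + d f^2 =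
    \<epsilon>, which fixes the constant.\<close>
  have e: "h (p (b r)) (X (b r) (T r)) (X (b r) (T r)) = (\<epsilon> - d * f\<^sup>2) / m" if r: "r \<in> J" for r
    using H_T[OF r] m_nz
    by (simp add: H_def horizontal[OF r] angle[OF r] bilinear_lzero[OF bil[OF p_S[OF b_U[OF r]]]]
        power2_eq_square field_simps)
  from geodesic_if_constant_angle[OF open_J s p_S[OF b_U] p_along_curve[OF b_U b'],
      OF _ _ _ X_along_curve[OF b_U[OF s] b'[OF s] T'[OF s]] u_along_curve[OF b_U[OF s] b'[OF s]] par
        unit[OF b_U] e angle]
  show ?thesis by simp
qed

text \<open>The first Frenet equation paired with \<open>z\<close>. Second-order terms vanish
  because \<open>x\<close> is a geodesic and the velocity stays horizontal; the curvature terms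
  cancel since both arguments of the connection are \<open>T s\<close>. One mixed product with
  coefficient d survives.\<close>

lemma H_normal:
  assumes s: "s \<in> J"
  shows "\<epsilon>1 * k s * H (b s) (W s) z = - (d * f * h (p (b s)) (X (b s) (T s)) (Y (b s) z))"
proof -
  let ?y = "b s"
  note y = b_U[OF s]
  note B = bil[OF p_S[OF y]]
  have "2 * (\<epsilon>1 * k s * H ?y (W s) z) = 2 * H ?y (T' s + G s (T s) (T s)) z"
    by (simp add: frenet_T[OF s] bilinear_lmul[OF bilinear_H[OF y]])
  also have "\<dots> = 2 * H ?y (T' s) z + 2 * H ?y (G s (T s) (T s)) z"
    by (simp add: bilinear_ladd[OF bilinear_H[OF y]])
  also have "\<dots> = 2 * m * h (p ?y) (X' ?y (T s) (T s) + X ?y (T' s)) (X ?y z)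
      + 2 * d * h (p ?y) (X' ?y (T s) (T s) + X ?y (T' s)) (u ?y) * h (p ?y) (X ?y z) (u ?y)
      + 2 * a * h (p ?y) (Y' ?y (T s) (T s) + Y ?y (T' s)) (Y ?y z)
      - 2 * (d * f * h (p ?y) (X ?y (T s)) (Y ?y z))"
    unfolding koszul_H[OF y G[OF s]] unfolding H_def horizontal[OF s] angle[OF s]
    by (simp add: bilinear_ladd[OF B] bilinear_lzero[OF B] bilinear_rzero[OF B] algebra_simps)
  also have "\<dots> = - 2 * (d * f * h (p ?y) (X ?y (T s)) (Y ?y z))"
    by (simp add: acceleration_zero[OF s] Y'_T[OF s] bilinear_lzero[OF B])
  finally show ?thesis by simp
qed

lemma X_normal:
  assumes s: "s \<in> J"
  shows "X (b s) (W s) = 0"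
proof (rule H_horizontal[OF b_U[OF s]])
  fix z assume "Y (b s) z = 0"
  then have "\<epsilon>1 * k s * H (b s) (W s) z = 0"
    using H_normal[OF s] by (simp add: bilinear_rzero[OF bil[OF p_S[OF b_U[OF s]]]])
  then show "H (b s) (W s) z = 0" using \<epsilon>1 k_nz[OF s] by auto
qed

lemma Y_normal:
  assumes s: "s \<in> J"
  shows "a * h (p (b s)) (Y (b s) (W s)) (Y (b s) (W s)) = \<epsilon>1"
    and "k s = - (d * f * h (p (b s)) (X (b s) (T s)) (Y (b s) (W s)))"
proof -
  note y = b_U[OF s]
  show "a * h (p (b s)) (Y (b s) (W s)) (Y (b s) (W s)) = \<epsilon>1"
    using H_W[OF s] by (simp add: H_def X_normal[OF s] bilinear_lzero[OF bil[OF p_S[OF y]]])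
  have "k s * \<epsilon>1\<^sup>2 = - (d * f * h (p (b s)) (X (b s) (T s)) (Y (b s) (W s)))"
    using H_normal[OF s, of "W s"] H_W[OF s] by (simp add: power2_eq_square mult_ac)
  then show "k s = - (d * f * h (p (b s)) (X (b s) (T s)) (Y (b s) (W s)))" using \<epsilon>1 by simp
qed

lemma X'_normal:
  assumes s: "s \<in> J"
  shows "X' (b s) (T s) (W s) + X (b s) (W' s) = 0"
proof -
  have "((\<lambda>s. X (b s) (W s)) has_vector_derivative 0) (at s)"
    by (rule has_vector_derivative_transform_within_open[OF has_vector_derivative_const open_J s])
       (simp add: X_normal)
  from vector_derivative_unique_at[OF X_along_curve[OF b_U[OF s] b'[OF s] W'[OF s]] this]
  show ?thesis by (simp add: X_normal[OF s] bilinear_rzero[OF bil_\<Gamma>[OF p_S[OF b_U[OF s]]]])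
qed

text \<open>The second Frenet equation paired with the horizontal vector over \<open>Z\<close>. The
  term with \<open>Y'\<close> needs the vertical part of that vector and disappears, and the
  covariant derivative of the horizontal part of \<open>W\<close> is zero by
  \<open>X'_normal\<close>, so only products at the point remain.\<close>

lemma horizontal_component:
  assumes s: "s \<in> J"
  shows "- 2 * \<epsilon> * k s * (m * h (p (b s)) (X (b s) (T s)) Z + d * f * h (p (b s)) Z (u (b s))) =
    d * (h (p (b s)) (X (b s) (T s)) (Y (b s) (W s)) * h (p (b s)) Z (u (b s))
       + f * h (p (b s)) Z (Y (b s) (W s)))
    + m * (h (p (b s)) Z (u (b s)) * h (p (b s)) (X (b s) (T s)) (Y (b s) (W s))
       - f * h (p (b s)) Z (Y (b s) (W s)))"
proof -
  let ?y = "b s"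
  note y = b_U[OF s]
  note B = bil[OF p_S[OF y]]
  obtain z where z: "X ?y z = Z" "Y ?y z = 0"
    using exists_horizontal_vertical[OF y, of 0 Z] by (auto simp: bilinear_lzero[OF B])
  have "- 2 * \<epsilon> * k s * (m * h (p ?y) (X ?y (T s)) Z + d * f * h (p ?y) Z (u ?y)) =
      2 * H ?y (- (\<epsilon> * k s) *\<^sub>R T s) z"
    unfolding bilinear_lmul[OF bilinear_H[OF y]] unfolding H_def z angle[OF s]
    by (simp add: bilinear_rzero[OF B] algebra_simps)
  also have "\<dots> = 2 * H ?y (W' s + G s (T s) (W s)) z" by (simp only: frenet_W[OF s])
  also have "\<dots> = 2 * H ?y (W' s) z + 2 * H ?y (G s (T s) (W s)) z"
    by (simp add: bilinear_ladd[OF bilinear_H[OF y]])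
  also have "\<dots> = 2 * m * h (p ?y) (X' ?y (T s) (W s) + X ?y (W' s)) Z
      + 2 * d * h (p ?y) (X' ?y (T s) (W s) + X ?y (W' s)) (u ?y) * h (p ?y) Z (u ?y)
      + d * (h (p ?y) (X ?y (T s)) (Y ?y (W s)) * h (p ?y) Z (u ?y) + f * h (p ?y) Z (Y ?y (W s)))
      + m * (h (p ?y) Z (u ?y) * h (p ?y) (X ?y (T s)) (Y ?y (W s)) - f * h (p ?y) Z (Y ?y (W s)))"
    unfolding koszul_H[OF y G[OF s]] unfolding H_def horizontal[OF s] angle[OF s] z X_normal[OF s]
    by (simp add: bilinear_ladd[OF B] bilinear_lzero[OF B] bilinear_rzero[OF B] algebra_simps)
  finally show ?thesis by (simp add: X'_normal[OF s] bilinear_lzero[OF B])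
qed

lemma curvature_angle:
  assumes s: "s \<in> J"
  shows "d \<noteq> 0" "m - d \<noteq> 0" "f\<^sup>2 = \<epsilon> / (2 * d)" "(k s)\<^sup>2 = (d - m) / (4 * \<epsilon>1 * (a * m))"
proof -
  note y = b_U[OF s]
  let ?q = "h (p (b s)) (X (b s) (T s)) (Y (b s) (W s))"
  note k = Y_normal(2)[OF s] k_nz[OF s]
  have nz: "\<epsilon> \<noteq> 0" "\<epsilon>1 \<noteq> 0" using \<epsilon> \<epsilon>1 by auto
  show d: "d \<noteq> 0" using k by auto
  have f: "f \<noteq> 0" using k by auto
  have "h (p (b s)) (u (b s)) (Y (b s) (W s)) = 0"
    using Y_unit[OF y] sym[OF p_S[OF y]] by simp
  then have "(m + d) * (?q + 2 * \<epsilon> * k s * f) = 0"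
    using horizontal_component[OF s, of "u (b s)"] angle[OF s] unit[OF y] by (simp add: algebra_simps)
  then have q: "?q = - 2 * \<epsilon> * k s * f" using md_nz by simp
  \<comment> \<open>The value of \<open>?q\<close> found from the component along \<open>u\<close>
    is put back into k = - d f \<open>?q\<close>; cancelling \<open>k s\<close>, which is nonzero,
    leaves an equation for \<open>f\<close> alone.\<close>
  have "k s = k s * (2 * d * \<epsilon> * f\<^sup>2)"
    using k(1) unfolding q by (simp add: power2_eq_square mult_ac)
  then have "2 * d * \<epsilon> * f\<^sup>2 = 1" using k(2) by simp
  then have "\<epsilon>\<^sup>2 * (2 * d * f\<^sup>2) = \<epsilon>" by (simp add: power2_eq_square mult_ac)
  then show "f\<^sup>2 = \<epsilon> / (2 * d)" using \<epsilon> d by (simp add: field_simps)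
  have "- 2 * \<epsilon> * k s * m * ?q = (d - m) * f * h (p (b s)) (Y (b s) (W s)) (Y (b s) (W s))"
    using horizontal_component[OF s, of "Y (b s) (W s)"] Y_unit[OF y] by (simp add: algebra_simps)
  then have "4 * \<epsilon>\<^sup>2 * (k s)\<^sup>2 * m * f * a = (d - m) * f * (a * h (p (b s)) (Y (b s) (W s)) (Y (b s) (W s)))"
    unfolding q by (simp add: power2_eq_square mult_ac)
  then have "4 * (k s)\<^sup>2 * m * a = (d - m) * \<epsilon>1" using f \<epsilon> Y_normal(1)[OF s] by simp
  then have "(k s)\<^sup>2 * (4 * \<epsilon>1 * (a * m)) = (d - m) * \<epsilon>1\<^sup>2" by (simp add: power2_eq_square mult_ac)
  then show k2: "(k s)\<^sup>2 = (d - m) / (4 * \<epsilon>1 * (a * m))"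
    using \<epsilon>1 nz a_nz m_nz by (simp add: field_simps)
  then show "m - d \<noteq> 0" using k(2) by auto
qed

text \<open>\<open>frenet_curve\<close> asks no regularity of the curvature function. Near
  \<open>s\<close> it coincides with a product of differentiable fields, and this continuity later
  excludes a change of sign.\<close>

lemma isCont_curvature:
  assumes s: "s \<in> J"
  shows "isCont k s"
proof -
  have "((\<lambda>s. h (p (b s)) (X (b s) (T s)) (Y (b s) (W s))) has_real_derivative
    h (p (b s)) (X' (b s) (T s) (T s) + X (b s) (T' s) - \<Gamma> (p (b s)) (X (b s) (T s)) (X (b s) (T s))
        + \<Gamma> (p (b s)) (X (b s) (T s)) (X (b s) (T s))) (Y (b s) (W s))
    + h (p (b s)) (X (b s) (T s)) (Y' (b s) (T s) (W s) + Y (b s) (W' s)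
        - \<Gamma> (p (b s)) (X (b s) (T s)) (Y (b s) (W s)) + \<Gamma> (p (b s)) (X (b s) (T s)) (Y (b s) (W s)))) (at s)"
    by (rule has_real_derivative_metric[OF p_S[OF b_U[OF s]] p_along_curve[OF b_U[OF s] b'[OF s]]
          X_along_curve[OF b_U[OF s] b'[OF s] T'[OF s]] Y_along_curve[OF b_U[OF s] b'[OF s] W'[OF s]]])
  then have "isCont (\<lambda>s. - (d * f * h (p (b s)) (X (b s) (T s)) (Y (b s) (W s)))) s"
    using DERIV_isCont by (intro continuous_intros) blast
  moreover have "\<forall>\<^sub>F r in nhds s. - (d * f * h (p (b r)) (X (b r) (T r)) (Y (b r) (W r))) = k r"
    using eventually_nhds_in_open[OF open_J s] by eventually_elim (simp only: Y_normal(2))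
  ultimately show ?thesis by (simp add: isCont_cong)
qed

end

section \<open>Changes of charts\<close>

lemma param_chart:
  assumes "smooth_manifold A" "C \<in> A" "p \<in> fst C"
  shows "param C (snd C p) = p"
  using assms unfolding smooth_manifold_def smooth_atlas_def by (simp add: param_def)

context
  fixes A :: "('m, 'e::euclidean_space) chart set"
  assumes A: "smooth_manifold A"
begin

lemma transition_open: "C \<in> A \<Longrightarrow> D \<in> A \<Longrightarrow> open (snd C ` (fst C \<inter> fst D))"
  and transition_Ck_on: "C \<in> A \<Longrightarrow> D \<in> A \<Longrightarrow> Ck_on k (transition C D) (snd C ` (fst C \<inter> fst D))"
  using A unfolding smooth_manifold_def smooth_atlas_def smooth_on_def by blast+

lemma transition_apply: "C \<in> A \<Longrightarrow> p \<in> fst C \<Longrightarrow> transition C D (snd C p) = snd D p"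
  by (simp add: transition_def param_chart[OF A])

lemma transition_has_derivative:
  assumes "C \<in> charts_at A p" "D \<in> charts_at A p"
  shows "(transition C D has_derivative frechet_derivative (transition C D) (at (snd C p))) (at (snd C p))"
  using assms by (intro has_derivative_Ck_on[OF transition_Ck_on]) (auto simp: charts_at_def)

lemma transition_cocycle:
  assumes C: "C \<in> charts_at A p" and D: "D \<in> charts_at A p" and E: "E \<in> charts_at A p"
  shows "frechet_derivative (transition C E) (at (snd C p)) v =
    frechet_derivative (transition D E) (at (snd D p)) (frechet_derivative (transition C D) (at (snd C p)) v)"
proof -
  have CD: "C \<in> A" "D \<in> A" "p \<in> fst C \<inter> fst D" using C D by (auto simp: charts_at_def)
  have "(transition D E \<circ> transition C D has_derivative
      frechet_derivative (transition D E) (at (snd D p)) \<circ> frechet_derivative (transition C D) (at (snd C p)))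
      (at (snd C p))"
    using transition_has_derivative[OF D E] CD
    by (intro diff_chain_at transition_has_derivative C D) (simp add: transition_apply)
  then have "(transition C E has_derivative
      frechet_derivative (transition D E) (at (snd D p)) \<circ> frechet_derivative (transition C D) (at (snd C p)))
      (at (snd C p))"
    by (rule has_derivative_transform_within_open[OF _ transition_open[OF CD(1,2)]])
       (use CD in \<open>auto simp: transition_apply\<close>)
  from frechet_derivative_at[OF this] show ?thesis by (metis comp_apply)
qed

lemma transition_self:
  assumes C: "C \<in> charts_at A p"
  shows "frechet_derivative (transition C C) (at (snd C p)) v = v"
proof -
  have CA: "C \<in> A" "p \<in> fst C" using C by (auto simp: charts_at_def)
  have "(transition C C has_derivative (\<lambda>v. v)) (at (snd C p))"
    by (rule has_derivative_transform_within_open[OF has_derivative_ident transition_open[OF CA(1,1)]])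
       (use CA in \<open>auto simp: transition_apply\<close>)
  from frechet_derivative_at[OF this] show ?thesis by metis
qed

lemma tvec_of_component:
  assumes "X \<in> tangent_space A p" "C \<in> charts_at A p"
  shows "tvec_of A p C (X C) = X"
proof
  fix D
  show "tvec_of A p C (X C) D = X D"
  proof (cases "D \<in> charts_at A p")
    case True
    then have "X D = frechet_derivative (transition C D) (at (snd C p)) (X C)"
      using assms unfolding tangent_space_def by blast
    with True show ?thesis by (simp add: tvec_of_def)
  next
    case False
    then have "X D = 0" using assms(1) unfolding tangent_space_def by blast
    with False show ?thesis by (simp add: tvec_of_def)
  qed
qed

lemma tvec_of_apply: "C \<in> charts_at A p \<Longrightarrow> tvec_of A p C v C = v"
  by (simp add: tvec_of_def transition_self)

lemma tvec_of_change:
  assumes "C \<in> charts_at A p" "D \<in> charts_at A p"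
  shows "tvec_of A p D (frechet_derivative (transition C D) (at (snd C p)) v) = tvec_of A p C v"
  unfolding tvec_of_def
  by (rule ext) (simp add: transition_cocycle[OF assms, symmetric])

lemma in_chart_eq:
  assumes "C \<in> charts_at A p"
  shows "in_chart A g C (snd C p) v w = g p (tvec_of A p C v) (tvec_of A p C w)"
  using assms by (simp add: in_chart_def charts_at_def param_chart[OF A])

lemma in_chart_change:
  assumes "C \<in> charts_at A p" "D \<in> charts_at A p"
  shows "in_chart A g C (snd C p) v w = in_chart A g D (snd D p)
    (frechet_derivative (transition C D) (at (snd C p)) v)
    (frechet_derivative (transition C D) (at (snd C p)) w)"
  using assms by (simp add: in_chart_eq tvec_of_change)

end

text \<open>The inhomogeneous transformation law. The connection of the chart \<open>D\<close> is
  pulled back to \<open>C\<close> as \<open>G\<close>; it is torsion-free because second derivatives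
  of the transition commute and metric because the transition is an isometry of the components, so
  uniqueness identifies it with the connection of \<open>C\<close>.\<close>

lemma christoffel_change:
  fixes A :: "('m, real^2) chart set"
  assumes A: "smooth_manifold A" and g: "pseudo_riemannian_metric A g"
    and K: "constant_gaussian_curvature A g \<kappa>"
    and C: "C \<in> charts_at A p" and D: "D \<in> charts_at A p"
  defines "J \<equiv> \<lambda>z. frechet_derivative (transition C D) (at z)"
  shows "J (snd C p) (christoffel A g C (snd C p) u v) =
    frechet_derivative (\<lambda>z. J z v) (at (snd C p)) u
    + christoffel A g D (snd D p) (J (snd C p) u) (J (snd C p) v)"
proof -
  define N y where "N = snd C ` (fst C \<inter> fst D)" and "y = snd C p"
  have CD: "C \<in> A" "D \<in> A" "p \<in> fst C" "p \<in> fst D" using C D by (auto simp: charts_at_def)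
  interpret CC: constant_curvature_chart "snd C ` fst C" "in_chart A g C" "christoffel A g C"
    "\<lambda>z u v w. frechet_derivative (\<lambda>z. christoffel A g C z v w) (at z) u" \<kappa>
    by (rule constant_curvature_chart_in_chart[OF g CD(1) K])
  interpret DD: constant_curvature_chart "snd D ` fst D" "in_chart A g D" "christoffel A g D"
    "\<lambda>z u v w. frechet_derivative (\<lambda>z. christoffel A g D z v w) (at z) u" \<kappa>
    by (rule constant_curvature_chart_in_chart[OF g CD(2) K])
  have N: "open N" "y \<in> N" using transition_open[OF A CD(1,2)] CD by (auto simp: N_def y_def)
  have yC: "y \<in> snd C ` fst C" and yD: "snd D p \<in> snd D ` fst D" using CD by (auto simp: y_def)
  have \<tau>y: "transition C D y = snd D p" using CD by (simp add: y_def transition_apply[OF A])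
  have Ck: "Ck_on k (transition C D) N" for k
    unfolding N_def by (rule transition_Ck_on[OF A CD(1,2)])
  have \<tau>: "(transition C D has_derivative J y) (at y)"
    using has_derivative_Ck_on[OF Ck N(2)] by (simp add: J_def)
  define D2 where "D2 u v = frechet_derivative (\<lambda>z. J z v) (at y) u" for u v
  have "Ck_on (Suc 0) (\<lambda>z. J z v) N" for v
    using Ck[of "Suc (Suc 0)"] unfolding J_def by (simp only: Ck_on.simps(2)[of "Suc 0"] simp_thms)
  from has_derivative_Ck_on[OF this N(2)]
  have J': "((\<lambda>z. J z v) has_derivative (\<lambda>u. D2 u v)) (at y)" for v by (simp add: D2_def)
  have D2_sym: "D2 u v = D2 v u" for u v
    unfolding D2_def J_def by (rule second_derivative_symmetric[OF N Ck])
  \<comment> \<open>The Jacobian of the reverse transition, as an inverse of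
    \<open>J y\<close>.\<close>
  define I where "I = frechet_derivative (transition D C) (at (snd D p))"
  have JI: "J y (I w) = w" for w
    using transition_cocycle[OF A D C D] transition_self[OF A D] by (simp add: I_def J_def y_def)
  have linJ: "linear (J y)" by (rule has_derivative_linear[OF \<tau>])
  have linI: "linear I"
    unfolding I_def by (rule has_derivative_linear[OF transition_has_derivative[OF A D C]])
  have linD2: "linear (\<lambda>u. D2 u v)" for v by (rule has_derivative_linear[OF J'])
  have linD2': "linear (D2 u)" for u
  proof -
    have "D2 u = (\<lambda>v. D2 v u)" using D2_sym by blast
    from ssubst[where P=linear, OF this linD2] show ?thesis .
  qed
  have change: "in_chart A g D (transition C D z) (J z v) (J z w) = in_chart A g C z v w"
    if z: "z \<in> N" for z v w
  proof -
    obtain q where q: "z = snd C q" "q \<in> fst C" "q \<in> fst D" using z by (auto simp: N_def)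
    then show ?thesis
      using in_chart_change[OF A, of C q D g v w] CD
      by (simp add: J_def charts_at_def transition_apply[OF A])
  qed
  note change_y = change[OF N(2), unfolded \<tau>y]
  define G where "G u v = I (D2 u v + christoffel A g D (snd D p) (J y u) (J y v))" for u v
  define E where "E u v w = in_chart A g C y (christoffel A g C y u v) w
      + in_chart A g C y v (christoffel A g C y u w)" for u v w
  have E: "E u v w = in_chart A g C y (G u v) w + in_chart A g C y v (G u w)" for u v w
  proof -
    have "((\<lambda>z. in_chart A g C z v w) has_derivative (\<lambda>u. in_chart A g D (transition C D y)
          (D2 u v + christoffel A g D (transition C D y) (J y u) (J y v)) (J y w)
        + in_chart A g D (transition C D y) (J y v)
          (D2 u w + christoffel A g D (transition C D y) (J y u) (J y w)))) (at y)"
      by (rule has_derivative_transform_within_open[OF _ N change])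
         (use DD.has_derivative_metric[OF _ \<tau> J' J'] \<tau>y yD in auto)
    from has_derivative_unique[OF CC.has_derivative_h[OF yC] this]
    show ?thesis
      unfolding E_def \<tau>y change_y[symmetric] G_def JI by metis
  qed
  have "levi_civita_form (in_chart A g C y) E (christoffel A g C y)"
    unfolding levi_civita_form_def E_def using CC.bil_\<Gamma>[OF yC] CC.sym_\<Gamma>[OF yC] by blast
  moreover have "levi_civita_form (in_chart A g C y) E G"
    unfolding levi_civita_form_def
  proof (intro conjI allI E)
    show "G v w = G w v" for v w
      using D2_sym[of v w] DD.sym_\<Gamma>[OF yD, of "J y v" "J y w"] by (simp add: G_def)
    show "bilinear G"
      unfolding bilinear_def G_def
      by (intro conjI allI linearI)
         (simp_all add: linear_add[OF linJ] linear_scale[OF linJ] linear_add[OF linI] linear_scale[OF linI]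
           linear_add[OF linD2] linear_scale[OF linD2] linear_add[OF linD2'] linear_scale[OF linD2']
           bilinear_ladd[OF DD.bil_\<Gamma>[OF yD]] bilinear_radd[OF DD.bil_\<Gamma>[OF yD]]
           bilinear_lmul[OF DD.bil_\<Gamma>[OF yD]] bilinear_rmul[OF DD.bil_\<Gamma>[OF yD]] scaleR_add_right)
  qed
  ultimately have "christoffel A g C y = G"
    using levi_civita_form_unique[OF CC.bil[OF yC] CC.sym[OF yC]] CC.nondeg[OF yC] by blast
  then show ?thesis unfolding y_def[symmetric] by (simp add: G_def JI D2_def)
qed

text \<open>On the tangent bundle a change of chart is the transition together with its Jacobian,
  whose derivative produces the second-order term. \<open>Q\<close> is controlled only through its
  coordinates in \<open>C\<close>, so membership of nearby base points in \<open>D\<close> is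
  deduced from these coordinates entering the open overlap.\<close>

lemma bundle_coords_change:
  fixes A :: "('m, real^2) chart set" and Q :: "'a::real_normed_vector \<Rightarrow> ('m, real^2) tpoint"
  assumes A: "smooth_manifold A" and C: "C \<in> charts_at A (fst (Q y))" and D: "D \<in> charts_at A (fst (Q y))"
    and N: "open N" "y \<in> N" and Q: "\<And>x. x \<in> N \<Longrightarrow> Q x \<in> unit_tangent_bundle A g"
      "\<And>x. x \<in> N \<Longrightarrow> fst (Q x) \<in> fst C"
    and F': "(bundle_coords C \<circ> Q has_derivative F') (at y)"
  defines "J \<equiv> \<lambda>z. frechet_derivative (transition C D) (at z)"
  shows "(bundle_coords D \<circ> Q has_derivative
      (\<lambda>v. (J (snd C (fst (Q y))) (fst (F' v)),
        frechet_derivative (\<lambda>z. J z (snd (Q y) C)) (at (snd C (fst (Q y)))) (fst (F' v))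
        + J (snd C (fst (Q y))) (snd (F' v))))) (at y)"
    and "\<exists>V. open V \<and> y \<in> V \<and> V \<subseteq> N \<and> (\<forall>x\<in>V. fst (Q x) \<in> fst D)"
proof -
  define M where "M = snd C ` (fst C \<inter> fst D)"
  have CD: "C \<in> A" "D \<in> A" "fst (Q y) \<in> fst C" "fst (Q y) \<in> fst D" using C D by (auto simp: charts_at_def)
  have M: "open M" "snd C (fst (Q y)) \<in> M" using transition_open[OF A CD(1,2)] CD by (auto simp: M_def)
  have Ck: "Ck_on k (transition C D) M" for k
    unfolding M_def by (rule transition_Ck_on[OF A CD(1,2)])
  have "Ck_on (Suc 0) (\<lambda>z. J z v) M" for v
    using Ck[of "Suc (Suc 0)"] unfolding J_def by (simp only: Ck_on.simps(2)[of "Suc 0"] simp_thms)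
  note J' = has_derivative_Ck_on[OF this M(2)]
  have \<tau>: "(transition C D has_derivative J z) (at z)" if "z \<in> M" for z
    using has_derivative_Ck_on[OF Ck that] by (simp add: J_def)
  have linJ: "linear (J z)" if "z \<in> M" for z by (rule has_derivative_linear[OF \<tau>[OF that]])
  have F1: "((\<lambda>x. snd C (fst (Q x))) has_derivative (\<lambda>v. fst (F' v))) (at y)"
    and F2: "((\<lambda>x. snd (Q x) C) has_derivative (\<lambda>v. snd (F' v))) (at y)"
    using has_derivative_fst[OF F'] has_derivative_snd[OF F'] by (simp_all add: bundle_coords_def)
  obtain V0 where V0: "open V0" "y \<in> V0" "\<And>x. x \<in> V0 \<Longrightarrow> snd C (fst (Q x)) \<in> M"
    using has_derivative_continuous[OF F1, unfolded continuous_at_open, rule_format, OF conjI[OF M]]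
    by blast
  define V where "V = V0 \<inter> N"
  have V: "open V" "y \<in> V" "V \<subseteq> N" using V0 N by (auto simp: V_def)
  have VD: "fst (Q x) \<in> fst D" if "x \<in> V" for x
  proof -
    have "snd C (fst (Q x)) \<in> M" and C: "fst (Q x) \<in> fst C" using V0(3) Q(2) that by (auto simp: V_def)
    then obtain q where q: "snd C (fst (Q x)) = snd C q" "q \<in> fst C" "q \<in> fst D"
      unfolding M_def by blast
    have "fst (Q x) = param C (snd C (fst (Q x)))" by (rule param_chart[OF A CD(1) C, symmetric])
    also have "\<dots> = q" unfolding q(1) by (rule param_chart[OF A CD(1) q(2)])
    finally have "fst (Q x) = q" .
    with q show ?thesis by simp
  qed
  then show "\<exists>V. open V \<and> y \<in> V \<and> V \<subseteq> N \<and> (\<forall>x\<in>V. fst (Q x) \<in> fst D)" using V by blast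
  have eq: "(transition C D (snd C (fst (Q x))), J (snd C (fst (Q x))) (snd (Q x) C)) = (bundle_coords D \<circ> Q) x"
    if x: "x \<in> V" for x
  proof -
    have xN: "x \<in> N" using V x by auto
    have ch: "C \<in> charts_at A (fst (Q x))" "D \<in> charts_at A (fst (Q x))"
      using Q(2)[OF xN] VD[OF x] CD by (auto simp: charts_at_def)
    have "snd (Q x) \<in> tangent_space A (fst (Q x))"
      using Q(1)[OF xN] by (auto simp: unit_tangent_bundle_def)
    then have "snd (Q x) D = J (snd C (fst (Q x))) (snd (Q x) C)"
      using ch unfolding tangent_space_def J_def by blast
    then show ?thesis
      using Q(2)[OF xN] by (simp add: bundle_coords_def transition_apply[OF A CD(1)])
  qed
  have "((\<lambda>x. (transition C D (snd C (fst (Q x))), J (snd C (fst (Q x))) (snd (Q x) C))) has_derivative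
      (\<lambda>v. (J (snd C (fst (Q y))) (fst (F' v)),
        frechet_derivative (\<lambda>z. J z (snd (Q y) C)) (at (snd C (fst (Q y)))) (fst (F' v))
        + J (snd C (fst (Q y))) (snd (F' v))))) (at y)"
    by (intro has_derivative_Pair has_derivative_compose[OF F1 \<tau>[OF M(2)]]
        has_derivative_linear_family[OF M(1) M(2) linJ J' F1 F2])
  then show "(bundle_coords D \<circ> Q has_derivative
      (\<lambda>v. (J (snd C (fst (Q y))) (fst (F' v)),
        frechet_derivative (\<lambda>z. J z (snd (Q y) C)) (at (snd C (fst (Q y)))) (fst (F' v))
        + J (snd C (fst (Q y))) (snd (F' v))))) (at y)"
    by (rule has_derivative_transform_within_open[OF _ V(1,2) eq])
qed

text \<open>Invariance of domain gives the open image, the inverse function theorem the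
  differentiable inverse. The isomorphism \<open>L\<close> between the two spaces turns the
  derivative into an endomorphism, for which a right inverse is available.\<close>

lemma injective_immersion_equal_dim:
  fixes f :: "'a::euclidean_space \<Rightarrow> 'b::euclidean_space"
  assumes dim: "DIM('a) = DIM('b)" and S: "open S" "x \<in> S" and inj: "inj_on f S"
    and cont: "continuous_on S f" and f': "(f has_derivative f') (at x)" and inj': "inj f'"
  shows "open (f ` S)" and "inv_into S f differentiable (at (f x))"
proof -
  show "open (f ` S)" using invariance_of_domain_gen[OF S(1) cont inj] dim by simp
  obtain L :: "'b \<Rightarrow> 'a" and M where LM: "linear L" "linear M" "\<And>z. M (L z) = z"
    using isomorphisms_UNIV_UNIV[where 'M='b and 'N='a] dim by metis
  have L: "(L has_derivative L) (at z)" for z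
    using LM(1) by (simp add: linear_imp_has_derivative)
  have Lf: "(L \<circ> f has_derivative L \<circ> f') (at x)" by (rule diff_chain_at[OF f' L])
  have "inj (L \<circ> f')" using inj' LM(3) by (metis inj_compose inj_on_inverseI)
  then obtain k where k: "(L \<circ> f') \<circ> k = id"
    using linear_injective_isomorphism[OF has_derivative_linear[OF Lf]] by (auto simp: fun_eq_iff)
  have "(inv_into S f \<circ> M has_derivative k) (at ((L \<circ> f) x))"
  proof (rule has_derivative_inverse_strong[OF S _ _ Lf k])
    show "continuous_on S (L \<circ> f)"
      using LM(1) by (intro continuous_on_compose[OF cont] linear_continuous_on)
        (simp add: linear_conv_bounded_linear)
    show "(inv_into S f \<circ> M) ((L \<circ> f) z) = z" if "z \<in> S" for z
      using inj that by (simp add: LM(3))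
  qed
  then have "(inv_into S f \<circ> M \<circ> L has_derivative k \<circ> L) (at (f x))"
    by (intro diff_chain_at[OF L]) simp
  moreover have "inv_into S f \<circ> M \<circ> L = inv_into S f" using LM(3) by (simp add: fun_eq_iff)
  ultimately show "inv_into S f differentiable (at (f x))" unfolding differentiable_def by metis
qed

text \<open>Rescaling the unit vectors extends a chart of the unit tangent bundle to an open set of the
  tangent bundle, where invariance of domain and the inverse function theorem apply.\<close>

lemma (in unit_immersion) immersion_inverse:
  assumes inj: "inj_on (\<lambda>y. (p y, u y)) U" and y: "y \<in> U"
  shows "\<exists>O' r. open O' \<and> (p y, u y) \<in> O' \<and> r differentiable (at (p y, u y)) \<and>
    (\<forall>z w. (z, w) \<in> O' \<longrightarrow> h z w w = 1 \<longrightarrow> (\<exists>x\<in>U. p x = z \<and> u x = w)) \<and>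
    (\<forall>x\<in>U. r (p x, u x) = x)"
proof -
  define \<Phi> where "\<Phi> = (\<lambda>(x, s::real). (p x, s *\<^sub>R u x))"
  define S' where "S' = U \<times> {0::real<..}"
  have S': "open S'" "(y, 1) \<in> S'" using open_U y by (auto simp: S'_def open_Times)
  \<comment> \<open>The length determines the positive scale \<open>s\<close>; hence
    \<open>\<Phi>\<close> is injective, and unit vectors are exactly those with scale 1.\<close>
  have len: "h (p x) (s *\<^sub>R u x) (s *\<^sub>R u x) = s * s" if "x \<in> U" for x s
    using unit[OF that] by (simp add: bilinear_lmul[OF bil[OF p_S[OF that]]] bilinear_rmul[OF bil[OF p_S[OF that]]])
  have inj': "inj_on \<Phi> S'"
  proof (rule inj_onI, clarsimp simp: \<Phi>_def S'_def)
    fix x s x' s'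
    assume *: "x \<in> U" "x' \<in> U" "0 < s" "0 < s'" "p x = p x'" "s *\<^sub>R u x = s' *\<^sub>R u x'"
    then have "s * s = s' * s'" using len[of x s] len[of x' s'] by simp
    then have "s = s'" using * by (metis abs_of_pos real_sqrt_abs2)
    then have "u x = u x'" using * by simp
    then show "x = x' \<and> s = s'" using inj * \<open>s = s'\<close> by (auto simp: inj_on_def)
  qed
  have der: "(\<Phi> has_derivative (\<lambda>(v, r). (X x v, s *\<^sub>R frechet_derivative u (at x) v + r *\<^sub>R u x))) (at (x, s))"
    if x: "x \<in> U" for x s
  proof -
    have 1: "((\<lambda>q. p (fst q)) has_derivative (\<lambda>q. X x (fst q))) (at (x, s))"
      using p_has_derivative[OF x] by (intro has_derivative_compose[OF has_derivative_fst[OF has_derivative_ident]]) simp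
    have 2: "((\<lambda>q. u (fst q)) has_derivative (\<lambda>q. frechet_derivative u (at x) (fst q))) (at (x, s))"
      using u_has_derivative[OF x] by (intro has_derivative_compose[OF has_derivative_fst[OF has_derivative_ident]]) simp
    have 3: "(snd has_derivative snd) (at (x, s))" by (intro has_derivative_snd has_derivative_ident)
    show ?thesis
      using has_derivative_Pair[OF 1 has_derivative_scaleR[OF 3 2]]
      by (simp add: \<Phi>_def case_prod_unfold)
  qed
  have cont: "continuous_on S' \<Phi>"
    using der by (auto simp: S'_def intro!: continuous_at_imp_continuous_on has_derivative_continuous)
  have "inj (\<lambda>(v, r). (X y v, 1 *\<^sub>R frechet_derivative u (at y) v + r *\<^sub>R u y))"
    unfolding linear_injective_0[OF has_derivative_linear[OF der[OF y]]]
  proof (clarsimp simp: zero_prod_def)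
    fix v r assume 0: "X y v = 0" "frechet_derivative u (at y) v + r *\<^sub>R u y = 0"
    have Yv: "Y y v = frechet_derivative u (at y) v"
      using 0(1) by (simp add: Y_def bilinear_lzero[OF bil_\<Gamma>[OF p_S[OF y]]])
    have "h (p y) (Y y v + r *\<^sub>R u y) (u y) = r"
      using Y_unit[OF y] unit[OF y]
      by (simp add: bilinear_ladd[OF bil[OF p_S[OF y]]] bilinear_lmul[OF bil[OF p_S[OF y]]])
    then have "r = 0" using 0(2) Yv by (simp add: bilinear_lzero[OF bil[OF p_S[OF y]]])
    then show "v = 0 \<and> r = 0" using immersion[OF y, of v] 0 by (simp add: X_def)
  qed
  note inv = injective_immersion_equal_dim[OF _ S' inj' cont der[OF y] this]
  define r where "r = (\<lambda>q. fst (inv_into S' \<Phi> q))"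
  have \<Phi>1: "\<Phi> (x, 1) = (p x, u x)" for x by (simp add: \<Phi>_def)
  show ?thesis
  proof (intro exI[of _ "\<Phi> ` S'"] exI[of _ r] conjI allI impI ballI)
    show "open (\<Phi> ` S')" using inv(1) by simp
    show "(p y, u y) \<in> \<Phi> ` S'" using S'(2) \<Phi>1[of y] by (metis image_eqI)
    have "inv_into S' \<Phi> differentiable (at (p y, u y))" using inv(2) \<Phi>1[of y] by simp
    then show "r differentiable (at (p y, u y))"
      unfolding r_def differentiable_def by (blast intro: has_derivative_fst)
    show "r (p x, u x) = x" if "x \<in> U" for x
      using inv_into_f_f[OF inj', of "(x, 1)"] that \<Phi>1[of x] by (simp add: r_def S'_def)
    fix z w assume "(z, w) \<in> \<Phi> ` S'" and 1: "h z w w = 1"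
    then obtain x s where x: "x \<in> U" "0 < s" "z = p x" "w = s *\<^sub>R u x" by (auto simp: \<Phi>_def S'_def)
    then have "s * s = 1" using len[of x s] 1 by simp
    then have "s = 1" using x(2) by (metis abs_of_pos real_sqrt_abs2 real_sqrt_one)
    then show "\<exists>x\<in>U. p x = z \<and> u x = w" using x by auto
  qed
qed

section \<open>The atlas of the unit tangent bundle\<close>

lemma velocity_change:
  assumes C: "inj_on (snd C) (fst C)" and J: "open J" "t \<in> J" "\<And>s. s \<in> J \<Longrightarrow> x s \<in> fst C"
    and v: "((\<lambda>s. snd C (x s)) has_vector_derivative v) (at t)"
    and D: "transition C D differentiable (at (snd C (x t)))"
  shows "((\<lambda>s. snd D (x s)) has_vector_derivative
    frechet_derivative (transition C D) (at (snd C (x t))) v) (at t)"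
proof -
  note D' = D[unfolded frechet_derivative_works]
  have "((\<lambda>s. transition C D (snd C (x s))) has_vector_derivative
    frechet_derivative (transition C D) (at (snd C (x t))) v) (at t)"
    using has_derivative_compose[OF v[unfolded has_vector_derivative_def] D']
    by (simp add: has_vector_derivative_def linear_scale[OF has_derivative_linear[OF D']])
  then show ?thesis
    by (rule has_vector_derivative_transform_within_open[OF _ J(1,2)])
       (simp add: transition_def param_def C J(3))
qed

locale kaluza_klein_surface =
  fixes A :: "('m, real^2) chart set" and g :: "('m, real^2) metric" and \<kappa> a c d :: real
  assumes A: "smooth_manifold A" and g: "pseudo_riemannian_metric A g"
    and K: "constant_gaussian_curvature A g \<kappa>"
    and a_nz: "a \<noteq> 0" and ac_nz: "a + c \<noteq> 0" and acd_nz: "a + c + d \<noteq> 0" and \<kappa>_a: "\<kappa> * a = a + c"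
begin

abbreviation B where "B \<equiv> unit_bundle_atlas A g"

text \<open>Fixes a chart \<open>C\<close> of the surface that witnesses the membership of
  \<open>\<Psi>\<close> in the atlas. It covers the base of the whole domain of
  \<open>\<Psi>\<close>, unlike a general chart around one of the base points.\<close>

definition base_chart :: "(('m, real^2) tpoint, real^3) chart \<Rightarrow> ('m, real^2) chart \<Rightarrow> bool" where
  "base_chart \<Psi> C \<longleftrightarrow> \<Psi> \<in> B \<and> C \<in> A \<and> fst ` fst \<Psi> \<subseteq> fst C \<and>
    smooth_on (bundle_coords C \<circ> param \<Psi>) (snd \<Psi> ` fst \<Psi>) \<and>
    (\<forall>y\<in>snd \<Psi> ` fst \<Psi>. inj (frechet_derivative (bundle_coords C \<circ> param \<Psi>) (at y)))"

definition pos :: "(('m, real^2) tpoint, real^3) chart \<Rightarrow> ('m, real^2) chart \<Rightarrow> real^3 \<Rightarrow> real^2" where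
  "pos \<Psi> C y = snd C (fst (param \<Psi> y))"

definition dir :: "(('m, real^2) tpoint, real^3) chart \<Rightarrow> ('m, real^2) chart \<Rightarrow> real^3 \<Rightarrow> real^2" where
  "dir \<Psi> C y = snd (param \<Psi> y) C"

lemma exists_base_chart: "\<Psi> \<in> B \<Longrightarrow> \<exists>C. base_chart \<Psi> C"
  unfolding base_chart_def unit_bundle_atlas_def by blast

lemma bundle_chart:
  assumes "\<Psi> \<in> B"
  shows "fst \<Psi> \<subseteq> unit_tangent_bundle A g" "inj_on (snd \<Psi>) (fst \<Psi>)" "open (snd \<Psi> ` fst \<Psi>)"
    and "q \<in> fst \<Psi> \<Longrightarrow> param \<Psi> (snd \<Psi> q) = q"
    and "y \<in> snd \<Psi> ` fst \<Psi> \<Longrightarrow> param \<Psi> y \<in> fst \<Psi>"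
    and "y \<in> snd \<Psi> ` fst \<Psi> \<Longrightarrow> snd \<Psi> (param \<Psi> y) = y"
  using assms by (auto simp: unit_bundle_atlas_def param_def)

lemma base_chart_at: "base_chart \<Psi> C \<Longrightarrow> q \<in> fst \<Psi> \<Longrightarrow> C \<in> charts_at A (fst q)"
  by (auto simp: base_chart_def charts_at_def)

lemma unit_tangent_vector:
  assumes q: "q \<in> unit_tangent_bundle A g" and C: "C \<in> charts_at A (fst q)"
  shows "snd q = tvec_of A (fst q) C (snd q C)"
    and "in_chart A g C (snd C (fst q)) (snd q C) (snd q C) = 1"
proof -
  have "snd q \<in> tangent_space A (fst q)" "g (fst q) (snd q) (snd q) = 1"
    using q by (auto simp: unit_tangent_bundle_def)
  then show "snd q = tvec_of A (fst q) C (snd q C)"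
    "in_chart A g C (snd C (fst q)) (snd q C) (snd q C) = 1"
    using metric_in_chart[OF A _ _ C, of "snd q" "snd q" g] tvec_of_component[OF A _ C] by simp_all
qed

text \<open>A tangent vector is a family of components over all charts, but the Jacobians of the
  transitions determine the family from one member.\<close>

lemma bundle_coords_inj:
  assumes q: "q \<in> unit_tangent_bundle A g" "C \<in> charts_at A (fst q)"
    and q': "q' \<in> unit_tangent_bundle A g" "C \<in> charts_at A (fst q')"
    and eq: "bundle_coords C q = bundle_coords C q'"
  shows "q = q'"
proof -
  have C: "C \<in> A" "fst q \<in> fst C" "fst q' \<in> fst C" using q q' by (auto simp: charts_at_def)
  have *: "snd C (fst q) = snd C (fst q')" "snd q C = snd q' C" using eq by (auto simp: bundle_coords_def)
  have "fst q = param C (snd C (fst q))" by (rule param_chart[OF A C(1,2), symmetric])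
  also have "\<dots> = fst q'" unfolding *(1) by (rule param_chart[OF A C(1,3)])
  finally have p: "fst q = fst q'" .
  have "snd q = tvec_of A (fst q') C (snd q' C)"
    using unit_tangent_vector(1)[OF q] p *(2) by metis
  also have "\<dots> = snd q'" by (rule unit_tangent_vector(1)[OF q', symmetric])
  finally show ?thesis using p by (simp add: prod_eq_iff)
qed

lemma bundle_coords_param: "bundle_coords C \<circ> param \<Psi> = (\<lambda>y. (pos \<Psi> C y, dir \<Psi> C y))"
  by (simp add: fun_eq_iff bundle_coords_def pos_def dir_def)

lemma unit_immersion_base_chart:
  assumes b: "base_chart \<Psi> C"
  shows "unit_immersion (snd C ` fst C) (in_chart A g C) (christoffel A g C)
    (\<lambda>z u v w. frechet_derivative (\<lambda>z. christoffel A g C z v w) (at z) u) \<kappa>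
    (snd \<Psi> ` fst \<Psi>) (pos \<Psi> C) (dir \<Psi> C) (a + c) d a"
proof -
  let ?U = "snd \<Psi> ` fst \<Psi>"
  have \<Psi>: "\<Psi> \<in> B" and C: "C \<in> A" and sub: "fst ` fst \<Psi> \<subseteq> fst C"
    and Ck: "Ck_on k (\<lambda>y. (pos \<Psi> C y, dir \<Psi> C y)) ?U"
    and inj: "y \<in> ?U \<Longrightarrow> inj (frechet_derivative (\<lambda>y. (pos \<Psi> C y, dir \<Psi> C y)) (at y))" for k y
    using b by (auto simp: base_chart_def smooth_on_def bundle_coords_param)
  note U = bundle_chart(3)[OF \<Psi>]
  interpret constant_curvature_chart "snd C ` fst C" "in_chart A g C" "christoffel A g C"
    "\<lambda>z u v w. frechet_derivative (\<lambda>z. christoffel A g C z v w) (at z) u" \<kappa>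
    by (rule constant_curvature_chart_in_chart[OF g C K])
  have pC: "Ck_on k (pos \<Psi> C) ?U" and uC: "Ck_on k (dir \<Psi> C) ?U" for k
    using Ck_on_linear[OF U bounded_linear_fst Ck[of k]] Ck_on_linear[OF U bounded_linear_snd Ck[of k]]
    by simp_all
  show ?thesis
  proof
    show "open ?U" by (rule U)
    show "Ck_on k (pos \<Psi> C) ?U" "Ck_on k (dir \<Psi> C) ?U" for k by (rule pC uC)+
    show "a + c \<noteq> 0" "a + c + d \<noteq> 0" "a \<noteq> 0" "\<kappa> * a = a + c" by (rule ac_nz acd_nz a_nz \<kappa>_a)+
    fix y assume y: "y \<in> ?U"
    have q: "param \<Psi> y \<in> fst \<Psi>" by (rule bundle_chart(5)[OF \<Psi> y])
    show "pos \<Psi> C y \<in> snd C ` fst C" using q sub by (auto simp: pos_def)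
    show "in_chart A g C (pos \<Psi> C y) (dir \<Psi> C y) (dir \<Psi> C y) = 1"
      using unit_tangent_vector(2)[OF _ base_chart_at[OF b q]] q bundle_chart(1)[OF \<Psi>]
      by (auto simp: pos_def dir_def)
    fix v
    assume 0: "frechet_derivative (pos \<Psi> C) (at y) v = 0" "frechet_derivative (dir \<Psi> C) (at y) v = 0"
    have "((\<lambda>y. (pos \<Psi> C y, dir \<Psi> C y)) has_derivative
        (\<lambda>v. (frechet_derivative (pos \<Psi> C) (at y) v, frechet_derivative (dir \<Psi> C) (at y) v))) (at y)"
      by (intro has_derivative_Pair has_derivative_Ck_on[OF pC y] has_derivative_Ck_on[OF uC y])
    from frechet_derivative_at[OF this] inj[OF y]
    have "inj (\<lambda>v. (frechet_derivative (pos \<Psi> C) (at y) v, frechet_derivative (dir \<Psi> C) (at y) v))"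
      by simp
    moreover have "linear (\<lambda>v. (frechet_derivative (pos \<Psi> C) (at y) v, frechet_derivative (dir \<Psi> C) (at y) v))"
      by (rule has_derivative_linear) fact
    ultimately show "v = 0" using 0 by (simp add: linear_injective_0 zero_prod_def)
  qed
qed

lemma base_chart_inj:
  assumes b: "base_chart \<Psi> C"
  shows "inj_on (\<lambda>y. (pos \<Psi> C y, dir \<Psi> C y)) (snd \<Psi> ` fst \<Psi>)"
proof (rule inj_onI)
  fix y y' assume y: "y \<in> snd \<Psi> ` fst \<Psi>" "y' \<in> snd \<Psi> ` fst \<Psi>"
    and eq: "(pos \<Psi> C y, dir \<Psi> C y) = (pos \<Psi> C y', dir \<Psi> C y')"
  have \<Psi>: "\<Psi> \<in> B" using b by (simp add: base_chart_def)
  note q = bundle_chart(5)[OF \<Psi> y(1)] bundle_chart(5)[OF \<Psi> y(2)]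
  have "param \<Psi> y = param \<Psi> y'"
    using bundle_coords_inj[OF _ base_chart_at[OF b q(1)] _ base_chart_at[OF b q(2)]]
      bundle_chart(1)[OF \<Psi>] q eq by (auto simp: bundle_coords_def pos_def dir_def)
  then show "y = y'" using bundle_chart(6)[OF \<Psi>] y by metis
qed

lemma base_chart_has_derivative:
  assumes b: "base_chart \<Psi> C" and y: "y \<in> snd \<Psi> ` fst \<Psi>"
  shows "(bundle_coords C \<circ> param \<Psi> has_derivative
    (\<lambda>v. (frechet_derivative (pos \<Psi> C) (at y) v, frechet_derivative (dir \<Psi> C) (at y) v))) (at y)"
proof -
  interpret unit_immersion "snd C ` fst C" "in_chart A g C" "christoffel A g C"
    "\<lambda>z u v w. frechet_derivative (\<lambda>z. christoffel A g C z v w) (at z) u" \<kappa>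
    "snd \<Psi> ` fst \<Psi>" "pos \<Psi> C" "dir \<Psi> C" "a + c" d a
    by (rule unit_immersion_base_chart[OF b])
  show ?thesis
    unfolding bundle_coords_param
    by (intro has_derivative_Pair has_derivative_Ck_on[OF p_Ck y] has_derivative_Ck_on[OF u_Ck y])
qed

text \<open>\<open>D\<close> may cover only a part of the base of \<open>\<Psi>\<close>; therefore
  the derivative is taken at \<open>q\<close>, together with a neighbourhood whose base points lie
  in \<open>D\<close>.\<close>

lemma other_chart_has_derivative:
  assumes b: "base_chart \<Psi> C" and q: "q \<in> fst \<Psi>" and D: "D \<in> charts_at A (fst q)"
  defines "J \<equiv> \<lambda>z. frechet_derivative (transition C D) (at z)"
  shows "(bundle_coords D \<circ> param \<Psi> has_derivative
      (\<lambda>v. (J (snd C (fst q)) (frechet_derivative (pos \<Psi> C) (at (snd \<Psi> q)) v),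
        frechet_derivative (\<lambda>z. J z (snd q C)) (at (snd C (fst q)))
          (frechet_derivative (pos \<Psi> C) (at (snd \<Psi> q)) v)
        + J (snd C (fst q)) (frechet_derivative (dir \<Psi> C) (at (snd \<Psi> q)) v)))) (at (snd \<Psi> q))"
    and "\<exists>V. open V \<and> snd \<Psi> q \<in> V \<and> V \<subseteq> snd \<Psi> ` fst \<Psi> \<and> (\<forall>x\<in>V. fst (param \<Psi> x) \<in> fst D)"
proof -
  have \<Psi>: "\<Psi> \<in> B" and sub: "fst ` fst \<Psi> \<subseteq> fst C" using b by (auto simp: base_chart_def)
  note pq = bundle_chart(4)[OF \<Psi> q]
  have N: "snd \<Psi> q \<in> snd \<Psi> ` fst \<Psi>" using q by simp
  have Q: "param \<Psi> x \<in> unit_tangent_bundle A g" "fst (param \<Psi> x) \<in> fst C" if "x \<in> snd \<Psi> ` fst \<Psi>" for x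
    using bundle_chart(1)[OF \<Psi>] bundle_chart(5)[OF \<Psi> that] sub by auto
  have CD: "C \<in> charts_at A (fst (param \<Psi> (snd \<Psi> q)))" "D \<in> charts_at A (fst (param \<Psi> (snd \<Psi> q)))"
    using base_chart_at[OF b q] D pq by simp_all
  note r = bundle_coords_change[OF A CD bundle_chart(3)[OF \<Psi>] N Q base_chart_has_derivative[OF b N]]
  show "(bundle_coords D \<circ> param \<Psi> has_derivative
      (\<lambda>v. (J (snd C (fst q)) (frechet_derivative (pos \<Psi> C) (at (snd \<Psi> q)) v),
        frechet_derivative (\<lambda>z. J z (snd q C)) (at (snd C (fst q)))
          (frechet_derivative (pos \<Psi> C) (at (snd \<Psi> q)) v)
        + J (snd C (fst q)) (frechet_derivative (dir \<Psi> C) (at (snd \<Psi> q)) v)))) (at (snd \<Psi> q))"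
    using r(1) unfolding J_def pq fst_conv snd_conv .
  show "\<exists>V. open V \<and> snd \<Psi> q \<in> V \<and> V \<subseteq> snd \<Psi> ` fst \<Psi> \<and> (\<forall>x\<in>V. fst (param \<Psi> x) \<in> fst D)"
    by (rule r(2))
qed

text \<open>The atlas consists of immersions, and compatibility of its charts is a consequence. The
  coordinates of \<open>\<Psi>\<close> in a base chart of \<open>\<Psi>'\<close> are followed by the
  inverse \<open>r\<close> of the rescaled parametrization, which is differentiable on an open set
  of the tangent bundle and not merely along the unit vectors.\<close>

lemma bundle_transition:
  assumes \<Psi>: "\<Psi> \<in> charts_at B q" and \<Psi>': "\<Psi>' \<in> charts_at B q"
  shows "transition \<Psi> \<Psi>' differentiable (at (snd \<Psi> q))"
    and "\<exists>V. open V \<and> snd \<Psi> q \<in> V \<and> V \<subseteq> snd \<Psi> ` (fst \<Psi> \<inter> fst \<Psi>')"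
proof -
  have \<Psi>B: "\<Psi> \<in> B" "q \<in> fst \<Psi>" and \<Psi>'B: "\<Psi>' \<in> B" "q \<in> fst \<Psi>'" using \<Psi> \<Psi>' by (auto simp: charts_at_def)
  obtain C where C: "base_chart \<Psi> C" using exists_base_chart[OF \<Psi>B(1)] by blast
  obtain D where D: "base_chart \<Psi>' D" using exists_base_chart[OF \<Psi>'B(1)] by blast
  note Dq = base_chart_at[OF D \<Psi>'B(2)]
  let ?U' = "snd \<Psi>' ` fst \<Psi>'" and ?F = "bundle_coords D \<circ> param \<Psi>"
  interpret unit_immersion "snd D ` fst D" "in_chart A g D" "christoffel A g D"
    "\<lambda>z u v w. frechet_derivative (\<lambda>z. christoffel A g D z v w) (at z) u" \<kappa>
    ?U' "pos \<Psi>' D" "dir \<Psi>' D" "a + c" d a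
    by (rule unit_immersion_base_chart[OF D])
  have y': "snd \<Psi>' q \<in> ?U'" using \<Psi>'B by simp
  have Fq: "(pos \<Psi>' D (snd \<Psi>' q), dir \<Psi>' D (snd \<Psi>' q)) = ?F (snd \<Psi> q)"
    using bundle_chart(4)[OF \<Psi>'B] bundle_chart(4)[OF \<Psi>B] by (simp add: pos_def dir_def bundle_coords_def)
  obtain O' r where O': "open O'" "?F (snd \<Psi> q) \<in> O'" and r: "r differentiable (at (?F (snd \<Psi> q)))"
    and ex: "\<And>z w. (z, w) \<in> O' \<Longrightarrow> in_chart A g D z w w = 1 \<Longrightarrow>
      \<exists>x\<in>?U'. pos \<Psi>' D x = z \<and> dir \<Psi>' D x = w"
    and rx: "\<And>x. x \<in> ?U' \<Longrightarrow> r (pos \<Psi>' D x, dir \<Psi>' D x) = x"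
    using immersion_inverse[OF base_chart_inj[OF D] y'] unfolding Fq by blast
  note F = other_chart_has_derivative[OF C \<Psi>B(2) Dq]
  obtain V1 where V1: "open V1" "snd \<Psi> q \<in> V1" "V1 \<subseteq> snd \<Psi> ` fst \<Psi>"
    "\<And>x. x \<in> V1 \<Longrightarrow> fst (param \<Psi> x) \<in> fst D" using F(2) by blast
  obtain V2 where V2: "open V2" "snd \<Psi> q \<in> V2" "\<And>x. x \<in> V2 \<Longrightarrow> ?F x \<in> O'"
    using has_derivative_continuous[OF F(1), unfolded continuous_at_open, rule_format, OF conjI[OF O']]
    by blast
  have V: "open (V1 \<inter> V2)" "snd \<Psi> q \<in> V1 \<inter> V2" using V1 V2 by auto
  \<comment> \<open>Near \<open>snd \<Psi> q\<close> the unit vector lands in \<open>O'\<close>, so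
    it is parametrized by \<open>\<Psi>'\<close>; since coordinates determine the vector,
    \<open>r\<close> returns its parameter in \<open>\<Psi>'\<close>.\<close>
  have key: "param \<Psi> x \<in> fst \<Psi>' \<and> r (?F x) = transition \<Psi> \<Psi>' x" if x: "x \<in> V1 \<inter> V2" for x
  proof -
    let ?q = "param \<Psi> x"
    have xU: "x \<in> snd \<Psi> ` fst \<Psi>" using x V1 by auto
    have q: "?q \<in> unit_tangent_bundle A g" "D \<in> charts_at A (fst ?q)"
      using bundle_chart(1,5)[OF \<Psi>B(1)] xU V1(4)[of x] x D
      by (auto simp: charts_at_def base_chart_def)
    have "(snd D (fst ?q), snd ?q D) \<in> O'" using V2(3)[of x] x by (simp add: bundle_coords_def)
    from ex[OF this unit_tangent_vector(2)[OF q]]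
    obtain x' where x': "x' \<in> ?U'" "pos \<Psi>' D x' = snd D (fst ?q)" "dir \<Psi>' D x' = snd ?q D" by blast
    note q' = bundle_chart(5)[OF \<Psi>'B(1) x'(1)]
    have "?q = param \<Psi>' x'"
    proof (rule bundle_coords_inj[OF q])
      show "param \<Psi>' x' \<in> unit_tangent_bundle A g" using q' bundle_chart(1)[OF \<Psi>'B(1)] by blast
      show "D \<in> charts_at A (fst (param \<Psi>' x'))" by (rule base_chart_at[OF D q'])
      show "bundle_coords D ?q = bundle_coords D (param \<Psi>' x')"
        using x' by (simp add: bundle_coords_def pos_def dir_def)
    qed
    moreover have "r (?F x) = x'" using rx[OF x'(1)] x' by (simp add: bundle_coords_def)
    ultimately show ?thesis
      using q' bundle_chart(6)[OF \<Psi>'B(1) x'(1)] by (simp add: transition_def)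
  qed
  have "V1 \<inter> V2 \<subseteq> snd \<Psi> ` (fst \<Psi> \<inter> fst \<Psi>')"
  proof
    fix x assume x: "x \<in> V1 \<inter> V2"
    then have "x \<in> snd \<Psi> ` fst \<Psi>" using V1 by auto
    then show "x \<in> snd \<Psi> ` (fst \<Psi> \<inter> fst \<Psi>')"
      using key[OF x] bundle_chart(5,6)[OF \<Psi>B(1)] by (metis IntI image_eqI)
  qed
  then show "\<exists>V. open V \<and> snd \<Psi> q \<in> V \<and> V \<subseteq> snd \<Psi> ` (fst \<Psi> \<inter> fst \<Psi>')" using V by blast
  obtain r' where "(r has_derivative r') (at (?F (snd \<Psi> q)))" using r unfolding differentiable_def by blast
  from has_derivative_transform_within_open[OF diff_chain_at[OF F(1) this] V] key
  have "\<exists>D. (transition \<Psi> \<Psi>' has_derivative D) (at (snd \<Psi> q))" by (metis (no_types, lifting) comp_apply)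
  then show "transition \<Psi> \<Psi>' differentiable (at (snd \<Psi> q))" by (simp add: differentiable_def)
qed

end

section \<open>The metric of Kaluza-Klein type in a chart\<close>

context kaluza_klein_surface
begin

abbreviation kk where "kk \<equiv> kk_metric A g a c d"
abbreviation hor where "hor \<Psi> C \<equiv> unit_immersion.X (pos \<Psi> C)"
abbreviation ver where "ver \<Psi> C \<equiv> unit_immersion.Y (christoffel A g C) (pos \<Psi> C) (dir \<Psi> C)"
abbreviation kk_coord where
  "kk_coord \<Psi> C \<equiv> unit_immersion.H (in_chart A g C) (christoffel A g C) (pos \<Psi> C) (dir \<Psi> C) (a + c) d a"
abbreviation kk_coord' where
  "kk_coord' \<Psi> C \<equiv> unit_immersion.H' (in_chart A g C) (christoffel A g C) (pos \<Psi> C) (dir \<Psi> C) (a + c) d a"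

text \<open>Eliminates the chart chosen in \<open>inclusion_diff\<close>: the chain rule through the
  transition from \<open>\<Psi>\<close> absorbs the choice. Of \<open>\<xi>\<close> it is asked only
  that its components come from one vector \<open>w\<close> by the Jacobians, which covers
  \<open>tvec_of\<close>, velocities and smooth fields alike.\<close>

lemma inclusion_diff_apply:
  assumes b: "base_chart \<Psi> C" and q: "q \<in> fst \<Psi>" and D: "D \<in> charts_at A (fst q)"
    and \<xi>: "\<forall>\<Psi>'\<in>charts_at B q. \<xi> \<Psi>' = frechet_derivative (transition \<Psi> \<Psi>') (at (snd \<Psi> q)) w"
  defines "J \<equiv> \<lambda>z. frechet_derivative (transition C D) (at z)"
  shows "inclusion_diff A g q \<xi> D = (J (snd C (fst q)) (frechet_derivative (pos \<Psi> C) (at (snd \<Psi> q)) w),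
        frechet_derivative (\<lambda>z. J z (snd q C)) (at (snd C (fst q)))
          (frechet_derivative (pos \<Psi> C) (at (snd \<Psi> q)) w)
        + J (snd C (fst q)) (frechet_derivative (dir \<Psi> C) (at (snd \<Psi> q)) w))"
proof -
  have \<Psi>: "\<Psi> \<in> charts_at B q" using b q by (auto simp: base_chart_def charts_at_def)
  define \<Psi>0 where "\<Psi>0 = (SOME \<Psi>. \<Psi> \<in> charts_at B q)"
  have \<Psi>0: "\<Psi>0 \<in> charts_at B q" unfolding \<Psi>0_def by (rule someI[where P="\<lambda>\<Psi>. \<Psi> \<in> charts_at B q", OF \<Psi>])
  then have \<Psi>0B: "\<Psi>0 \<in> B" "q \<in> fst \<Psi>0" by (auto simp: charts_at_def)
  obtain C0 where C0: "base_chart \<Psi>0 C0" using exists_base_chart[OF \<Psi>0B(1)] by blast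
  let ?F0 = "bundle_coords D \<circ> param \<Psi>0"
  have F0: "(?F0 has_derivative frechet_derivative ?F0 (at (snd \<Psi>0 q))) (at (snd \<Psi>0 q))"
    using other_chart_has_derivative(1)[OF C0 \<Psi>0B(2) D]
    unfolding frechet_derivative_works[symmetric] differentiable_def by blast
  have \<tau>: "(transition \<Psi> \<Psi>0 has_derivative frechet_derivative (transition \<Psi> \<Psi>0) (at (snd \<Psi> q))) (at (snd \<Psi> q))"
    using bundle_transition(1)[OF \<Psi> \<Psi>0] by (simp add: frechet_derivative_works)
  obtain V where V: "open V" "snd \<Psi> q \<in> V" "V \<subseteq> snd \<Psi> ` (fst \<Psi> \<inter> fst \<Psi>0)"
    using bundle_transition(2)[OF \<Psi> \<Psi>0] by blast
  have \<Psi>B: "\<Psi> \<in> B" using \<Psi> by (simp add: charts_at_def)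
  have \<tau>q: "transition \<Psi> \<Psi>0 (snd \<Psi> q) = snd \<Psi>0 q"
    by (simp add: transition_def bundle_chart(4)[OF \<Psi>B q])
  have "(?F0 \<circ> transition \<Psi> \<Psi>0 has_derivative
      frechet_derivative ?F0 (at (snd \<Psi>0 q)) \<circ> frechet_derivative (transition \<Psi> \<Psi>0) (at (snd \<Psi> q)))
      (at (snd \<Psi> q))"
    by (rule diff_chain_at[OF \<tau>]) (use F0 \<tau>q in simp)
  then have "(bundle_coords D \<circ> param \<Psi> has_derivative
      frechet_derivative ?F0 (at (snd \<Psi>0 q)) \<circ> frechet_derivative (transition \<Psi> \<Psi>0) (at (snd \<Psi> q)))
      (at (snd \<Psi> q))"
  proof (rule has_derivative_transform_within_open[OF _ V(1,2)])
    fix x assume "x \<in> V"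
    then obtain q' where "x = snd \<Psi> q'" "q' \<in> fst \<Psi>" "q' \<in> fst \<Psi>0" using V(3) by blast
    then show "(?F0 \<circ> transition \<Psi> \<Psi>0) x = (bundle_coords D \<circ> param \<Psi>) x"
      by (simp add: transition_def bundle_chart(4)[OF \<Psi>B] bundle_chart(4)[OF \<Psi>0B(1)])
  qed
  from has_derivative_unique[OF this other_chart_has_derivative(1)[OF b q D]]
  have "frechet_derivative ?F0 (at (snd \<Psi>0 q)) (frechet_derivative (transition \<Psi> \<Psi>0) (at (snd \<Psi> q)) w) =
    (J (snd C (fst q)) (frechet_derivative (pos \<Psi> C) (at (snd \<Psi> q)) w),
        frechet_derivative (\<lambda>z. J z (snd q C)) (at (snd C (fst q)))
          (frechet_derivative (pos \<Psi> C) (at (snd \<Psi> q)) w)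
        + J (snd C (fst q)) (frechet_derivative (dir \<Psi> C) (at (snd \<Psi> q)) w))"
    unfolding J_def by (simp add: fun_eq_iff)
  then show ?thesis
    unfolding inclusion_diff_def Let_def \<Psi>0_def[symmetric] using D bspec[OF \<xi> \<Psi>0] by simp
qed

text \<open>For the vertical part in a chart \<open>D\<close>, the second-order term of the
  coordinate change and the Christoffel term of \<open>D\<close> add up to the Jacobian applied to
  the Christoffel term of \<open>C\<close>. This is why vertical parts transform as tangent
  vectors.\<close>

lemma inclusion_diff_parts:
  assumes b: "base_chart \<Psi> C" and q: "q \<in> fst \<Psi>"
    and \<xi>: "\<forall>\<Psi>'\<in>charts_at B q. \<xi> \<Psi>' = frechet_derivative (transition \<Psi> \<Psi>') (at (snd \<Psi> q)) w"
  shows "horizontal_part A q (inclusion_diff A g q \<xi>) = tvec_of A (fst q) C (hor \<Psi> C (snd \<Psi> q) w)"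
    and "vertical_part A g q (inclusion_diff A g q \<xi>) = tvec_of A (fst q) C (ver \<Psi> C (snd \<Psi> q) w)"
proof -
  interpret unit_immersion "snd C ` fst C" "in_chart A g C" "christoffel A g C"
    "\<lambda>z u v w. frechet_derivative (\<lambda>z. christoffel A g C z v w) (at z) u" \<kappa>
    "snd \<Psi> ` fst \<Psi>" "pos \<Psi> C" "dir \<Psi> C" "a + c" d a
    by (rule unit_immersion_base_chart[OF b])
  have \<Psi>: "\<Psi> \<in> B" using b by (simp add: base_chart_def)
  note C = base_chart_at[OF b q]
  have qT: "q \<in> unit_tangent_bundle A g" using bundle_chart(1)[OF \<Psi>] q by blast
  show "horizontal_part A q (inclusion_diff A g q \<xi>) = tvec_of A (fst q) C (hor \<Psi> C (snd \<Psi> q) w)"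
    by (rule ext) (simp add: horizontal_part_def tvec_of_def inclusion_diff_apply[OF b q _ \<xi>] X_def)
  show "vertical_part A g q (inclusion_diff A g q \<xi>) = tvec_of A (fst q) C (ver \<Psi> C (snd \<Psi> q) w)"
  proof
    fix D
    show "vertical_part A g q (inclusion_diff A g q \<xi>) D = tvec_of A (fst q) C (ver \<Psi> C (snd \<Psi> q) w) D"
    proof (cases "D \<in> charts_at A (fst q)")
      case True
      let ?J = "frechet_derivative (transition C D) (at (snd C (fst q)))"
      have J: "linear ?J" by (rule has_derivative_linear[OF transition_has_derivative[OF A C True]])
      have "snd q D = ?J (snd q C)"
        using fun_cong[OF unit_tangent_vector(1)[OF qT C], of D] True by (simp add: tvec_of_def)
      moreover have "pos \<Psi> C (snd \<Psi> q) = snd C (fst q)" "dir \<Psi> C (snd \<Psi> q) = snd q C"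
        by (simp_all add: pos_def dir_def bundle_chart(4)[OF \<Psi> q])
      ultimately show ?thesis
        using True christoffel_change[OF A g K C True, of "hor \<Psi> C (snd \<Psi> q) w" "snd q C"]
        by (simp add: vertical_part_def tvec_of_def inclusion_diff_apply[OF b q True \<xi>] X_def Y_def
            linear_add[OF J])
    qed (simp add: vertical_part_def tvec_of_def)
  qed
qed

lemma kaluza_klein_parts:
  assumes q: "q \<in> unit_tangent_bundle A g" and C: "C \<in> charts_at A (fst q)"
    and "horizontal_part A q \<xi> = tvec_of A (fst q) C x1" "vertical_part A g q \<xi> = tvec_of A (fst q) C y1"
    and "horizontal_part A q \<eta> = tvec_of A (fst q) C x2" "vertical_part A g q \<eta> = tvec_of A (fst q) C y2"
  defines "h \<equiv> in_chart A g C (snd C (fst q))"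
  shows "kaluza_klein A g a c d q \<xi> \<eta> = (a + c) * h x1 x2 + d * h x1 (snd q C) * h x2 (snd q C)
    + a * h y1 y2 - a * h y1 (snd q C) * h y2 (snd q C)"
proof -
  have "g (fst q) (tvec_of A (fst q) C x) (snd q) = h x (snd q C)" for x
    using unit_tangent_vector(1)[OF q C] in_chart_eq[OF A C] unfolding h_def by metis
  then show ?thesis
    unfolding kaluza_klein_def Let_def assms(3-6) by (simp add: h_def in_chart_eq[OF A C])
qed

lemma kk_metric_eq:
  assumes b: "base_chart \<Psi> C" and q: "q \<in> fst \<Psi>"
    and \<xi>: "\<forall>\<Psi>'\<in>charts_at B q. \<xi> \<Psi>' = frechet_derivative (transition \<Psi> \<Psi>') (at (snd \<Psi> q)) v"
    and \<eta>: "\<forall>\<Psi>'\<in>charts_at B q. \<eta> \<Psi>' = frechet_derivative (transition \<Psi> \<Psi>') (at (snd \<Psi> q)) w"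
  shows "kk q \<xi> \<eta> = kk_coord \<Psi> C (snd \<Psi> q) v w"
proof -
  interpret unit_immersion "snd C ` fst C" "in_chart A g C" "christoffel A g C"
    "\<lambda>z u v w. frechet_derivative (\<lambda>z. christoffel A g C z v w) (at z) u" \<kappa>
    "snd \<Psi> ` fst \<Psi>" "pos \<Psi> C" "dir \<Psi> C" "a + c" d a
    by (rule unit_immersion_base_chart[OF b])
  have \<Psi>: "\<Psi> \<in> B" using b by (simp add: base_chart_def)
  have qT: "q \<in> unit_tangent_bundle A g" using bundle_chart(1)[OF \<Psi>] q by blast
  have pd: "pos \<Psi> C (snd \<Psi> q) = snd C (fst q)" "dir \<Psi> C (snd \<Psi> q) = snd q C"
    by (simp_all add: pos_def dir_def bundle_chart(4)[OF \<Psi> q])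
  have y: "snd \<Psi> q \<in> snd \<Psi> ` fst \<Psi>" using q by simp
  have "in_chart A g C (snd C (fst q)) (ver \<Psi> C (snd \<Psi> q) v) (snd q C) = 0"
    using Y_unit[OF y, of v] by (simp add: pd)
  then show ?thesis
    unfolding kk_metric_def H_def
      kaluza_klein_parts[OF qT base_chart_at[OF b q] inclusion_diff_parts[OF b q \<xi>] inclusion_diff_parts[OF b q \<eta>]]
    by (simp add: pd)
qed

lemma in_chart_kk:
  assumes b: "base_chart \<Psi> C" and y: "y \<in> snd \<Psi> ` fst \<Psi>"
  shows "in_chart B kk \<Psi> y = kk_coord \<Psi> C y"
proof (intro ext)
  fix v w
  have \<Psi>: "\<Psi> \<in> B" using b by (simp add: base_chart_def)
  obtain q where q: "q \<in> fst \<Psi>" "y = snd \<Psi> q" using y by blast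
  show "in_chart B kk \<Psi> y v w = kk_coord \<Psi> C y v w"
    unfolding in_chart_def[of B kk \<Psi>] q(2) bundle_chart(4)[OF \<Psi> q(1)]
    by (rule kk_metric_eq[OF b q(1)]) (simp_all add: tvec_of_def)
qed

text \<open>The link that makes \<open>koszul_H\<close> applicable to the connection of
  \<open>kk_metric\<close>: its components are \<open>H\<close>, and \<open>H'\<close> is their
  derivative.\<close>

lemma christoffel_kk:
  assumes b: "base_chart \<Psi> C" and y: "y \<in> snd \<Psi> ` fst \<Psi>"
  shows "levi_civita_form (kk_coord \<Psi> C y) (kk_coord' \<Psi> C y) (christoffel B kk \<Psi> y)"
proof -
  interpret unit_immersion "snd C ` fst C" "in_chart A g C" "christoffel A g C"
    "\<lambda>z u v w. frechet_derivative (\<lambda>z. christoffel A g C z v w) (at z) u" \<kappa>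
    "snd \<Psi> ` fst \<Psi>" "pos \<Psi> C" "dir \<Psi> C" "a + c" d a
    by (rule unit_immersion_base_chart[OF b])
  note H = in_chart_kk[OF b]
  have der: "((\<lambda>z. in_chart B kk \<Psi> z v w) has_derivative (\<lambda>u. kk_coord' \<Psi> C y u v w)) (at y)" for v w
    by (rule has_derivative_transform_within_open[OF has_derivative_H[OF y] open_U y]) (simp add: H)
  have "levi_civita_form (in_chart B kk \<Psi> y) (kk_coord' \<Psi> C y) (christoffel B kk \<Psi> y)"
    by (rule christoffel_levi_civita_form[OF open_U y _ _ _ der])
       (auto simp: H y bilinear_H sym_H intro: nondegenerate_H[OF y])
  then show ?thesis by (simp add: H[OF y])
qed

end

section \<open>Horizontal curves in the unit tangent bundle\<close>

lemma Ck_on_has_vector_derivative: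
  fixes f :: "real \<Rightarrow> 'b::euclidean_space"
  assumes "Ck_on (Suc k) f J" "s \<in> J"
  shows "(f has_vector_derivative vector_derivative f (at s)) (at s)"
    and "vector_derivative f (at s) = frechet_derivative f (at s) 1"
proof -
  note f = has_derivative_Ck_on[OF assms]
  have "frechet_derivative f (at s) r = r *\<^sub>R frechet_derivative f (at s) 1" for r
    using linear_scale[OF has_derivative_linear[OF f], of r 1] by simp
  then have *: "(f has_vector_derivative frechet_derivative f (at s) 1) (at s)"
    unfolding has_vector_derivative_def by (intro has_derivative_eq_rhs[OF f] ext)
  then show "vector_derivative f (at s) = frechet_derivative f (at s) 1" by (rule vector_derivative_at)
  with * show "(f has_vector_derivative vector_derivative f (at s)) (at s)" by simp
qed

text \<open>A continuous image of a connected set inside two points is empty or a single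
  point.\<close>

lemma constant_of_constant_square:
  fixes f :: "real \<Rightarrow> real"
  assumes "connected J" "continuous_on J f" "\<And>t. t \<in> J \<Longrightarrow> (f t)\<^sup>2 = r"
  shows "\<exists>s\<in>{1, -1}. \<forall>t\<in>J. f t = s * sqrt r"
proof -
  have sub: "f ` J \<subseteq> {sqrt r, - sqrt r}"
  proof
    fix y assume "y \<in> f ` J"
    then have "r = y\<^sup>2" using assms(3) by auto
    then show "y \<in> {sqrt r, - sqrt r}" by (auto simp: abs_if)
  qed
  then have "finite (f ` J)" by (rule finite_subset) simp
  then have "f ` J = {} \<or> (\<exists>y. f ` J = {y})"
    using connected_finite_iff_sing[OF connected_continuous_image[OF assms(2,1)]] by blast
  then show ?thesis using sub by fastforce
qed

locale kaluza_klein_curve = kaluza_klein_surface A g \<kappa> a c d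
  for A :: "('m, real^2) chart set" and g :: "('m, real^2) metric" and \<kappa> a c d :: real +
  fixes I :: "real set" and \<gamma> :: "real \<Rightarrow> ('m, real^2) tpoint"
  assumes open_I: "open I" and smooth: "smooth_curve B I \<gamma>" and parallel: "horizontal_curve A g I \<gamma>"
begin

abbreviation x where "x \<equiv> fst \<circ> \<gamma>"
abbreviation T where "T \<equiv> velocity B \<gamma>"

text \<open>An open set of times but in general not an interval; constancy on \<open>I\<close>
  therefore has to come from continuity on \<open>I\<close> and not from single charts.\<close>

definition chart_times where "chart_times \<Psi> = {t \<in> I. \<gamma> t \<in> fst \<Psi>}" for \<Psi> :: "(('m, real^2) tpoint, real^3) chart"

definition angle where "angle t = g (x t) (velocity A x t) (snd (\<gamma> t))"

lemma exists_chart: "t \<in> I \<Longrightarrow> \<exists>\<Psi> C. base_chart \<Psi> C \<and> t \<in> chart_times \<Psi>"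
  using smooth exists_base_chart unfolding smooth_curve_def points_def chart_times_def by blast

lemma open_chart_times: "\<Psi> \<in> B \<Longrightarrow> open (chart_times \<Psi>)"
  and coords_Ck_on: "\<Psi> \<in> B \<Longrightarrow> Ck_on k (\<lambda>s. snd \<Psi> (\<gamma> s)) (chart_times \<Psi>)"
  using smooth unfolding smooth_curve_def smooth_on_def chart_times_def comp_def by blast+

lemma T_eq: "\<Psi> \<in> B \<Longrightarrow> s \<in> chart_times \<Psi> \<Longrightarrow> T s \<Psi> = vector_derivative (\<lambda>s. snd \<Psi> (\<gamma> s)) (at s)"
  by (simp add: velocity_def charts_at_def chart_times_def comp_def)

lemma coords_has_vector_derivative:
  "\<Psi> \<in> B \<Longrightarrow> s \<in> chart_times \<Psi> \<Longrightarrow> ((\<lambda>s. snd \<Psi> (\<gamma> s)) has_vector_derivative T s \<Psi>) (at s)"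
  using Ck_on_has_vector_derivative(1)[OF coords_Ck_on] by (simp add: T_eq)

lemma T_has_vector_derivative:
  assumes \<Psi>: "\<Psi> \<in> B" and s: "s \<in> chart_times \<Psi>"
  shows "((\<lambda>s. T s \<Psi>) has_vector_derivative vector_derivative (\<lambda>s. T s \<Psi>) (at s)) (at s)"
proof -
  have "Ck_on (Suc 0) (\<lambda>s. frechet_derivative (\<lambda>s. snd \<Psi> (\<gamma> s)) (at s) 1) (chart_times \<Psi>)"
    using coords_Ck_on[OF \<Psi>, of "Suc (Suc 0)"] by (simp only: Ck_on.simps(2)[of "Suc 0"])
  then have "Ck_on (Suc 0) (\<lambda>s. T s \<Psi>) (chart_times \<Psi>)"
    by (rule Ck_on_cong[OF open_chart_times[OF \<Psi>], rotated])
       (simp add: T_eq[OF \<Psi>] Ck_on_has_vector_derivative(2)[OF coords_Ck_on[OF \<Psi>]])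
  from Ck_on_has_vector_derivative(1)[OF this s] show ?thesis .
qed

lemma pos_dir:
  assumes "base_chart \<Psi> C" "s \<in> chart_times \<Psi>"
  shows "pos \<Psi> C (snd \<Psi> (\<gamma> s)) = snd C (x s)" "dir \<Psi> C (snd \<Psi> (\<gamma> s)) = snd (\<gamma> s) C"
  using assms bundle_chart(4)[of \<Psi> "\<gamma> s"] by (simp_all add: pos_def dir_def chart_times_def base_chart_def)

text \<open>The compatibility that the lemmas on \<open>inclusion_diff\<close> ask of a tangent
  vector, obtained for the velocity by the chain rule.\<close>

lemma T_rep:
  assumes \<Psi>: "\<Psi> \<in> B" and s: "s \<in> chart_times \<Psi>"
  shows "\<forall>\<Psi>'\<in>charts_at B (\<gamma> s).
    T s \<Psi>' = frechet_derivative (transition \<Psi> \<Psi>') (at (snd \<Psi> (\<gamma> s))) (T s \<Psi>)"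
proof
  fix \<Psi>' assume \<Psi>': "\<Psi>' \<in> charts_at B (\<gamma> s)"
  then have \<Psi>'B: "\<Psi>' \<in> B" "s \<in> chart_times \<Psi>'" using s by (auto simp: charts_at_def chart_times_def)
  have ch: "\<Psi> \<in> charts_at B (\<gamma> s)" using \<Psi> s by (simp add: charts_at_def chart_times_def)
  have "((\<lambda>s. snd \<Psi>' (\<gamma> s)) has_vector_derivative
      frechet_derivative (transition \<Psi> \<Psi>') (at (snd \<Psi> (\<gamma> s))) (T s \<Psi>)) (at s)"
    by (rule velocity_change[OF bundle_chart(2)[OF \<Psi>] open_chart_times[OF \<Psi>] s _
          coords_has_vector_derivative[OF \<Psi> s] bundle_transition(1)[OF ch \<Psi>']])
       (simp add: chart_times_def)
  then show "T s \<Psi>' = frechet_derivative (transition \<Psi> \<Psi>') (at (snd \<Psi> (\<gamma> s))) (T s \<Psi>)"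
    using T_eq[OF \<Psi>'B] vector_derivative_at by metis
qed

context
  fixes \<Psi> :: "(('m, real^2) tpoint, real^3) chart" and C :: "('m, real^2) chart"
  assumes base: "base_chart \<Psi> C"
begin

interpretation unit_immersion "snd C ` fst C" "in_chart A g C" "christoffel A g C"
  "\<lambda>z u v w. frechet_derivative (\<lambda>z. christoffel A g C z v w) (at z) u" \<kappa>
  "snd \<Psi> ` fst \<Psi>" "pos \<Psi> C" "dir \<Psi> C" "a + c" d a
  by (rule unit_immersion_base_chart[OF base])

lemma \<Psi>B: "\<Psi> \<in> B" and CA: "C \<in> A" using base by (simp_all add: base_chart_def)

lemma in_U: "s \<in> chart_times \<Psi> \<Longrightarrow> snd \<Psi> (\<gamma> s) \<in> snd \<Psi> ` fst \<Psi>"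
  by (simp add: chart_times_def)

lemma x_in_C: "s \<in> chart_times \<Psi> \<Longrightarrow> C \<in> charts_at A (x s)"
  using base_chart_at[OF base, of "\<gamma> s"] by (simp add: chart_times_def)

lemma unit_bundle: "s \<in> chart_times \<Psi> \<Longrightarrow> \<gamma> s \<in> unit_tangent_bundle A g"
  using bundle_chart(1)[OF \<Psi>B] by (auto simp: chart_times_def)

lemma x_has_vector_derivative:
  assumes s: "s \<in> chart_times \<Psi>"
  shows "((\<lambda>s. snd C (x s)) has_vector_derivative hor \<Psi> C (snd \<Psi> (\<gamma> s)) (T s \<Psi>)) (at s)"
  by (rule has_vector_derivative_transform_within_open[OF
        p_along_curve[OF in_U[OF s] coords_has_vector_derivative[OF \<Psi>B s]] open_chart_times[OF \<Psi>B] s])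
     (simp only: pos_dir(1)[OF base])

lemma V_has_vector_derivative:
  assumes s: "s \<in> chart_times \<Psi>"
  shows "((\<lambda>s. snd (\<gamma> s) C) has_vector_derivative
    frechet_derivative (dir \<Psi> C) (at (snd \<Psi> (\<gamma> s))) (T s \<Psi>)) (at s)"
  by (rule has_vector_derivative_transform_within_open[OF
        u_along_curve[OF in_U[OF s] coords_has_vector_derivative[OF \<Psi>B s]] open_chart_times[OF \<Psi>B] s])
     (simp only: pos_dir(2)[OF base])

lemma velocity_x:
  assumes s: "s \<in> chart_times \<Psi>"
  shows "velocity A x s = tvec_of A (x s) C (hor \<Psi> C (snd \<Psi> (\<gamma> s)) (T s \<Psi>))"
proof
  fix D
  have inj: "inj_on (snd C) (fst C)"
    using A CA unfolding smooth_manifold_def smooth_atlas_def by blast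
  show "velocity A x s D = tvec_of A (x s) C (hor \<Psi> C (snd \<Psi> (\<gamma> s)) (T s \<Psi>)) D"
  proof (cases "D \<in> charts_at A (x s)")
    case True
    have "transition C D differentiable (at (snd C (x s)))"
      using transition_has_derivative[OF A x_in_C[OF s] True] unfolding differentiable_def by blast
    from velocity_change[OF inj open_chart_times[OF \<Psi>B] s _ x_has_vector_derivative[OF s] this]
    have "((\<lambda>s. snd D (x s)) has_vector_derivative frechet_derivative (transition C D) (at (snd C (x s)))
        (hor \<Psi> C (snd \<Psi> (\<gamma> s)) (T s \<Psi>))) (at s)"
      using x_in_C by (auto simp: charts_at_def)
    from vector_derivative_at[OF this] True show ?thesis
      by (simp add: velocity_def tvec_of_def comp_def)
  qed (simp add: velocity_def tvec_of_def)
qed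

lemma velocity_x_C: "s \<in> chart_times \<Psi> \<Longrightarrow> velocity A x s C = hor \<Psi> C (snd \<Psi> (\<gamma> s)) (T s \<Psi>)"
  using velocity_x tvec_of_apply[OF A x_in_C] by metis

lemma ver_T:
  assumes s: "s \<in> chart_times \<Psi>"
  shows "ver \<Psi> C (snd \<Psi> (\<gamma> s)) (T s \<Psi>) = 0"
proof -
  have "cov_deriv A g x (snd \<circ> \<gamma>) s C = 0"
    using parallel s unfolding horizontal_curve_def chart_times_def by simp
  then show ?thesis
    using x_in_C[OF s] vector_derivative_at[OF V_has_vector_derivative[OF s]]
    by (simp add: cov_deriv_def Y_def velocity_x_C[OF s] pos_dir[OF base s])
qed

lemma angle_eq:
  assumes s: "s \<in> chart_times \<Psi>"
  shows "angle s = in_chart A g C (pos \<Psi> C (snd \<Psi> (\<gamma> s))) (hor \<Psi> C (snd \<Psi> (\<gamma> s)) (T s \<Psi>))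
    (dir \<Psi> C (snd \<Psi> (\<gamma> s)))"
proof -
  have "snd (\<gamma> s) = tvec_of A (x s) C (snd (\<gamma> s) C)"
    using unit_tangent_vector(1)[OF unit_bundle[OF s]] x_in_C[OF s] by simp
  then show ?thesis
    unfolding angle_def velocity_x[OF s] pos_dir[OF base s] in_chart_eq[OF A x_in_C[OF s]] by simp
qed

lemma isCont_angle:
  assumes s: "s \<in> chart_times \<Psi>"
  shows "isCont angle s"
proof -
  note b = in_U[OF s] coords_has_vector_derivative[OF \<Psi>B s]
  note r = has_real_derivative_metric[OF p_S[OF b(1)] p_along_curve[OF b]
    X_along_curve[OF b T_has_vector_derivative[OF \<Psi>B s]] u_along_curve[OF b]]
  have "\<forall>\<^sub>F r in nhds s. in_chart A g C (pos \<Psi> C (snd \<Psi> (\<gamma> r))) (hor \<Psi> C (snd \<Psi> (\<gamma> r)) (T r \<Psi>))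
    (dir \<Psi> C (snd \<Psi> (\<gamma> r))) = angle r"
    using eventually_nhds_in_open[OF open_chart_times[OF \<Psi>B] s] by eventually_elim (simp only: angle_eq)
  with DERIV_isCont[OF r] show ?thesis by (simp add: isCont_cong)
qed

text \<open>The horizontal lift of V has horizontal part V and vertical part zero. Since g(V, V) =
  1, both horizontal terms of the metric are multiples of g(x', V), with coefficients a + c and
  d.\<close>

lemma kaluza_klein_geodesic_field:
  assumes s: "s \<in> chart_times \<Psi>"
  shows "kaluza_klein A g a c d (\<gamma> s) (inclusion_diff A g (\<gamma> s) (T s))
    (horizontal_lift A g (\<gamma> s) (snd (\<gamma> s))) = (a + c + d) * angle s"
proof -
  let ?q = "\<gamma> s"
  have q: "?q \<in> fst \<Psi>" using s by (simp add: chart_times_def)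
  note qT = unit_bundle[OF s]
  note C = base_chart_at[OF base q]
  have "snd ?q \<in> tangent_space A (fst ?q)" using qT by (auto simp: unit_tangent_bundle_def)
  then have V: "snd ?q D = 0" if "D \<notin> charts_at A (fst ?q)" for D
    using that unfolding tangent_space_def by blast
  have "horizontal_part A ?q (horizontal_lift A g ?q (snd ?q)) = snd ?q"
    using V by (auto simp: horizontal_part_def horizontal_lift_def)
  also have "\<dots> = tvec_of A (fst ?q) C (snd ?q C)" by (rule unit_tangent_vector(1)[OF qT C])
  finally have hp: "horizontal_part A ?q (horizontal_lift A g ?q (snd ?q)) = tvec_of A (fst ?q) C (snd ?q C)" .
  have lin0: "frechet_derivative (transition C D) (at (snd C (fst ?q))) 0 = 0"
    if "D \<in> charts_at A (fst ?q)" for D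
    by (rule linear_0[OF has_derivative_linear[OF transition_has_derivative[OF A C that]]])
  have vp: "vertical_part A g ?q (horizontal_lift A g ?q (snd ?q)) = tvec_of A (fst ?q) C 0"
    by (rule ext) (simp add: vertical_part_def horizontal_lift_def tvec_of_def lin0)
  have z: "snd C (fst ?q) \<in> snd C ` fst C" using C by (simp add: charts_at_def)
  note l = bilinear_lzero[OF bil[OF z]] bilinear_rzero[OF bil[OF z]]
  show ?thesis
    unfolding kaluza_klein_parts[OF qT C inclusion_diff_parts[OF base q T_rep[OF \<Psi>B s]] hp vp]
      angle_eq[OF s] pos_dir[OF base s]
    using unit_tangent_vector(2)[OF qT C] by (simp add: l ver_T[OF s] algebra_simps)
qed

text \<open>In the chart \<open>C\<close> the base curve is \<open>pos \<Psi> C\<close> after the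
  coordinates of the curve. A transition leads to \<open>D\<close>, on the open set of times at
  which the base point lies in both charts.\<close>

lemma x_Ck_on:
  assumes D: "D \<in> A" and s: "s \<in> chart_times \<Psi>" "x s \<in> fst D"
  shows "\<exists>V. open V \<and> s \<in> V \<and> V \<subseteq> {r \<in> I. x r \<in> fst D} \<and> Ck_on k (snd D \<circ> x) V"
proof -
  let ?M = "snd C ` (fst C \<inter> fst D)" and ?p = "\<lambda>r. snd C (x r)"
  define V where "V = {r \<in> chart_times \<Psi>. ?p r \<in> ?M}"
  have M: "open ?M" by (rule transition_open[OF A CA D])
  have "Ck_on k (\<lambda>r. pos \<Psi> C (snd \<Psi> (\<gamma> r))) (chart_times \<Psi>)" for k
    using Ck_on_compose[OF open_chart_times[OF \<Psi>B] open_U _ coords_Ck_on[OF \<Psi>B] p_Ck] in_U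
    by (auto simp: comp_def)
  then have p: "Ck_on k ?p (chart_times \<Psi>)" for k
    by (rule Ck_on_cong[OF open_chart_times[OF \<Psi>B], rotated]) (simp only: pos_dir(1)[OF base])
  then have "continuous_on (chart_times \<Psi>) ?p" by (rule Ck_on_continuous_on)
  then have V: "open V"
    using continuous_open_preimage[OF _ open_chart_times[OF \<Psi>B] M] unfolding V_def vimage_def Int_def by simp
  have inV: "x r \<in> fst C \<and> x r \<in> fst D \<longleftrightarrow> r \<in> V" if "r \<in> chart_times \<Psi>" for r
  proof
    assume "r \<in> V"
    then obtain y where y: "?p r = snd C y" "y \<in> fst C" "y \<in> fst D" by (auto simp: V_def)
    have C: "x r \<in> fst C" using x_in_C[OF that] by (simp add: charts_at_def)
    have "x r = param C (?p r)" by (rule param_chart[OF A CA C, symmetric])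
    also have "\<dots> = y" unfolding y(1) by (rule param_chart[OF A CA y(2)])
    finally show "x r \<in> fst C \<and> x r \<in> fst D" using y by simp
  qed (use that in \<open>auto simp: V_def\<close>)
  have "Ck_on k (transition C D \<circ> ?p) V"
    by (rule Ck_on_compose[OF V M _ Ck_on_subset[OF p] transition_Ck_on[OF A CA D]]) (auto simp: V_def)
  then have "Ck_on k (snd D \<circ> x) V"
  proof (rule Ck_on_cong[OF V, rotated])
    fix r assume "r \<in> V"
    then have "x r \<in> fst C" using inV by (auto simp: V_def)
    then show "(transition C D \<circ> ?p) r = (snd D \<circ> x) r" by (simp add: transition_apply[OF A CA])
  qed
  moreover have "s \<in> V" using inV[OF s(1)] x_in_C[OF s(1)] s(2) by (simp add: charts_at_def)
  moreover have "V \<subseteq> {r \<in> I. x r \<in> fst D}" using inV by (auto simp: V_def chart_times_def)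
  ultimately show ?thesis using V by blast
qed

text \<open>The premise concerns the one chart \<open>C\<close>, while the conclusion is a family
  over all charts \<open>D\<close>. Where the covariant acceleration vanishes, the velocity
  components in \<open>C\<close> have derivative \<open>- ?G\<close>; passing to \<open>D\<close>
  adds the second derivative of the transition, and the transformation law makes the Christoffel
  term of \<open>D\<close> cancel the sum.\<close>

lemma cov_deriv_velocity_zero:
  assumes s: "s \<in> chart_times \<Psi>"
    and 0: "X' (snd \<Psi> (\<gamma> s)) (T s \<Psi>) (T s \<Psi>)
      + hor \<Psi> C (snd \<Psi> (\<gamma> s)) (vector_derivative (\<lambda>s. T s \<Psi>) (at s)) = 0"
  shows "cov_deriv A g x (velocity A x) s = (\<lambda>_. 0)"
proof
  fix D
  show "cov_deriv A g x (velocity A x) s D = 0"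
  proof (cases "D \<in> charts_at A (x s)")
    case True
    define J where "J = (\<lambda>z. frechet_derivative (transition C D) (at z))"
    define v where "v = (\<lambda>r. hor \<Psi> C (snd \<Psi> (\<gamma> r)) (T r \<Psi>))"
    let ?M = "snd C ` (fst C \<inter> fst D)" and ?G = "christoffel A g C (snd C (x s)) (v s) (v s)"
    let ?D2 = "frechet_derivative (\<lambda>z. J z (v s)) (at (snd C (x s)))"
    have D: "D \<in> A" "x s \<in> fst D" using True by (auto simp: charts_at_def)
    have M: "open ?M" "snd C (x s) \<in> ?M"
      using transition_open[OF A CA D(1)] x_in_C[OF s] D by (auto simp: charts_at_def)
    note Ck = transition_Ck_on[OF A CA D(1)]
    have "Ck_on (Suc 0) (\<lambda>z. J z w) ?M" for w
      using Ck[of "Suc (Suc 0)"] unfolding J_def by (simp only: Ck_on.simps(2)[of "Suc 0"] simp_thms)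
    note J' = has_derivative_Ck_on[OF this M(2)]
    have linJ: "linear (J z)" if "z \<in> ?M" for z
      unfolding J_def by (rule has_derivative_linear[OF has_derivative_Ck_on[OF Ck that]])
    have v': "(v has_vector_derivative - ?G) (at s)"
      using X_along_curve[OF in_U[OF s] coords_has_vector_derivative[OF \<Psi>B s] T_has_vector_derivative[OF \<Psi>B s]]
      by (simp add: v_def 0 pos_dir[OF base s])
    have x': "((\<lambda>r. snd C (x r)) has_vector_derivative v s) (at s)"
      using x_has_vector_derivative[OF s] by (simp add: v_def)
    have "((\<lambda>r. J (snd C (x r)) (v r)) has_vector_derivative ?D2 (v s) + J (snd C (x s)) (- ?G)) (at s)"
      using has_derivative_linear_family[OF M(1) M(2) linJ J' x'[unfolded has_vector_derivative_def]
          v'[unfolded has_vector_derivative_def]]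
      unfolding has_vector_derivative_def linear_scale[OF linJ[OF M(2)]]
        linear_scale[OF has_derivative_linear[OF J']] scaleR_add_right .
    moreover obtain V where V: "open V" "s \<in> V" "V \<subseteq> {r \<in> I. x r \<in> fst D}"
      using x_Ck_on[OF D(1) s D(2)] by blast
    have "((\<lambda>r. velocity A x r D) has_vector_derivative ?D2 (v s) + J (snd C (x s)) (- ?G)) (at s)"
    proof (rule has_vector_derivative_transform_within_open[OF calculation])
      show "open (V \<inter> chart_times \<Psi>)" "s \<in> V \<inter> chart_times \<Psi>" using V open_chart_times[OF \<Psi>B] s by auto
      fix r assume r: "r \<in> V \<inter> chart_times \<Psi>"
      then have "D \<in> charts_at A (x r)" using V(3) D(1) by (auto simp: charts_at_def)
      then show "J (snd C (x r)) (v r) = velocity A x r D"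
        using velocity_x[of r] r by (simp add: tvec_of_def J_def v_def)
    qed
    note vd = vector_derivative_at[OF this]
    have "velocity A x s D = J (snd C (x s)) (v s)"
      using velocity_x[OF s] True by (simp add: tvec_of_def J_def v_def)
    moreover have "J (snd C (x s)) ?G = ?D2 (v s)
        + christoffel A g D (snd D (x s)) (J (snd C (x s)) (v s)) (J (snd C (x s)) (v s))"
      unfolding J_def by (rule christoffel_change[OF A g K x_in_C[OF s] True])
    moreover have "J (snd C (x s)) (- ?G) = - J (snd C (x s)) ?G"
      by (rule linear_neg[OF linJ[OF M(2)]])
    ultimately show ?thesis
      using True by (simp add: cov_deriv_def vd)
  qed (simp add: cov_deriv_def)
qed

text \<open>Reads the invariant Frenet equations as their components in \<open>\<Psi>\<close>. The
  vanishing of \<open>\<tau>\<close> removes \<open>W2\<close> from the derivative of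
  \<open>W1\<close>, so the third equation of the frame does not enter the local system.\<close>

lemma horizontal_frenet_curve_local:
  assumes F: "frenet_curve B kk I \<gamma> W1 W2 \<epsilon> \<epsilon>1 \<epsilon>2 k \<tau>" and \<tau>: "\<forall>t\<in>I. \<tau> t = 0"
    and f: "\<And>t. t \<in> I \<Longrightarrow> angle t = f"
  shows "horizontal_frenet_curve (snd C ` fst C) (in_chart A g C) (christoffel A g C)
    (\<lambda>z u v w. frechet_derivative (\<lambda>z. christoffel A g C z v w) (at z) u) \<kappa>
    (snd \<Psi> ` fst \<Psi>) (pos \<Psi> C) (dir \<Psi> C) (a + c) d a (chart_times \<Psi>) (\<lambda>s. snd \<Psi> (\<gamma> s))
    (\<lambda>s. T s \<Psi>) (\<lambda>s. vector_derivative (\<lambda>s. T s \<Psi>) (at s))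
    (\<lambda>s. W1 s \<Psi>) (\<lambda>s. vector_derivative (\<lambda>s. W1 s \<Psi>) (at s))
    (\<lambda>s. christoffel B kk \<Psi> (snd \<Psi> (\<gamma> s))) k \<epsilon> \<epsilon>1 f"
proof
  note F = F[unfolded frenet_curve_def Let_def]
  have W1: "W1 s \<in> tangent_space B (\<gamma> s)" if "s \<in> I" for s
    using F that unfolding smooth_field_along_def by blast
  have W1_Ck: "Ck_on k (\<lambda>s. W1 s \<Psi>) (chart_times \<Psi>)" for k
    using F \<Psi>B unfolding smooth_field_along_def smooth_on_def chart_times_def by blast
  have eps: "\<epsilon> \<in> {1, -1}" "\<epsilon>1 \<in> {1, -1}" using F by blast+
  then show "\<epsilon>\<^sup>2 = 1" "\<epsilon>1\<^sup>2 = 1" by auto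
  show "open (chart_times \<Psi>)" by (rule open_chart_times[OF \<Psi>B])
  fix s assume s: "s \<in> chart_times \<Psi>"
  have sI: "s \<in> I" and q: "\<gamma> s \<in> fst \<Psi>" using s by (auto simp: chart_times_def)
  have ch: "\<Psi> \<in> charts_at B (\<gamma> s)" using \<Psi>B q by (simp add: charts_at_def)
  have W1_rep: "\<forall>\<Psi>'\<in>charts_at B (\<gamma> s).
      W1 s \<Psi>' = frechet_derivative (transition \<Psi> \<Psi>') (at (snd \<Psi> (\<gamma> s))) (W1 s \<Psi>)"
    using W1[OF sI] ch unfolding tangent_space_def by blast
  have GT: "kk (\<gamma> s) (T s) (T s) = \<epsilon>" and GW: "kk (\<gamma> s) (W1 s) (W1 s) = \<epsilon>1" and k: "k s \<noteq> 0"
    and dT: "cov_deriv B kk \<gamma> T s = (\<lambda>C. (\<epsilon>1 * k s) *\<^sub>R W1 s C)"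
    and dW: "cov_deriv B kk \<gamma> W1 s = (\<lambda>C. - (\<epsilon> * k s) *\<^sub>R T s C - (\<epsilon>2 * \<tau> s) *\<^sub>R W2 s C)"
    using F sI by blast+
  show "snd \<Psi> (\<gamma> s) \<in> snd \<Psi> ` fst \<Psi>" by (rule in_U[OF s])
  show "((\<lambda>s. snd \<Psi> (\<gamma> s)) has_vector_derivative T s \<Psi>) (at s)"
    by (rule coords_has_vector_derivative[OF \<Psi>B s])
  show "((\<lambda>s. T s \<Psi>) has_vector_derivative vector_derivative (\<lambda>s. T s \<Psi>) (at s)) (at s)"
    by (rule T_has_vector_derivative[OF \<Psi>B s])
  show "((\<lambda>s. W1 s \<Psi>) has_vector_derivative vector_derivative (\<lambda>s. W1 s \<Psi>) (at s)) (at s)"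
    by (rule Ck_on_has_vector_derivative(1)[OF W1_Ck s])
  show "levi_civita_form (kk_coord \<Psi> C (snd \<Psi> (\<gamma> s))) (kk_coord' \<Psi> C (snd \<Psi> (\<gamma> s)))
      (christoffel B kk \<Psi> (snd \<Psi> (\<gamma> s)))"
    by (rule christoffel_kk[OF base in_U[OF s]])
  show "vector_derivative (\<lambda>s. T s \<Psi>) (at s) + christoffel B kk \<Psi> (snd \<Psi> (\<gamma> s)) (T s \<Psi>) (T s \<Psi>) =
      (\<epsilon>1 * k s) *\<^sub>R W1 s \<Psi>"
    using fun_cong[OF dT, of \<Psi>] ch by (simp add: cov_deriv_def)
  show "vector_derivative (\<lambda>s. W1 s \<Psi>) (at s) + christoffel B kk \<Psi> (snd \<Psi> (\<gamma> s)) (T s \<Psi>) (W1 s \<Psi>) =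
      - (\<epsilon> * k s) *\<^sub>R T s \<Psi>"
    using fun_cong[OF dW, of \<Psi>] ch \<tau> sI by (simp add: cov_deriv_def)
  show "kk_coord \<Psi> C (snd \<Psi> (\<gamma> s)) (T s \<Psi>) (T s \<Psi>) = \<epsilon>"
    using kk_metric_eq[OF base q T_rep[OF \<Psi>B s] T_rep[OF \<Psi>B s]] GT by simp
  show "kk_coord \<Psi> C (snd \<Psi> (\<gamma> s)) (W1 s \<Psi>) (W1 s \<Psi>) = \<epsilon>1"
    using kk_metric_eq[OF base q W1_rep W1_rep] GW by simp
  show "k s \<noteq> 0" by (rule k)
  show "ver \<Psi> C (snd \<Psi> (\<gamma> s)) (T s \<Psi>) = 0" by (rule ver_T[OF s])
  show "in_chart A g C (pos \<Psi> C (snd \<Psi> (\<gamma> s))) (hor \<Psi> C (snd \<Psi> (\<gamma> s)) (T s \<Psi>))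
      (dir \<Psi> C (snd \<Psi> (\<gamma> s))) = f"
    using angle_eq[OF s] f[OF sI] by simp
qed

end

lemma smooth_curve_x: "smooth_curve A I x"
  unfolding smooth_curve_def smooth_on_def
proof (intro conjI ballI allI)
  fix t assume "t \<in> I"
  then obtain \<Psi> C where "base_chart \<Psi> C" "t \<in> chart_times \<Psi>" using exists_chart by blast
  from x_in_C[OF this] show "x t \<in> points A" by (auto simp: points_def charts_at_def)
next
  fix D k assume D: "D \<in> A"
  let ?S = "{t \<in> I. x t \<in> fst D}"
  have loc: "\<exists>V. open V \<and> t \<in> V \<and> V \<subseteq> ?S \<and> Ck_on k (snd D \<circ> x) V" if t: "t \<in> ?S" for t k
  proof -
    obtain \<Psi> C where "base_chart \<Psi> C" "t \<in> chart_times \<Psi>" using exists_chart t by blast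
    then show ?thesis using x_Ck_on[OF _ D] t by blast
  qed
  then show "open ?S" by (subst open_subopen) blast
  show "Ck_on k (snd D \<circ> x) ?S" by (rule Ck_on_local) (use loc in blast)
qed

lemma helix_iff:
  "helix_geodesic_field A g a c d I \<gamma> \<longleftrightarrow> (\<exists>f. \<forall>t\<in>I. angle t = f)"
proof -
  have "kaluza_klein A g a c d (\<gamma> t) (inclusion_diff A g (\<gamma> t) (T t))
      (horizontal_lift A g (\<gamma> t) (snd (\<gamma> t))) = (a + c + d) * angle t" if "t \<in> I" for t
    using exists_chart[OF that] kaluza_klein_geodesic_field by blast
  then have "helix_geodesic_field A g a c d I \<gamma> \<longleftrightarrow> (\<exists>K. \<forall>t\<in>I. (a + c + d) * angle t = K)"
    by (simp add: helix_geodesic_field_def)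
  also have "\<dots> \<longleftrightarrow> (\<exists>f. \<forall>t\<in>I. angle t = f)"
    using acd_nz by (metis nonzero_mult_div_cancel_left)
  finally show ?thesis .
qed

lemma continuous_on_angle: "continuous_on I angle"
  using exists_chart isCont_angle by (intro continuous_at_imp_continuous_on) blast

end

theorem theorem0p2:
  fixes A :: "('m, real^2) chart set" and g :: "('m, real^2) metric"
    and \<kappa> a c d \<alpha> \<phi> :: real
    and I :: "real set" and \<gamma> :: "real \<Rightarrow> ('m, real^2) tpoint"
    and W1 W2 :: "real \<Rightarrow> (('m, real^2) tpoint, real^3) tvec"
    and \<epsilon> \<epsilon>1 \<epsilon>2 :: real and k \<tau> :: "real \<Rightarrow> real"
  assumes "smooth_manifold A" and "pseudo_riemannian_metric A g"
    and "constant_gaussian_curvature A g \<kappa>" and "\<kappa> \<noteq> 0"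
    and "\<alpha> = a * (a + c)" and "\<alpha> \<noteq> 0" and "\<phi> = a + c + d" and "\<phi> \<noteq> 0"
    and "(a + c) / a = \<kappa>" and "\<bar>\<phi>\<bar> = 4 * \<bar>\<alpha>\<bar>"
    and "open I" and "is_interval I" and "I \<noteq> {}"
    and "frenet_curve (unit_bundle_atlas A g) (kk_metric A g a c d) I \<gamma> W1 W2 \<epsilon> \<epsilon>1 \<epsilon>2 k \<tau>"
    and "\<forall>t\<in>I. \<tau> t = 0"
    and "horizontal_curve A g I \<gamma>"
  shows "let x = fst \<circ> \<gamma>; V = snd \<circ> \<gamma> in
         helix_geodesic_field A g a c d I \<gamma> \<longleftrightarrow>
           (d \<noteq> 0 \<and> a + c - d \<noteq> 0) \<and>
           geodesic_curve A g I x \<and>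
           (\<forall>t\<in>I. (g (x t) (velocity A x t) (V t))\<^sup>2 = \<epsilon> / (2 * d)) \<and>
           0 \<le> (d - (a + c)) / (4 * \<epsilon>1 * \<alpha>) \<and>
           (\<exists>s\<in>{1, -1}. \<forall>t\<in>I. k t = s * sqrt ((d - (a + c)) / (4 * \<epsilon>1 * \<alpha>)))"
proof -
  have nz: "a \<noteq> 0" "a + c \<noteq> 0" using assms(5,6) by auto
  note F = assms(14)
  interpret kaluza_klein_curve A g \<kappa> a c d I \<gamma>
    using assms nz by unfold_locales (auto simp: frenet_curve_def Let_def field_simps)
  have conn: "connected I" using assms(12) by (simp add: is_interval_connected)
  have ang: "g (x t) (velocity A x t) ((snd \<circ> \<gamma>) t) = angle t" for t by (simp add: angle_def)
  let ?r = "(d - (a + c)) / (4 * \<epsilon>1 * \<alpha>)"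
  show ?thesis
    unfolding Let_def ang
  proof
    assume "helix_geodesic_field A g a c d I \<gamma>"
    then obtain f where f: "\<And>t. t \<in> I \<Longrightarrow> angle t = f" using helix_iff by blast
    have local: "d \<noteq> 0 \<and> a + c - d \<noteq> 0 \<and> f\<^sup>2 = \<epsilon> / (2 * d) \<and> (k t)\<^sup>2 = ?r \<and> isCont k t \<and>
        cov_deriv A g x (velocity A x) t = (\<lambda>_. 0)" if t: "t \<in> I" for t
    proof -
      obtain \<Psi> C where b: "base_chart \<Psi> C" "t \<in> chart_times \<Psi>" using exists_chart[OF t] by blast
      interpret L: horizontal_frenet_curve "snd C ` fst C" "in_chart A g C" "christoffel A g C"
        "\<lambda>z u v w. frechet_derivative (\<lambda>z. christoffel A g C z v w) (at z) u" \<kappa>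
        "snd \<Psi> ` fst \<Psi>" "pos \<Psi> C" "dir \<Psi> C" "a + c" d a "chart_times \<Psi>" "\<lambda>s. snd \<Psi> (\<gamma> s)"
        "\<lambda>s. T s \<Psi>" "\<lambda>s. vector_derivative (\<lambda>s. T s \<Psi>) (at s)"
        "\<lambda>s. W1 s \<Psi>" "\<lambda>s. vector_derivative (\<lambda>s. W1 s \<Psi>) (at s)"
        "\<lambda>s. christoffel B kk \<Psi> (snd \<Psi> (\<gamma> s))" k \<epsilon> \<epsilon>1 f
        by (rule horizontal_frenet_curve_local[OF b(1) F assms(15) f])
      show ?thesis
        using L.curvature_angle[OF b(2)] L.isCont_curvature[OF b(2)] assms(5)
          cov_deriv_velocity_zero[OF b L.acceleration_zero[OF b(2)]] by simp
    qed
    obtain t where "t \<in> I" using assms(13) by blast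
    from local[OF this] have "d \<noteq> 0" "a + c - d \<noteq> 0" "f\<^sup>2 = \<epsilon> / (2 * d)" "(k t)\<^sup>2 = ?r" by auto
    moreover from this have "0 \<le> ?r" by (metis zero_le_power2)
    moreover have "geodesic_curve A g I x"
      using smooth_curve_x local by (simp add: geodesic_curve_def)
    \<comment> \<open>The charts determine only the square of \<open>k\<close>; continuity on the
      connected set \<open>I\<close> makes its sign the same at all times.\<close>
    moreover have "continuous_on I k" using local by (intro continuous_at_imp_continuous_on) blast
    then have "\<exists>s\<in>{1, -1}. \<forall>t\<in>I. k t = s * sqrt ?r"
      using constant_of_constant_square[OF conn] local by blast
    ultimately show "(d \<noteq> 0 \<and> a + c - d \<noteq> 0) \<and> geodesic_curve A g I x \<and>
        (\<forall>t\<in>I. (angle t)\<^sup>2 = \<epsilon> / (2 * d)) \<and> 0 \<le> ?r \<and> (\<exists>s\<in>{1, -1}. \<forall>t\<in>I. k t = s * sqrt ?r)"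
      using f by simp
  next
    assume "(d \<noteq> 0 \<and> a + c - d \<noteq> 0) \<and> geodesic_curve A g I x \<and>
        (\<forall>t\<in>I. (angle t)\<^sup>2 = \<epsilon> / (2 * d)) \<and> 0 \<le> ?r \<and> (\<exists>s\<in>{1, -1}. \<forall>t\<in>I. k t = s * sqrt ?r)"
    then have "\<exists>s\<in>{1, -1}. \<forall>t\<in>I. angle t = s * sqrt (\<epsilon> / (2 * d))"
      using constant_of_constant_square[OF conn continuous_on_angle] by blast
    then show "helix_geodesic_field A g a c d I \<gamma>" using helix_iff by blast
  qed
qed

end
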